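(* Let $d\ge1$, $\alpha,c_2>0$, and consider the directed polymer partition functions $Z_n^{\eta,\beta}$ defined in the context. For every $q\in[0,1)$, $\delta>0$ and $\beta_0\in\mathbb{R}$ there exist $C_1,C_2>0$ and $\lambda\in(0,1)$ such that for every $p\in[0,q)$, every $\beta\in[-\infty,\beta_0]$ and every $n\in\mathbb{N}$, \[Q\bigl(|\log Z_n^{\eta,\beta}-Q[\log Z_n^{\eta,\beta}]|>n^{\frac12+\delta}\bigr)<C_1\exp\{-C_2n^{\lambda}\}.\]
   Context: Let $(X_n)_{n\ge0}$ be a random walk on $\mathbb{Z}^d$ under $P$, with $X_0=0$ and $P(X_{n+1}=z\mid X_n=y)=f(|y-z|_1)$, where $|x|_1=\sum_i|x_i|$ and $f(k)=c_1\exp\{-c_2k^\alpha\}$ for $k\in\mathbb{N}\cup\{0\}$, with $c_1>0$ chosen so that $\sum_{y\in\mathbb{Z}^d}f(|y|_1)=1$. The environment $\{\eta(j,x)\}_{(j,x)\in\mathbb{N}\times\mathbb{Z}^d}$ is i.i.d. Bernoulli under $Q$ with $Q(\eta(0,0)=1)=p$, independent of the walk; $Q[\cdot]$ is expectation under $Q$. Let $H_n^\eta(X)=\sum_{j=1}^n\eta(j,X_j)$, $Z_n^{\eta,\beta}=P[\exp\{\beta H_n^\eta\}]$ for $\beta\in\mathbb{R}$, and $Z_n^{\eta,-\infty}=P(H_n^\eta=0)$. *)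

theory Defs
  imports "HOL-Probability.Probability"
begin

text \<open>Sites of Z^d are vectors int ^ d; the dimension d = CARD('d) >= 1.\<close>

definition l1norm :: "int ^ 'd \<Rightarrow> nat" where
  "l1norm x = nat (\<Sum>i\<in>UNIV. \<bar>x $ i\<bar>)"

definition c1_const :: "real \<Rightarrow> real \<Rightarrow> ('d::finite) itself \<Rightarrow> real" where
  "c1_const \<alpha> c2 _ = 1 / (\<Sum>\<^sub>\<infinity>y::int ^ 'd. exp (- c2 * real (l1norm y) powr \<alpha>))"

definition kernel_f :: "real \<Rightarrow> real \<Rightarrow> ('d::finite) itself \<Rightarrow> nat \<Rightarrow> real" where
  "kernel_f \<alpha> c2 d k = c1_const \<alpha> c2 d * exp (- c2 * real k powr \<alpha>)"

text \<open>A path (X_1,...,X_n) is a list xs of length n, X_j = xs ! (j-1), X_0 = 0.\<close>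
definition pos :: "(int ^ 'd) list \<Rightarrow> nat \<Rightarrow> int ^ 'd" where
  "pos xs j = (if j = 0 then 0 else xs ! (j - 1))"

definition path_prob :: "real \<Rightarrow> real \<Rightarrow> (int ^ 'd) list \<Rightarrow> real" where
  "path_prob \<alpha> c2 xs =
     (\<Prod>j\<in>{1..length xs}. kernel_f \<alpha> c2 TYPE('d) (l1norm (pos xs j - pos xs (j - 1))))"

definition hamiltonian :: "(nat \<times> (int ^ 'd) \<Rightarrow> bool) \<Rightarrow> (int ^ 'd) list \<Rightarrow> nat" where
  "hamiltonian \<eta> xs = card {j\<in>{1..length xs}. \<eta> (j, pos xs j)}"

text \<open>Partition function Z_n^{eta,beta} = P[exp(beta H_n)], beta in [-infinity, infinity);
  for beta = -infinity it is P(H_n = 0).\<close>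
definition partition_fn ::
  "real \<Rightarrow> real \<Rightarrow> ereal \<Rightarrow> nat \<Rightarrow> (nat \<times> (int ^ 'd) \<Rightarrow> bool) \<Rightarrow> real" where
  "partition_fn \<alpha> c2 \<beta> n \<eta> =
     (if \<beta> = -\<infinity>
      then (\<Sum>\<^sub>\<infinity>xs\<in>{xs::(int ^ 'd) list. length xs = n}.
              path_prob \<alpha> c2 xs * (if hamiltonian \<eta> xs = 0 then 1 else 0))
      else (\<Sum>\<^sub>\<infinity>xs\<in>{xs::(int ^ 'd) list. length xs = n}.
              path_prob \<alpha> c2 xs * exp (real_of_ereal \<beta> * real (hamiltonian \<eta> xs))))"

definition envQ :: "real \<Rightarrow> (nat \<times> (int ^ 'd) \<Rightarrow> bool) measure" where
  "envQ p = PiM UNIV (\<lambda>_. measure_pmf (bernoulli_pmf p))"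

end

theory Submission
  imports Defs "HOL-Real_Asymp.Real_Asymp"
begin

text \<open>
  Call an environment dense at scale \<open>r\<close> if every space-time point has an open site of its slice
  within distance \<open>r\<close>. Truncating an environment slice by slice makes it dense at scale
  \<open>r = n\<^sup>\<epsilon>\<close> and, outside an event of stretched exponentially small probability, changes
  \<open>log Z\<close> by at most \<open>log 2\<close>. In dense environments, resampling one time slice \<open>j\<close> changes
  \<open>log Z\<close> by at most a small power of \<open>n\<close>, uniformly in \<open>\<beta>\<close>: move the \<open>j\<close>-th point of the path to a
  nearby open site. Then the bounded differences inequality over the \<open>n\<close> independent slices applies.

  For \<open>\<alpha> \<le> 1\<close> the cost of moving one point is controlled by subadditivity. For \<open>\<alpha> > 1\<close> one first
  needs that under the polymer measure a jump exceeds \<open>C r n\<^sup>\<epsilon>\<close> with probability at most \<open>1/4\<close>.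
  If the jumps around time \<open>j\<close> are unusually large compared with those in a longer window, then by strict
  convexity replacing the path in that window by a straight line through open sites gains more than
  the entropy of the replaced piece; so the mean jump size can only decrease slowly along windows
  whose length grows by a fixed factor, from the jump at time \<open>j\<close> up to the whole path, where it is
  of order \<open>r\<close>.
\<close>

section \<open>Bounded differences over blocks of a product measure\<close>

definition resample :: "'i set \<Rightarrow> ('i \<Rightarrow> 'a) \<Rightarrow> ('i \<Rightarrow> 'a) \<Rightarrow> 'i \<Rightarrow> 'a" where
  "resample J \<eta> \<zeta> = (\<lambda>i. if i \<in> J then \<zeta> i else \<eta> i)"

lemma resample_resample [simp]: "resample J (resample J \<eta> \<zeta>) \<zeta>' = resample J \<eta> \<zeta>'"
  by (auto simp: resample_def)

lemma measurable_resample [measurable (raw)]: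
  assumes [measurable]: "f \<in> N \<rightarrow>\<^sub>M PiM UNIV M" "g \<in> N \<rightarrow>\<^sub>M PiM UNIV M"
  shows "(\<lambda>x. resample J (f x) (g x)) \<in> N \<rightarrow>\<^sub>M PiM UNIV M"
proof (rule measurable_PiM_single')
  fix i
  show "(\<lambda>x. resample J (f x) (g x) i) \<in> N \<rightarrow>\<^sub>M M i"
    by (cases "i \<in> J") (simp_all add: resample_def)
next
  show "(\<lambda>x. resample J (f x) (g x)) \<in> space N \<rightarrow> (\<Pi>\<^sub>E i\<in>UNIV. space (M i))"
    using measurable_space[OF assms(1)] measurable_space[OF assms(2)]
    by (auto simp: space_PiM PiE_iff resample_def)
qed

lemma resample_in_space:
  "\<eta> \<in> space (PiM UNIV M) \<Longrightarrow> \<zeta> \<in> space (PiM UNIV M) \<Longrightarrow> resample J \<eta> \<zeta> \<in> space (PiM UNIV M)"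
  by (auto simp: space_PiM PiE_iff resample_def)

locale prob_family =
  fixes M :: "'i \<Rightarrow> 'a measure"
  assumes M: "\<And>i. prob_space (M i)"
begin

abbreviation PM :: "('i \<Rightarrow> 'a) measure" where "PM \<equiv> PiM UNIV M"

sublocale prob_space PM by (rule prob_space_PiM) (rule M)

lemma distr_resample:
  shows "distr (PM \<Otimes>\<^sub>M PM) PM (\<lambda>(\<eta>, \<zeta>). resample J \<eta> \<zeta>) = PM"
    (is "distr (?P \<Otimes>\<^sub>M ?P) ?P ?f = ?P")
proof -
  interpret M: prob_space "M i" for i by (rule M)
  interpret product_prob_space M UNIV by unfold_locales
  interpret PP: pair_prob_space ?P ?P ..
  show ?thesis
  proof (rule PiM_eq)
    fix K F assume K: "finite K" "K \<subseteq> UNIV" and F: "\<And>j. j \<in> K \<Longrightarrow> F j \<in> sets (M j)"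
    let ?A = "\<lambda>K. prod_emb UNIV M K (\<Pi>\<^sub>E j\<in>K. F j)"
    have sets: "?A L \<in> sets ?P" if "L \<subseteq> K" for L
      using that F K by (intro sets_PiM_I) (auto intro: finite_subset)
    have "?f -` ?A K \<inter> space (?P \<Otimes>\<^sub>M ?P) = ?A (K - J) \<times> ?A (K \<inter> J)"
      by (auto simp: prod_emb_def space_PiM PiE_iff resample_def space_pair_measure split: if_splits)
    then have "emeasure (distr (?P \<Otimes>\<^sub>M ?P) ?P ?f) (?A K) = emeasure ?P (?A (K - J)) * emeasure ?P (?A (K \<inter> J))"
      using sets K by (subst emeasure_distr) (auto simp: emeasure_pair_measure_Times)
    also have "\<dots> = (\<Prod>j\<in>K - J. emeasure (M j) (F j)) * (\<Prod>j\<in>K \<inter> J. emeasure (M j) (F j))"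
      using K F by (subst (1 2) emeasure_PiM_emb) auto
    also have "\<dots> = (\<Prod>j\<in>K. emeasure (M j) (F j))"
      using K by (subst prod.union_disjoint[symmetric]) (auto intro!: prod.cong)
    finally show "emeasure (distr (?P \<Otimes>\<^sub>M ?P) ?P ?f) (?A K) = (\<Prod>j\<in>K. emeasure (M j) (F j))" .
  qed simp
qed

lemma nn_integral_resample:
  assumes [measurable]: "f \<in> borel_measurable PM"
  shows "(\<integral>\<^sup>+\<eta>. \<integral>\<^sup>+\<zeta>. f (resample J \<eta> \<zeta>) \<partial>PM \<partial>PM) = (\<integral>\<^sup>+\<eta>. f \<eta> \<partial>PM)"
proof -
  have "(\<integral>\<^sup>+\<eta>. f \<eta> \<partial>PM)
      = (\<integral>\<^sup>+x. f (case_prod (resample J) x) \<partial>(PM \<Otimes>\<^sub>M PM))"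
    by (subst distr_resample[where J = J, symmetric]) (simp add: nn_integral_distr)
  also have "\<dots> = (\<integral>\<^sup>+\<eta>. \<integral>\<^sup>+\<zeta>. f (resample J \<eta> \<zeta>) \<partial>PM \<partial>PM)"
    by (subst nn_integral_fst[symmetric]) simp_all
  finally show ?thesis ..
qed

definition block_average ::
    "'i set \<Rightarrow> (('i \<Rightarrow> 'a) \<Rightarrow> real) \<Rightarrow> ('i \<Rightarrow> 'a) \<Rightarrow> real" where
  "block_average J F \<eta> = (\<integral>\<zeta>. F (resample J \<eta> \<zeta>) \<partial>PM)"

lemma block_average_measurable [measurable]:
  assumes [measurable]: "F \<in> borel_measurable PM"
  shows "block_average J F \<in> borel_measurable PM"
proof -
  show ?thesis unfolding block_average_def[abs_def] by measurable
qed

lemma block_average_bounds: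
  assumes F[measurable]: "F \<in> borel_measurable PM"
    and bd: "\<And>\<eta>. \<eta> \<in> space PM \<Longrightarrow> \<bar>F \<eta>\<bar> \<le> b"
    and \<eta>: "\<eta> \<in> space PM"
  shows "integrable PM (\<lambda>\<zeta>. F (resample J \<eta> \<zeta>))"
    and "\<bar>block_average J F \<eta>\<bar> \<le> b"
proof -
  have [measurable]: "(\<lambda>\<zeta>. F (resample J \<eta> \<zeta>)) \<in> borel_measurable PM"
    using \<eta> by measurable
  show int: "integrable PM (\<lambda>\<zeta>. F (resample J \<eta> \<zeta>))"
    by (rule integrable_const_bound[where B = b]) (auto intro!: AE_I2 bd resample_in_space \<eta>)
  have "\<bar>block_average J F \<eta>\<bar> \<le> (\<integral>\<zeta>. \<bar>F (resample J \<eta> \<zeta>)\<bar> \<partial>PM)"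
    unfolding block_average_def by (rule integral_abs_bound)
  also have "\<dots> \<le> b"
    using int by (intro integral_le_const integrable_abs) (auto intro!: AE_I2 bd resample_in_space \<eta>)
  finally show "\<bar>block_average J F \<eta>\<bar> \<le> b" .
qed

lemma integral_block_average:
  assumes F[measurable]: "F \<in> borel_measurable PM"
    and bd: "\<And>\<eta>. \<eta> \<in> space PM \<Longrightarrow> \<bar>F \<eta>\<bar> \<le> b"
  shows "(\<integral>\<eta>. block_average J F \<eta> \<partial>PM) = (\<integral>\<eta>. F \<eta> \<partial>PM)"
proof -
  interpret PP: pair_prob_space "PM" "PM" ..
  have int: "integrable (PM \<Otimes>\<^sub>M PM) (\<lambda>x. F (case_prod (resample J) x))"
    by (rule PP.integrable_const_bound[where B = b])
       (auto intro!: AE_I2 bd resample_in_space simp: space_pair_measure)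
  have "(\<integral>\<eta>. F \<eta> \<partial>PM)
      = (\<integral>x. F (case_prod (resample J) x) \<partial>(PM \<Otimes>\<^sub>M PM))"
    by (subst distr_resample[where J = J, symmetric]) (simp add: integral_distr)
  also have "\<dots> = (\<integral>\<eta>. \<integral>\<zeta>. F (resample J \<eta> \<zeta>) \<partial>PM \<partial>PM)"
    using PP.integral_fst'[OF int] by simp
  finally show ?thesis by (simp add: block_average_def)
qed

lemma block_average_exp:
  assumes F[measurable]: "F \<in> borel_measurable PM"
    and bd: "\<And>\<eta>. \<eta> \<in> space PM \<Longrightarrow> \<bar>F \<eta>\<bar> \<le> b"
    and diff: "\<And>\<eta> \<zeta>. \<eta> \<in> space PM \<Longrightarrow> \<zeta> \<in> space PM \<Longrightarrow>
                 \<bar>F (resample J \<eta> \<zeta>) - F \<eta>\<bar> \<le> c"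
    and l: "l > 0"
  shows "(\<integral>\<^sup>+\<eta>. ennreal (exp (l * F \<eta>)) \<partial>PM)
       \<le> ennreal (exp (l\<^sup>2 * c\<^sup>2 / 8)) * (\<integral>\<^sup>+\<eta>. ennreal (exp (l * block_average J F \<eta>)) \<partial>PM)"
proof -
  note [measurable] = block_average_measurable[OF F]
  have "(\<integral>\<^sup>+\<eta>. ennreal (exp (l * F \<eta>)) \<partial>PM)
      = (\<integral>\<^sup>+\<eta>. \<integral>\<^sup>+\<zeta>. ennreal (exp (l * F (resample J \<eta> \<zeta>))) \<partial>PM \<partial>PM)"
    by (subst nn_integral_resample) simp_all
  also have "\<dots> \<le> (\<integral>\<^sup>+\<eta>. ennreal (exp (l\<^sup>2 * c\<^sup>2 / 8)) * ennreal (exp (l * block_average J F \<eta>)) \<partial>PM)"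
  proof (rule nn_integral_mono)
    fix \<eta> assume \<eta>: "\<eta> \<in> space PM"
    let ?G = "\<lambda>\<zeta>. F (resample J \<eta> \<zeta>)"
    have [measurable]: "?G \<in> borel_measurable PM" using \<eta> by measurable
    define a where "a = (INF \<zeta>\<in>space PM. ?G \<zeta>)"
    have bdd: "bdd_below (?G ` space PM)"
      using bd resample_in_space[OF \<eta>] by (intro bdd_belowI2[of _ "- b"]) (meson abs_le_iff minus_le_iff)
    have lo: "a \<le> ?G \<zeta>" if "\<zeta> \<in> space PM" for \<zeta>
      unfolding a_def by (rule cINF_lower[OF bdd that])
    have hi: "?G \<zeta> \<le> a + c" if \<zeta>: "\<zeta> \<in> space PM" for \<zeta>
    proof -
      have "?G \<zeta> - c \<le> a"
        unfolding a_def
      proof (rule cINF_greatest)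
        show "space PM \<noteq> {}" by (rule not_empty)
        fix \<xi> assume \<xi>: "\<xi> \<in> space PM"
        show "?G \<zeta> - c \<le> ?G \<xi>"
          using diff[OF resample_in_space[OF \<eta> \<zeta>, of J] \<xi>] by (simp add: abs_le_iff)
      qed
      then show ?thesis by simp
    qed
    interpret interval_bounded_random_variable "PM" ?G a "a + c"
      by unfold_locales (auto intro!: AE_I2 lo hi)
    have "(\<integral>\<^sup>+\<zeta>. ennreal (exp (l * ?G \<zeta>)) \<partial>PM)
        = (\<integral>\<^sup>+\<zeta>. ennreal (exp (l * (?G \<zeta> - expectation ?G))) * ennreal (exp (l * expectation ?G)) \<partial>PM)"
      by (intro nn_integral_cong) (simp add: ennreal_mult[symmetric] exp_add[symmetric] algebra_simps)
    also have "\<dots> = (\<integral>\<^sup>+\<zeta>. ennreal (exp (l * (?G \<zeta> - expectation ?G))) \<partial>PM) * ennreal (exp (l * expectation ?G))"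
      by (rule nn_integral_multc) simp
    also have "\<dots> \<le> ennreal (exp (l\<^sup>2 * (a + c - a)\<^sup>2 / 8)) * ennreal (exp (l * expectation ?G))"
      by (intro mult_right_mono Hoeffdings_lemma_nn_integral l) simp
    finally show "(\<integral>\<^sup>+\<zeta>. ennreal (exp (l * ?G \<zeta>)) \<partial>PM)
       \<le> ennreal (exp (l\<^sup>2 * c\<^sup>2 / 8)) * ennreal (exp (l * block_average J F \<eta>))"
      by (simp add: block_average_def)
  qed
  also have "\<dots> = ennreal (exp (l\<^sup>2 * c\<^sup>2 / 8)) * (\<integral>\<^sup>+\<eta>. ennreal (exp (l * block_average J F \<eta>)) \<partial>PM)"
    by (rule nn_integral_cmult) measurable
  finally show ?thesis .
qed

text \<open>The blocks are averaged out one at a time; each step costs a factor given by Hoeffding's lemma.\<close>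

lemma bounded_differences_mgf:
  fixes J :: "nat \<Rightarrow> 'i set" and n :: nat and c l :: real and F :: "('i \<Rightarrow> 'a) \<Rightarrow> real"
  assumes "F \<in> borel_measurable PM"
    and "\<And>\<eta>. \<eta> \<in> space PM \<Longrightarrow> \<bar>F \<eta>\<bar> \<le> b"
    and "\<And>k \<eta> \<zeta>. k < n \<Longrightarrow> \<eta> \<in> space PM \<Longrightarrow> \<zeta> \<in> space PM \<Longrightarrow>
                 \<bar>F (resample (J k) \<eta> \<zeta>) - F \<eta>\<bar> \<le> c"
    and "\<And>\<eta> \<eta>'. (\<And>i k. k < n \<Longrightarrow> i \<in> J k \<Longrightarrow> \<eta> i = \<eta>' i) \<Longrightarrow> F \<eta> = F \<eta>'"
    and disj: "disjoint_family J"
    and l: "l > 0"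
  shows "(\<integral>\<^sup>+\<eta>. ennreal (exp (l * F \<eta>)) \<partial>PM)
       \<le> ennreal (exp (l\<^sup>2 * n * c\<^sup>2 / 8 + l * (\<integral>\<eta>. F \<eta> \<partial>PM)))"
  using assms(1-4)
proof (induction n arbitrary: F)
  case 0
  obtain v where v: "F \<eta> = v" for \<eta> using 0(4) by blast
  then have "F = (\<lambda>_. v)" by blast
  then show ?case by (simp add: emeasure_space_1 prob_space)
next
  case (Suc n)
  note F = Suc.prems
  let ?G = "block_average (J n) F"
  have "(\<integral>\<^sup>+\<eta>. ennreal (exp (l * ?G \<eta>)) \<partial>PM)
     \<le> ennreal (exp (l\<^sup>2 * n * c\<^sup>2 / 8 + l * (\<integral>\<eta>. ?G \<eta> \<partial>PM)))"
  proof (rule Suc.IH)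
    show "?G \<in> borel_measurable PM"
      by (rule block_average_measurable[OF F(1)])
    show "\<bar>?G \<eta>\<bar> \<le> b" if "\<eta> \<in> space PM" for \<eta>
      using block_average_bounds(2)[OF F(1,2) that] by blast
    show "\<bar>?G (resample (J k) \<eta> \<zeta>) - ?G \<eta>\<bar> \<le> c"
      if k: "k < n" and \<eta>: "\<eta> \<in> space PM" and \<zeta>: "\<zeta> \<in> space PM" for k \<eta> \<zeta>
    proof -
      have eq: "resample (J n) (resample (J k) \<eta> \<zeta>) \<xi> = resample (J k) (resample (J n) \<eta> \<xi>) \<zeta>" for \<xi>
        using disjoint_family_onD[OF disj, of k n] k by (auto simp: resample_def fun_eq_iff)
      have i1: "integrable PM (\<lambda>\<xi>. F (resample (J n) (resample (J k) \<eta> \<zeta>) \<xi>))"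
        by (rule block_average_bounds(1)[OF F(1,2) resample_in_space[OF \<eta> \<zeta>]])
      have i2: "integrable PM (\<lambda>\<xi>. F (resample (J n) \<eta> \<xi>))"
        by (rule block_average_bounds(1)[OF F(1,2) \<eta>])
      have "\<bar>?G (resample (J k) \<eta> \<zeta>) - ?G \<eta>\<bar>
          = \<bar>\<integral>\<xi>. F (resample (J n) (resample (J k) \<eta> \<zeta>) \<xi>) - F (resample (J n) \<eta> \<xi>) \<partial>PM\<bar>"
        unfolding block_average_def using i1 i2 by simp
      also have "\<dots> \<le> (\<integral>\<xi>. \<bar>F (resample (J n) (resample (J k) \<eta> \<zeta>) \<xi>) - F (resample (J n) \<eta> \<xi>)\<bar> \<partial>PM)"
        by (rule integral_abs_bound)
      also have "\<dots> \<le> c"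
        using i1 i2 k \<eta> \<zeta> unfolding eq
        by (intro integral_le_const integrable_abs Bochner_Integration.integrable_diff AE_I2 F(3) resample_in_space)
           auto
      finally show ?thesis .
    qed
    show "?G \<eta> = ?G \<eta>'" if eq: "\<And>i k. k < n \<Longrightarrow> i \<in> J k \<Longrightarrow> \<eta> i = \<eta>' i" for \<eta> \<eta>'
      unfolding block_average_def
      by (intro Bochner_Integration.integral_cong refl F(4)) (auto simp: resample_def less_Suc_eq eq)
  qed
  note IH = this
  have avg: "(\<integral>\<eta>. ?G \<eta> \<partial>PM) = (\<integral>\<eta>. F \<eta> \<partial>PM)"
    by (rule integral_block_average[OF F(1,2)])
  have "(\<integral>\<^sup>+\<eta>. ennreal (exp (l * F \<eta>)) \<partial>PM)
     \<le> ennreal (exp (l\<^sup>2 * c\<^sup>2 / 8)) * (\<integral>\<^sup>+\<eta>. ennreal (exp (l * ?G \<eta>)) \<partial>PM)"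
    by (rule block_average_exp[OF F(1,2) _ l]) (auto intro: F(3))
  also have "\<dots> \<le> ennreal (exp (l\<^sup>2 * c\<^sup>2 / 8)) * ennreal (exp (l\<^sup>2 * n * c\<^sup>2 / 8 + l * (\<integral>\<eta>. ?G \<eta> \<partial>PM)))"
    by (intro mult_left_mono IH) simp
  also have "\<dots> = ennreal (exp (l\<^sup>2 * Suc n * c\<^sup>2 / 8 + l * (\<integral>\<eta>. F \<eta> \<partial>PM)))"
    by (simp add: ennreal_mult[symmetric] exp_add[symmetric] avg field_simps)
  finally show ?case .
qed

theorem bounded_differences_inequality:
  fixes J :: "nat \<Rightarrow> 'i set" and n :: nat and c t :: real and F :: "('i \<Rightarrow> 'a) \<Rightarrow> real"
  assumes F[measurable]: "F \<in> borel_measurable PM"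
    and bd: "\<And>\<eta>. \<eta> \<in> space PM \<Longrightarrow> \<bar>F \<eta>\<bar> \<le> b"
    and diff: "\<And>k \<eta> \<zeta>. k < n \<Longrightarrow> \<eta> \<in> space PM \<Longrightarrow> \<zeta> \<in> space PM \<Longrightarrow>
                 \<bar>F (resample (J k) \<eta> \<zeta>) - F \<eta>\<bar> \<le> c"
    and dep: "\<And>\<eta> \<eta>'. (\<And>i k. k < n \<Longrightarrow> i \<in> J k \<Longrightarrow> \<eta> i = \<eta>' i) \<Longrightarrow> F \<eta> = F \<eta>'"
    and disj: "disjoint_family J" and pos: "n > 0" "c > 0" "t > 0"
  shows "measure PM {\<eta> \<in> space PM. \<bar>F \<eta> - (\<integral>\<zeta>. F \<zeta> \<partial>PM)\<bar> \<ge> t}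
       \<le> 2 * exp (- 2 * t\<^sup>2 / (n * c\<^sup>2))"
proof -
  let ?m = "\<integral>\<zeta>. F \<zeta> \<partial>PM"
  define l where "l = 4 * t / (n * c\<^sup>2)"
  have l: "l > 0" using pos by (simp add: l_def)
  have tail: "prob {\<eta> \<in> space PM. \<sigma> * (F \<eta> - ?m) \<ge> t} \<le> exp (- 2 * t\<^sup>2 / (n * c\<^sup>2))"
    if \<sigma>: "\<bar>\<sigma>\<bar> = 1" for \<sigma> :: real
  proof -
    have "(\<integral>\<^sup>+\<eta>. ennreal (exp (l * (\<sigma> * F \<eta>))) \<partial>PM)
        \<le> ennreal (exp (l\<^sup>2 * n * c\<^sup>2 / 8 + l * (\<integral>\<eta>. \<sigma> * F \<eta> \<partial>PM)))"
    proof (rule bounded_differences_mgf[OF _ _ _ _ disj l, where b = b])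
      show "\<bar>\<sigma> * F (resample (J k) \<eta> \<zeta>) - \<sigma> * F \<eta>\<bar> \<le> c"
        if "k < n" "\<eta> \<in> space PM" "\<zeta> \<in> space PM" for k \<eta> \<zeta>
        using diff[OF that] \<sigma> by (simp add: abs_mult flip: right_diff_distrib)
      show "\<sigma> * F \<eta> = \<sigma> * F \<eta>'" if "\<And>i k. k < n \<Longrightarrow> i \<in> J k \<Longrightarrow> \<eta> i = \<eta>' i" for \<eta> \<eta>'
        using dep[of \<eta> \<eta>'] that by simp
    qed (use bd \<sigma> in \<open>auto simp: abs_mult\<close>)
    then have mgf: "(\<integral>\<^sup>+\<eta>. ennreal (exp (l * (\<sigma> * F \<eta>))) \<partial>PM)
        \<le> ennreal (exp (l\<^sup>2 * n * c\<^sup>2 / 8 + l * (\<sigma> * ?m)))" by simp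
    have "ennreal (prob {\<eta> \<in> space PM. \<sigma> * (F \<eta> - ?m) \<ge> t})
        = emeasure PM {\<eta> \<in> space PM. \<sigma> * (F \<eta> - ?m) \<ge> t}"
      by (simp add: emeasure_eq_measure)
    also have "\<dots> \<le> ennreal (exp (-l*t)) * (\<integral>\<^sup>+\<eta>\<in>space PM. exp (l * (\<sigma> * (F \<eta> - ?m))) \<partial>PM)"
      by (intro Chernoff_ineq_nn_integral_ge l) auto
    also have "(\<integral>\<^sup>+\<eta>\<in>space PM. exp (l * (\<sigma> * (F \<eta> - ?m))) \<partial>PM)
        = (\<integral>\<^sup>+\<eta>. ennreal (exp (l * (\<sigma> * F \<eta>))) * ennreal (exp (- l * (\<sigma> * ?m))) \<partial>PM)"
      by (intro nn_integral_cong) (auto simp: ennreal_mult[symmetric] exp_add[symmetric] algebra_simps)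
    also have "\<dots> = (\<integral>\<^sup>+\<eta>. ennreal (exp (l * (\<sigma> * F \<eta>))) \<partial>PM) * ennreal (exp (- l * (\<sigma> * ?m)))"
      by (rule nn_integral_multc) simp
    also have "\<dots> \<le> ennreal (exp (l\<^sup>2 * n * c\<^sup>2 / 8 + l * (\<sigma> * ?m))) * ennreal (exp (- l * (\<sigma> * ?m)))"
      by (intro mult_right_mono mgf) simp
    also have "ennreal (exp (-l*t)) * \<dots> = ennreal (exp (l\<^sup>2 * n * c\<^sup>2 / 8 - l * t))"
      by (simp add: ennreal_mult[symmetric] exp_add[symmetric])
    also have "l\<^sup>2 * n * c\<^sup>2 / 8 - l * t = - 2 * t\<^sup>2 / (n * c\<^sup>2)"
      using pos by (simp add: l_def field_simps power2_eq_square)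
    finally show ?thesis by (simp add: mult_left_mono)
  qed
  note up = tail[of 1, simplified] and lo = tail[of "- 1", simplified]
  have "prob {\<eta> \<in> space PM. \<bar>F \<eta> - ?m\<bar> \<ge> t}
      \<le> prob ({\<eta> \<in> space PM. F \<eta> - ?m \<ge> t} \<union> {\<eta> \<in> space PM. ?m - F \<eta> \<ge> t})"
    by (intro finite_measure_mono) auto
  also have "\<dots> \<le> prob {\<eta> \<in> space PM. F \<eta> - ?m \<ge> t} + prob {\<eta> \<in> space PM. ?m - F \<eta> \<ge> t}"
    by (intro measure_Un_le) auto
  finally show ?thesis using up lo by auto
qed

end

section \<open>Lattice sums and sums over paths\<close>

type_synonym 'd env = "nat \<times> (int ^ 'd) \<Rightarrow> bool"

lemma l1norm_zero [simp]: "l1norm 0 = 0"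
  by (simp add: l1norm_def)

lemma l1norm_minus [simp]: "l1norm (- x) = l1norm x"
  by (simp add: l1norm_def)

lemma l1norm_minus_commute: "l1norm (x - y) = l1norm (y - x)"
  using l1norm_minus[of "x - y"] by simp

lemma l1norm_add_le: "l1norm (x + y) \<le> l1norm x + l1norm y"
proof -
  have "(\<Sum>i\<in>UNIV. \<bar>(x + y) $ i\<bar>) \<le> (\<Sum>i\<in>UNIV. \<bar>x $ i\<bar>) + (\<Sum>i\<in>UNIV. \<bar>y $ i\<bar>)"
    by (simp add: sum.distrib[symmetric]) (rule sum_mono, simp)
  then show ?thesis
    by (simp add: l1norm_def sum_nonneg flip: nat_add_distrib)
qed

lemma l1norm_diff_triangle: "l1norm (x - z) \<le> l1norm (x - y) + l1norm (y - z)"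
  using l1norm_add_le[of "x - y" "y - z"] by simp

lemma component_le_l1norm: "\<bar>x $ i\<bar> \<le> int (l1norm x)"
  using member_le_sum[of i UNIV "\<lambda>i. \<bar>x $ i\<bar>"] by (simp add: l1norm_def sum_nonneg)

lemma l1ball_finite_card:
  fixes k :: nat
  shows "finite {x :: int ^ 'd. l1norm x \<le> k}"
    and "card {x :: int ^ 'd. l1norm x \<le> k} \<le> (2 * k + 1) ^ CARD('d)"
proof -
  let ?B = "{x :: int ^ 'd. l1norm x \<le> k}" and ?I = "{- int k..int k}"
  have sub: "?B \<subseteq> vec_lambda ` (PiE UNIV (\<lambda>_. ?I))"
  proof
    fix x :: "int ^ 'd" assume "x \<in> ?B"
    then have "\<bar>x $ i\<bar> \<le> int k" for i
      using component_le_l1norm[of x i] by simp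
    then have "vec_nth x \<in> PiE UNIV (\<lambda>_. ?I)"
      by (auto simp: abs_le_iff minus_le_iff)
    then show "x \<in> vec_lambda ` (PiE UNIV (\<lambda>_. ?I))"
      by (intro image_eqI[of _ _ "vec_nth x"]) simp_all
  qed
  have fin: "finite (PiE (UNIV :: 'd set) (\<lambda>_. ?I))"
    by (intro finite_PiE) auto
  show "finite ?B" using sub fin by (meson finite_imageI finite_subset)
  have "card ?B \<le> card (PiE (UNIV :: 'd set) (\<lambda>_. ?I))"
    using sub fin by (meson card_image_le card_mono finite_imageI order_trans)
  also have "\<dots> = card ?I ^ CARD('d)" by (simp add: card_PiE)
  also have "card ?I = 2 * k + 1" by simp
  finally show "card ?B \<le> (2 * k + 1) ^ CARD('d)" .
qed

definition axis_site :: "nat \<Rightarrow> int ^ 'd" where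
  "axis_site k = (\<chi> i. if i = (SOME i. True) then int k else 0)"

lemma l1norm_axis_site_diff: "l1norm (axis_site k - axis_site m :: int ^ 'd) = nat \<bar>int k - int m\<bar>"
proof -
  have "(\<Sum>i\<in>(UNIV :: 'd set). \<bar>(axis_site k - axis_site m :: int ^ 'd) $ i\<bar>)
     = (\<Sum>i\<in>(UNIV :: 'd set). if i = (SOME i. True) then \<bar>int k - int m\<bar> else 0)"
    by (intro sum.cong) (auto simp: axis_site_def)
  then show ?thesis by (simp add: l1norm_def)
qed

lemma axis_site_0 [simp]: "axis_site 0 = 0"
  by (simp add: axis_site_def vec_eq_iff)

lemma l1norm_axis_site [simp]: "l1norm (axis_site k) = k"
  using l1norm_axis_site_diff[of k 0] by simp

lemma inj_axis_site: "inj axis_site"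
  by (rule injI) (metis l1norm_axis_site)

lemma nn_integral_exp_l1norm_finite:
  assumes "s > 0" "\<alpha> > 0"
  shows "(\<integral>\<^sup>+(y::int ^ 'd). ennreal (exp (- s * real (l1norm y) powr \<alpha>)) \<partial>count_space UNIV) < \<infinity>"
proof -
  let ?D = "CARD('d)"
  let ?g = "\<lambda>k. exp (- s * real k powr \<alpha>)"
  have lim: "((\<lambda>k. (2 * real k + 1) ^ ?D * ?g k * real k ^ 2) \<longlongrightarrow> 0) sequentially"
  proof -
    have "((\<lambda>k. (2 * real k + 1) powr real ?D * ?g k * real k ^ 2) \<longlongrightarrow> 0) sequentially"
      using assms by real_asymp
    then show ?thesis
      by (rule Lim_transform_eventually)
         (auto simp: powr_realpow)
  qed
  then have "eventually (\<lambda>k. (2 * real k + 1) ^ ?D * ?g k * real k ^ 2 < 1) sequentially"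
    by (rule order_tendstoD) simp
  then have "eventually (\<lambda>k. norm ((2 * real k + 1) ^ ?D * ?g k) \<le> 1 / real k ^ 2) sequentially"
    using eventually_gt_at_top[of 0]
    by eventually_elim (simp add: field_simps)
  then have summ: "summable (\<lambda>k. (2 * real k + 1) ^ ?D * ?g k)"
    by (rule summable_comparison_test_ev) (use inverse_power_summable[of 2] in \<open>simp add: inverse_eq_divide\<close>)
  have "(\<integral>\<^sup>+(y::int ^ 'd). ennreal (?g (l1norm y)) \<partial>count_space UNIV)
      = (\<integral>\<^sup>+(y::int ^ 'd). (\<integral>\<^sup>+k. ennreal (?g k) * indicator {k. l1norm y = k} k \<partial>count_space UNIV) \<partial>count_space UNIV)"
  proof (intro nn_integral_cong)
    fix y :: "int ^ 'd"
    have "(\<integral>\<^sup>+k. ennreal (?g k) * indicator {k. l1norm y = k} k \<partial>count_space UNIV)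
       = (\<integral>\<^sup>+k. ennreal (?g (l1norm y)) * indicator {l1norm y} k \<partial>count_space UNIV)"
      by (intro nn_integral_cong) (auto simp: indicator_def)
    then show "ennreal (?g (l1norm y)) = (\<integral>\<^sup>+k. ennreal (?g k) * indicator {k. l1norm y = k} k \<partial>count_space UNIV)"
      by (simp add: nn_integral_cmult)
  qed
  also have "\<dots> = (\<integral>\<^sup>+k. (\<integral>\<^sup>+(y::int ^ 'd). ennreal (?g k) * indicator {y. l1norm y = k} y \<partial>count_space UNIV) \<partial>count_space UNIV)"
    by (subst nn_integral_count_space_nn_integral) (auto intro!: nn_integral_cong simp: indicator_def)
  also have "\<dots> \<le> (\<integral>\<^sup>+k. ennreal ((2 * real k + 1) ^ ?D * ?g k) \<partial>count_space UNIV)"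
  proof (intro nn_integral_mono)
    fix k :: nat
    have "card {y :: int ^ 'd. l1norm y = k} \<le> card {y :: int ^ 'd. l1norm y \<le> k}"
      by (intro card_mono l1ball_finite_card) auto
    also have "\<dots> \<le> (2 * k + 1) ^ ?D" by (rule l1ball_finite_card)
    finally have "real (card {y :: int ^ 'd. l1norm y = k}) \<le> real ((2 * k + 1) ^ ?D)"
      by (rule of_nat_mono)
    then have c: "real (card {y :: int ^ 'd. l1norm y = k}) \<le> (2 * real k + 1) ^ ?D"
      by (simp add: add.commute)
    have fin: "finite {y :: int ^ 'd. l1norm y = k}"
      by (rule finite_subset[OF _ l1ball_finite_card(1)[of k]]) auto
    have "(\<integral>\<^sup>+(y::int ^ 'd). ennreal (?g k) * indicator {y. l1norm y = k} y \<partial>count_space UNIV)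
        = ennreal (?g k) * of_nat (card {y :: int ^ 'd. l1norm y = k})"
      using fin by (subst nn_integral_cmult) auto
    also have "\<dots> = ennreal (?g k * real (card {y :: int ^ 'd. l1norm y = k}))"
      by (simp add: ennreal_mult ennreal_of_nat_eq_real_of_nat)
    also have "\<dots> \<le> ennreal ((2 * real k + 1) ^ ?D * ?g k)"
      using c by (intro ennreal_leI) (simp add: mult.commute)
    finally show "(\<integral>\<^sup>+(y::int ^ 'd). ennreal (?g k) * indicator {y. l1norm y = k} y \<partial>count_space UNIV)
        \<le> ennreal ((2 * real k + 1) ^ ?D * ?g k)" .
  qed
  also have "\<dots> = ennreal (\<Sum>k. (2 * real k + 1) ^ ?D * ?g k)"
    by (subst nn_integral_count_space_nat) (rule suminf_ennreal2[OF _ summ], simp)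
  also have "\<dots> < \<infinity>" by simp
  finally show ?thesis .
qed

primrec path_sum :: "nat \<Rightarrow> ('a list \<Rightarrow> ennreal) \<Rightarrow> ennreal" where
  "path_sum 0 F = F []"
| "path_sum (Suc n) F = (\<integral>\<^sup>+x. path_sum n (\<lambda>xs. F (x # xs)) \<partial>count_space UNIV)"

lemma path_sum_mono:
  "(\<And>xs. length xs = n \<Longrightarrow> F xs \<le> G xs) \<Longrightarrow> path_sum n F \<le> path_sum n G"
  by (induction n arbitrary: F G) (auto intro!: nn_integral_mono)

lemma path_sum_cong:
  "(\<And>xs. length xs = n \<Longrightarrow> F xs = G xs) \<Longrightarrow> path_sum n F = path_sum n G"
  by (intro antisym path_sum_mono) auto

lemma path_sum_cmult: "path_sum n (\<lambda>xs. c * F xs) = c * path_sum n F"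
  by (induction n arbitrary: F) (auto simp: nn_integral_cmult)

lemma path_sum_add: "path_sum n (\<lambda>xs. F xs + G xs) = path_sum n F + path_sum n G"
  by (induction n arbitrary: F G) (auto simp: nn_integral_add)

lemma path_sum_zero [simp]: "path_sum n (\<lambda>_. 0) = 0"
  by (induction n) auto

lemma path_sum_sum:
  "finite I \<Longrightarrow> path_sum n (\<lambda>xs. \<Sum>i\<in>I. F i xs) = (\<Sum>i\<in>I. path_sum n (F i))"
by (induction I rule: finite_induct) (simp_all add: path_sum_add)

lemma path_sum_append: "path_sum (m + n) F = path_sum m (\<lambda>xs. path_sum n (\<lambda>ys. F (xs @ ys)))"
  by (induction m arbitrary: F) auto

lemma path_sum_ge_point: "length xs = n \<Longrightarrow> F xs \<le> path_sum n F"
proof (induction n arbitrary: F xs)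
  case (Suc n)
  then obtain x ys where xs: "xs = x # ys" "length ys = n" by (cases xs) auto
  have "F xs \<le> path_sum n (\<lambda>xs. F (x # xs))"
    using Suc.IH[of ys "\<lambda>ys. F (x # ys)"] xs by simp
  also have "\<dots> \<le> path_sum (Suc n) F"
    by (simp add: nn_integral_ge_point[where p = "\<lambda>x. path_sum n (\<lambda>xs. F (x # xs))"])
  finally show ?case .
qed simp

lemma path_sum_nn_integral:
  fixes F :: "'a::countable list \<Rightarrow> 'b \<Rightarrow> ennreal"
  assumes "\<And>xs. length xs = n \<Longrightarrow> F xs \<in> borel_measurable M"
  shows "(\<lambda>x. path_sum n (\<lambda>xs. F xs x)) \<in> borel_measurable M"
    and "(\<integral>\<^sup>+x. path_sum n (\<lambda>xs. F xs x) \<partial>M) = path_sum n (\<lambda>xs. \<integral>\<^sup>+x. F xs x \<partial>M)"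
  using assms
proof (induction n arbitrary: F)
  case (Suc n)
  interpret sigma_finite_measure "count_space (UNIV :: 'a set)"
    by (rule sigma_finite_measure_count_space)
  {
    case 1
    have m: "(\<lambda>x. path_sum n (\<lambda>xs. F (a # xs) x)) \<in> borel_measurable M" for a
      by (rule Suc.IH(1)) (use 1 in simp)
    have "case_prod (\<lambda>x a. path_sum n (\<lambda>xs. F (a # xs) x)) \<in> borel_measurable (M \<Otimes>\<^sub>M count_space UNIV)"
      using measurable_compose_countable[where f = "\<lambda>a z. path_sum n (\<lambda>xs. F (a # xs) (fst z))"
          and g = snd and M = "M \<Otimes>\<^sub>M count_space UNIV" and N = borel] m
      by (simp add: case_prod_beta' measurable_compose[OF measurable_fst])
    then show ?case
      unfolding path_sum.simps by (rule borel_measurable_nn_integral)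
  next
    case 2
    have m: "(\<lambda>x. path_sum n (\<lambda>xs. F (a # xs) x)) \<in> borel_measurable M" for a
      by (rule Suc.IH(1)) (use 2 in simp)
    have "(\<integral>\<^sup>+x. path_sum (Suc n) (\<lambda>xs. F xs x) \<partial>M)
        = (\<integral>\<^sup>+a. \<integral>\<^sup>+x. path_sum n (\<lambda>xs. F (a # xs) x) \<partial>M \<partial>count_space UNIV)"
      unfolding path_sum.simps using m by (intro nn_integral_count_space_nn_integral) auto
    also have "\<dots> = path_sum (Suc n) (\<lambda>xs. \<integral>\<^sup>+x. F xs x \<partial>M)"
      unfolding path_sum.simps using 2 by (intro nn_integral_cong Suc.IH(2)) auto
    finally show ?case .
  }
qed auto

lemma path_sum_eq_nn_integral:
  fixes F :: "'a::countable list \<Rightarrow> ennreal"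
  shows "path_sum n F = (\<integral>\<^sup>+xs. F xs \<partial>count_space {xs. length xs = n})"
proof (induction n arbitrary: F)
  case 0
  have "{xs :: 'a list. length xs = 0} = {[]}" by auto
  then show ?case by (simp add: nn_integral_count_space_finite)
next
  case (Suc n)
  have bij: "bij_betw (\<lambda>(x, xs). x # xs) (UNIV \<times> {xs. length xs = n}) {xs :: 'a list. length xs = Suc n}"
    by (auto simp: bij_betw_def inj_on_def image_def length_Suc_conv)
  have sf: "sigma_finite_measure (count_space {xs :: 'a list. length xs = n})"
    by (rule sigma_finite_measure_count_space_countable) simp
  have pair: "count_space (UNIV :: 'a set) \<Otimes>\<^sub>M count_space {xs :: 'a list. length xs = n}
     = count_space (UNIV \<times> {xs. length xs = n})"
    by (rule pair_measure_countable) auto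
  have "path_sum (Suc n) F
      = (\<integral>\<^sup>+x. \<integral>\<^sup>+xs. F (case_prod (#) (x, xs)) \<partial>count_space {xs. length xs = n} \<partial>count_space UNIV)"
    by (simp add: Suc.IH)
  also have "\<dots> = (\<integral>\<^sup>+z. F (case_prod (#) z) \<partial>(count_space UNIV \<Otimes>\<^sub>M count_space {xs. length xs = n}))"
    by (rule sigma_finite_measure.nn_integral_fst[OF sf, where f = "\<lambda>z. F (case_prod (#) z)"]) (simp add: pair)
  also have "\<dots> = (\<integral>\<^sup>+xs. F xs \<partial>count_space {xs. length xs = Suc n})"
    unfolding pair by (rule nn_integral_bij_count_space[OF bij])
  finally show ?case .
qed

lemma infsum_eq_enn2real_nn_integral:
  fixes f :: "'a \<Rightarrow> real"
  assumes "(\<integral>\<^sup>+x. ennreal (f x) \<partial>count_space A) < \<infinity>" and "\<And>x. x \<in> A \<Longrightarrow> f x \<ge> 0"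
  shows "infsum f A = enn2real (\<integral>\<^sup>+x. ennreal (f x) \<partial>count_space A)"
proof -
  have "Infinite_Set_Sum.abs_summable_on f A"
    unfolding Infinite_Set_Sum.abs_summable_on_def
  proof (rule integrableI_bounded)
    have "(\<integral>\<^sup>+x. ennreal (norm (f x)) \<partial>count_space A) = (\<integral>\<^sup>+x. ennreal (f x) \<partial>count_space A)"
      using assms(2) by (intro nn_integral_cong) simp
    then show "(\<integral>\<^sup>+x. ennreal (norm (f x)) \<partial>count_space A) < \<infinity>"
      using assms(1) by simp
  qed simp
  then have "infsum f A = infsetsum f A"
    by (rule infsetsum_infsum[symmetric])
  also have "\<dots> = enn2real (\<integral>\<^sup>+x. ennreal (f x) \<partial>count_space A)"
    using assms by (intro infsetsum_conv_nn_integral) auto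
  finally show ?thesis .
qed

section \<open>Path weights\<close>

lemma nn_integral_count_space_translate:
  fixes a :: "'a::group_add"
  shows "(\<integral>\<^sup>+x. f (x - a) \<partial>count_space UNIV) = (\<integral>\<^sup>+x. f x \<partial>count_space UNIV)"
    and "(\<integral>\<^sup>+x. f (x + a) \<partial>count_space UNIV) = (\<integral>\<^sup>+x. f x \<partial>count_space UNIV)"
proof -
  have "bij_betw (\<lambda>x. x - a) UNIV UNIV"
    by (rule bij_betwI[where g = "\<lambda>x. x + a"]) auto
  moreover have "bij_betw (\<lambda>x. x + a) UNIV UNIV"
    by (rule bij_betwI[where g = "\<lambda>x. x - a"]) auto
  ultimately show "(\<integral>\<^sup>+x. f (x - a) \<partial>count_space UNIV) = (\<integral>\<^sup>+x. f x \<partial>count_space UNIV)"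
    and "(\<integral>\<^sup>+x. f (x + a) \<partial>count_space UNIV) = (\<integral>\<^sup>+x. f x \<partial>count_space UNIV)"
    using nn_integral_bij_count_space by blast+
qed

primrec jumps :: "int ^ 'd \<Rightarrow> (int ^ 'd) list \<Rightarrow> real list" where
  "jumps a [] = []"
| "jumps a (x # xs) = real (l1norm (x - a)) # jumps x xs"

lemma length_jumps [simp]: "length (jumps a xs) = length xs"
  by (induction xs arbitrary: a) auto

lemma jumps_append [simp]: "jumps a (xs @ ys) = jumps a xs @ jumps (last (a # xs)) ys"
  by (induction xs arbitrary: a) auto

lemma jumps_nonneg: "k \<in> set (jumps a xs) \<Longrightarrow> k \<ge> 0"
  by (induction xs arbitrary: a) auto

lemma l1norm_le_sum_jumps: "real (l1norm (last (a # xs) - a)) \<le> sum_list (jumps a xs)"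
proof (induction xs arbitrary: a)
  case (Cons x xs)
  have "real (l1norm (last (x # xs) - a)) \<le> real (l1norm (last (x # xs) - x) + l1norm (x - a))"
    by (intro of_nat_mono l1norm_diff_triangle)
  with Cons.IH[of x] show ?case by simp
qed simp

definition cost :: "real \<Rightarrow> real list \<Rightarrow> real" where
  "cost \<alpha> js = (\<Sum>k\<leftarrow>js. k powr \<alpha>)"

lemma cost_simps [simp]:
  "cost \<alpha> [] = 0" "cost \<alpha> (k # js) = k powr \<alpha> + cost \<alpha> js"
  "cost \<alpha> (js @ js') = cost \<alpha> js + cost \<alpha> js'"
  by (simp_all add: cost_def)

lemma cost_nonneg: "cost \<alpha> js \<ge> 0"
  by (induction js) auto

lemma cost_le_const:
  assumes "\<And>k. k \<in> set js \<Longrightarrow> 0 \<le> k \<and> k \<le> b" "\<alpha> \<ge> 0"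
  shows "cost \<alpha> js \<le> length js * b powr \<alpha>"
  using assms(1)
proof (induction js)
  case (Cons k js)
  have "k powr \<alpha> \<le> b powr \<alpha>" using Cons.prems assms(2) by (intro powr_mono2) auto
  then show ?case using Cons by (simp add: algebra_simps)
qed simp

text \<open>The factor \<open>exp (\<beta> H)\<close> with \<open>\<gamma> = exp \<beta>\<close>; \<open>\<gamma> = 0\<close> is \<open>\<beta> = -\<infinity>\<close>. The list starts at time \<open>t + 1\<close>.\<close>

primrec env_factor :: "real \<Rightarrow> ('d::finite) env \<Rightarrow> nat \<Rightarrow> (int ^ 'd) list \<Rightarrow> real" where
  "env_factor \<gamma> \<eta> t [] = 1"
| "env_factor \<gamma> \<eta> t (x # xs) = (if \<eta> (Suc t, x) then \<gamma> else 1) * env_factor \<gamma> \<eta> (Suc t) xs"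

lemma env_factor_append [simp]:
  "env_factor \<gamma> \<eta> t (xs @ ys) = env_factor \<gamma> \<eta> t xs * env_factor \<gamma> \<eta> (t + length xs) ys"
  by (induction xs arbitrary: t) auto

lemma env_factor_nonneg: "\<gamma> \<ge> 0 \<Longrightarrow> env_factor \<gamma> \<eta> t xs \<ge> 0"
  by (induction xs arbitrary: t) auto

lemma env_factor_le:
  assumes "0 \<le> \<gamma>" "\<gamma> \<le> \<Gamma>" "1 \<le> \<Gamma>"
  shows "env_factor \<gamma> \<eta> t xs \<le> \<Gamma> ^ length xs"
proof (induction xs arbitrary: t)
  case (Cons x xs)
  have "(if \<eta> (Suc t, x) then \<gamma> else 1) * env_factor \<gamma> \<eta> (Suc t) xs \<le> \<Gamma> * \<Gamma> ^ length xs"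
    using assms by (intro mult_mono Cons.IH env_factor_nonneg) auto
  then show ?case by simp
qed simp

lemma env_factor_cong:
  "(\<And>j x. t < j \<Longrightarrow> j \<le> t + length xs \<Longrightarrow> x \<in> set xs \<Longrightarrow> \<eta> (j, x) = \<eta>' (j, x)) \<Longrightarrow> env_factor \<gamma> \<eta> t xs = env_factor \<gamma> \<eta>' t xs"
  by (induction xs arbitrary: t) auto

lemma env_factor_conv_prod:
  "env_factor \<gamma> \<eta> t xs = (\<Prod>j<length xs. if \<eta> (t + Suc j, xs ! j) then \<gamma> else 1)"
  by (induction xs arbitrary: t) (simp_all add: prod.lessThan_Suc_shift del: prod.lessThan_Suc)

lemma env_factor_eq_hamiltonian: "env_factor \<gamma> \<eta> 0 xs = \<gamma> ^ hamiltonian \<eta> xs"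
proof -
  let ?A = "{j. j < length xs \<and> \<eta> (Suc j, xs ! j)}"
  have "bij_betw Suc ?A {j\<in>{1..length xs}. \<eta> (j, pos xs j)}"
    by (rule bij_betwI[where g = "\<lambda>j. j - 1"]) (auto simp: pos_def)
  then have "hamiltonian \<eta> xs = card ?A"
    unfolding hamiltonian_def by (rule bij_betw_same_card[symmetric])
  moreover have "env_factor \<gamma> \<eta> 0 xs = (\<Prod>j\<in>?A. \<gamma>)"
    unfolding env_factor_conv_prod by (subst prod.inter_filter[symmetric]) (auto intro!: prod.cong)
  ultimately show ?thesis by simp
qed

lemma env_factor_measurable [measurable]:
  "(\<lambda>\<eta>. env_factor \<gamma> \<eta> t xs) \<in> borel_measurable (envQ p)"
proof (induction xs arbitrary: t)
  case (Cons x xs)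
  have [measurable]: "(\<lambda>\<eta>. \<eta> (Suc t, x)) \<in> envQ p \<rightarrow>\<^sub>M count_space UNIV"
    unfolding envQ_def by (rule measurable_component_singleton[where M = "\<lambda>_. measure_pmf (bernoulli_pmf p)", simplified]) simp
  note [measurable] = Cons.IH
  show ?case by simp
qed simp

locale polymer =
  fixes \<alpha> c2 \<Gamma> :: real and d :: "'d::finite itself"
  assumes \<alpha>_pos: "\<alpha> > 0" and c2_pos: "c2 > 0" and \<Gamma>_ge_1: "\<Gamma> \<ge> 1"
begin

definition c1 :: real where "c1 = c1_const \<alpha> c2 TYPE('d)"

definition expsum :: "real \<Rightarrow> real" where
  "expsum s = enn2real (\<integral>\<^sup>+(y::int ^ 'd). ennreal (exp (- s * real (l1norm y) powr \<alpha>)) \<partial>count_space UNIV)"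

lemma ennreal_expsum:
  "s > 0 \<Longrightarrow> (\<integral>\<^sup>+(y::int ^ 'd). ennreal (exp (- s * real (l1norm y) powr \<alpha>)) \<partial>count_space UNIV) = ennreal (expsum s)"
  unfolding expsum_def using nn_integral_exp_l1norm_finite[where 'd = 'd, of s \<alpha>] \<alpha>_pos by simp

lemma expsum_ge_1: "s > 0 \<Longrightarrow> expsum s \<ge> 1"
proof -
  assume s: "s > 0"
  have "ennreal 1 \<le> (\<integral>\<^sup>+(y::int ^ 'd). ennreal (exp (- s * real (l1norm y) powr \<alpha>)) \<partial>count_space UNIV)"
    using nn_integral_ge_point[of "0 :: int ^ 'd" UNIV "\<lambda>y. ennreal (exp (- s * real (l1norm y) powr \<alpha>))"] by simp
  then have "ennreal 1 \<le> ennreal (expsum s)" using ennreal_expsum[OF s] by simp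
  then show ?thesis by (simp add: expsum_def)
qed

lemma c1_eq: "c1 = 1 / expsum c2"
proof -
  have "(\<Sum>\<^sub>\<infinity>y::int ^ 'd. exp (- c2 * real (l1norm y) powr \<alpha>)) = expsum c2"
    unfolding expsum_def
    by (rule infsum_eq_enn2real_nn_integral) (use nn_integral_exp_l1norm_finite[of c2 \<alpha>] c2_pos \<alpha>_pos in auto)
  then show ?thesis by (simp add: c1_def c1_const_def)
qed

lemma c1_bounds: "c1 > 0" "c1 \<le> 1"
  using expsum_ge_1[OF c2_pos] by (simp_all add: c1_eq)

lemma path_sum_exp_cost:
  assumes "s > 0"
  shows "path_sum n (\<lambda>xs. ennreal (exp (- s * cost \<alpha> (jumps (a :: int ^ 'd) xs)))) = ennreal (expsum s ^ n)"
proof (induction n arbitrary: a)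
  case (Suc n)
  have "path_sum (Suc n) (\<lambda>xs. ennreal (exp (- s * cost \<alpha> (jumps a xs))))
      = (\<integral>\<^sup>+x. ennreal (exp (- s * real (l1norm (x - a)) powr \<alpha>))
            * path_sum n (\<lambda>xs. ennreal (exp (- s * cost \<alpha> (jumps x xs)))) \<partial>count_space UNIV)"
    by (simp add: path_sum_cmult[symmetric] ennreal_mult[symmetric] exp_add[symmetric] algebra_simps)
  also have "\<dots> = (\<integral>\<^sup>+x. ennreal (exp (- s * real (l1norm (x - a)) powr \<alpha>)) \<partial>count_space UNIV) * ennreal (expsum s ^ n)"
    unfolding Suc.IH by (simp add: nn_integral_multc)
  also have "(\<integral>\<^sup>+x. ennreal (exp (- s * real (l1norm (x - a)) powr \<alpha>)) \<partial>count_space UNIV) = ennreal (expsum s)"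
    using nn_integral_count_space_translate(1)[of "\<lambda>y. ennreal (exp (- s * real (l1norm y) powr \<alpha>))" a] ennreal_expsum[OF assms]
    by simp
  finally show ?case using expsum_ge_1[OF assms] by (simp add: ennreal_mult)
qed simp

definition weight :: "real \<Rightarrow> ('d::finite) env \<Rightarrow> nat \<Rightarrow> int ^ 'd \<Rightarrow> (int ^ 'd) list \<Rightarrow> real" where
  "weight \<gamma> \<eta> t a xs = c1 ^ length xs * exp (- c2 * cost \<alpha> (jumps a xs)) * env_factor \<gamma> \<eta> t xs"

lemma weight_append:
  "weight \<gamma> \<eta> t a (xs @ ys) = weight \<gamma> \<eta> t a xs * weight \<gamma> \<eta> (t + length xs) (last (a # xs)) ys"
  by (simp add: weight_def power_add exp_add[symmetric] algebra_simps)

lemma weight_nonneg: "\<gamma> \<ge> 0 \<Longrightarrow> weight \<gamma> \<eta> t a xs \<ge> 0"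
  using c1_bounds by (simp add: weight_def env_factor_nonneg)

lemma path_prob_conv_cost: "path_prob \<alpha> c2 xs = c1 ^ length xs * exp (- c2 * cost \<alpha> (jumps (0 :: int ^ 'd) xs))"
proof -
  have gen: "(\<Prod>j<length xs. kernel_f \<alpha> c2 TYPE('d) (l1norm ((a # xs) ! Suc j - (a # xs) ! j)))
     = c1 ^ length xs * exp (- c2 * cost \<alpha> (jumps a xs))" for a :: "int ^ 'd" and xs
    by (induction xs arbitrary: a)
       (simp_all add: prod.lessThan_Suc_shift kernel_f_def c1_def exp_add[symmetric] algebra_simps del: prod.lessThan_Suc)
  have "path_prob \<alpha> c2 xs = (\<Prod>j<length xs. kernel_f \<alpha> c2 TYPE('d) (l1norm ((0 # xs) ! Suc j - (0 # xs) ! j)))"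
    unfolding path_prob_def
    by (rule prod.reindex_bij_witness[of _ Suc "\<lambda>j. j - 1"]) (auto simp: pos_def nth_Cons')
  then show ?thesis unfolding gen .
qed

definition Zsum :: "real \<Rightarrow> ('d::finite) env \<Rightarrow> nat \<Rightarrow> ennreal" where
  "Zsum \<gamma> \<eta> n = path_sum n (\<lambda>xs. ennreal (weight \<gamma> \<eta> 0 0 xs))"

lemma Zsum_le:
  assumes "0 \<le> \<gamma>" "\<gamma> \<le> \<Gamma>"
  shows "Zsum \<gamma> \<eta> n \<le> ennreal (\<Gamma> ^ n)"
proof -
  have "Zsum \<gamma> \<eta> n \<le> path_sum n (\<lambda>xs. ennreal (c1 ^ n * \<Gamma> ^ n) * ennreal (exp (- c2 * cost \<alpha> (jumps (0 :: int ^ 'd) xs))))"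
    unfolding Zsum_def
  proof (rule path_sum_mono)
    fix xs :: "(int ^ 'd) list" assume n: "length xs = n"
    have "weight \<gamma> \<eta> 0 0 xs \<le> c1 ^ n * exp (- c2 * cost \<alpha> (jumps 0 xs)) * \<Gamma> ^ n"
      using env_factor_le[OF assms \<Gamma>_ge_1, of \<eta> 0 xs] n c1_bounds
      by (auto simp: weight_def intro!: mult_left_mono)
    then show "ennreal (weight \<gamma> \<eta> 0 0 xs) \<le> ennreal (c1 ^ n * \<Gamma> ^ n) * ennreal (exp (- c2 * cost \<alpha> (jumps 0 xs)))"
      using \<Gamma>_ge_1 c1_bounds by (simp add: ennreal_mult[symmetric] algebra_simps ennreal_leI)
  qed
  also have "\<dots> = ennreal (c1 ^ n * \<Gamma> ^ n) * ennreal (expsum c2 ^ n)"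
    by (simp add: path_sum_cmult path_sum_exp_cost[OF c2_pos, simplified])
  also have "\<dots> = ennreal (\<Gamma> ^ n)"
    using expsum_ge_1[OF c2_pos] \<Gamma>_ge_1 c1_bounds
    by (simp add: ennreal_mult[symmetric] c1_eq power_divide)
  finally show ?thesis .
qed

definition gamma_of :: "ereal \<Rightarrow> real" where
  "gamma_of \<beta> = (if \<beta> = -\<infinity> then 0 else exp (real_of_ereal \<beta>))"

lemma partition_fn_eq:
  assumes "0 \<le> gamma_of \<beta>" "gamma_of \<beta> \<le> \<Gamma>"
  shows "partition_fn \<alpha> c2 \<beta> n \<eta> = enn2real (Zsum (gamma_of \<beta>) \<eta> n)"
proof -
  have "partition_fn \<alpha> c2 \<beta> n \<eta> = (\<Sum>\<^sub>\<infinity>xs\<in>{xs. length xs = n}. weight (gamma_of \<beta>) \<eta> 0 0 xs)"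
    by (auto simp: partition_fn_def weight_def path_prob_conv_cost env_factor_eq_hamiltonian gamma_of_def
        exp_of_nat_mult[symmetric] mult.commute power_0_left intro!: infsum_cong)
  also have "\<dots> = enn2real (\<integral>\<^sup>+xs. ennreal (weight (gamma_of \<beta>) \<eta> 0 0 xs) \<partial>count_space {xs. length xs = n})"
    using Zsum_le[OF assms, of \<eta> n] assms
    by (intro infsum_eq_enn2real_nn_integral)
       (auto simp: weight_nonneg Zsum_def path_sum_eq_nn_integral less_top[symmetric] top_unique)
  finally show ?thesis by (simp add: Zsum_def path_sum_eq_nn_integral)
qed

lemma Zsum_measurable [measurable]: "(\<lambda>\<eta>. Zsum \<gamma> \<eta> n) \<in> borel_measurable (envQ p)"
  unfolding Zsum_def by (rule path_sum_nn_integral(1)) (simp add: weight_def)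

end

section \<open>Control of the jump size\<close>

lemma powr_above_tangent:
  fixes x y \<alpha> :: real
  assumes "\<alpha> \<ge> 1" "x > 0" "y \<ge> 0"
  shows "y powr \<alpha> \<ge> x powr \<alpha> + \<alpha> * x powr (\<alpha> - 1) * (y - x)"
proof (cases "y = 0")
  case True
  have "x powr (\<alpha> - 1) * x = x powr \<alpha>" using assms by (simp add: powr_diff)
  then have "x powr \<alpha> + \<alpha> * x powr (\<alpha> - 1) * (y - x) = (1 - \<alpha>) * x powr \<alpha>"
    using True by (simp add: algebra_simps)
  also have "\<dots> \<le> 0" using assms by (simp add: mult_nonpos_nonneg)
  finally show ?thesis using True by simp
next
  case False
  have "convex_on {0<..} (\<lambda>t. t powr \<alpha>)"
  proof (rule convex_on_realI)
    show "connected {0::real<..}" by simp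
    show "((\<lambda>t. t powr \<alpha>) has_real_derivative \<alpha> * t powr (\<alpha> - 1)) (at t)" if "t \<in> {0<..}" for t
      using that by (auto intro!: derivative_eq_intros)
    show "\<alpha> * s powr (\<alpha> - 1) \<le> \<alpha> * t powr (\<alpha> - 1)" if "s \<in> {0<..}" "t \<in> {0<..}" "s \<le> t" for s t
      using that assms by (intro mult_left_mono powr_mono2) auto
  qed
  then have "y powr \<alpha> - x powr \<alpha> \<ge> \<alpha> * x powr (\<alpha> - 1) * (y - x)"
    using assms False
    by (intro convex_on_imp_above_tangent[where A = "{0<..}"])
       (auto intro!: derivative_eq_intros simp: interior_open)
  then show ?thesis by simp
qed

lemma cost_ge_tangent:
  fixes v \<alpha> :: real and js :: "real list"
  assumes "\<alpha> \<ge> 1" "v > 0" "\<And>k. k \<in> set js \<Longrightarrow> k \<ge> 0"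
  shows "cost \<alpha> js \<ge> length js * v powr \<alpha> + \<alpha> * v powr (\<alpha> - 1) * (sum_list js - length js * v)"
  using assms(3)
proof (induction js)
  case (Cons k js)
  then show ?case
    using powr_above_tangent[OF assms(1,2), of k] by (simp add: algebra_simps)
qed simp

lemma cost_ge_mean_powr:
  fixes \<alpha> :: real and js :: "real list"
  assumes "\<alpha> \<ge> 1" "\<And>k. k \<in> set js \<Longrightarrow> k \<ge> 0"
  shows "length js * (sum_list js / length js) powr \<alpha> \<le> cost \<alpha> js"
proof (cases "sum_list js / length js > 0")
  case True
  then have "length js > 0" by (cases js) auto
  then show ?thesis using cost_ge_tangent[OF assms(1) True, of js] assms(2) by simp
next
  case False
  moreover have "sum_list js \<ge> 0" using assms(2) by (rule sum_list_nonneg)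
  ultimately have "sum_list js / length js = 0"
    by (meson divide_nonneg_nonneg not_less of_nat_0_le_iff order.antisym)
  then have "(sum_list js / length js) powr \<alpha> = 0" by (simp only: powr_zero_eq_one powr_0)
  then show ?thesis using cost_nonneg[of \<alpha> js] by (metis mult_zero_right)
qed

definition speed_ratio :: "real \<Rightarrow> real" where
  "speed_ratio \<alpha> = 2 + (1 + 2 * \<alpha> + 2 powr \<alpha>) powr (1 / (\<alpha> - 1))"

text \<open>The point is that \<open>speed_ratio \<alpha>\<close> does not depend on \<open>L\<close>: iterating over scales
  growing by a factor \<open>L\<close> therefore loses only a small power of the total length.\<close>

lemma mean_le_of_near_convex_equality:
  fixes h v u R w \<kappa> L \<alpha> :: real
  assumes \<alpha>: "\<alpha> > 1" and h: "0 < h" "h \<le> 1 / 2" "1 / L \<le> h" and L: "L \<ge> speed_ratio \<alpha>"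
    and \<kappa>: "0 \<le> \<kappa>" "\<kappa> \<le> 1 / (2 * L)" and uv: "v \<ge> 0" "u \<ge> 0" and R: "R > 0"
    and le: "(1 - \<kappa>) * (h * v powr \<alpha> + (1 - h) * u powr \<alpha>) \<le> (h * v + (1 - h) * u + R) powr \<alpha>"
  shows "v \<le> speed_ratio \<alpha> * (h * v + (1 - h) * u) + L * R"
proof -
  define c where "c = 1 + 2 * \<alpha> + 2 powr \<alpha>"
  define C where "C = c powr (1 / (\<alpha> - 1))"
  define m where "m = h * v + (1 - h) * u"
  define w where "w = m + R"
  have C: "C \<ge> 0" "speed_ratio \<alpha> = 2 + C" by (simp_all add: C_def c_def speed_ratio_def)
  have L2: "L \<ge> 2" using L C by simp
  have m0: "m \<ge> 0" using h uv by (simp add: m_def)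
  have w0: "w > 0" using m0 R by (simp add: w_def)
  consider "v \<le> L * R" | "v \<le> w" | "v > L * R" "v > w" by linarith
  then have "v \<le> speed_ratio \<alpha> * m + L * R"
  proof cases
    case 1
    have "speed_ratio \<alpha> * m \<ge> 0" using C m0 by simp
    with 1 show ?thesis by linarith
  next
    case 2
    have "1 * m \<le> speed_ratio \<alpha> * m" using C m0 by (intro mult_right_mono) auto
    moreover have "1 * R \<le> L * R" using L2 R by (intro mult_right_mono) auto
    ultimately show ?thesis using 2 by (simp add: w_def)
  next
    case 3
    have \<kappa>h: "\<kappa> \<le> h / 2" using \<kappa> h(3) by (simp add: field_simps) 
    have "1 \<le> (1 + h) * (1 - \<kappa>)"
    proof -
      have "\<kappa> * (1 + h) \<le> (h / 2) * (3 / 2)" using \<kappa>h h \<kappa> by (intro mult_mono) auto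
      then show ?thesis using h by (simp add: algebra_simps)
    qed
    then have "1 * (h * v powr \<alpha> + (1 - h) * u powr \<alpha>) \<le> (1 + h) * (1 - \<kappa>) * (h * v powr \<alpha> + (1 - h) * u powr \<alpha>)"
      using h by (intro mult_right_mono) auto
    also have "\<dots> = (1 + h) * ((1 - \<kappa>) * (h * v powr \<alpha> + (1 - h) * u powr \<alpha>))" by simp
    also have "\<dots> \<le> (1 + h) * w powr \<alpha>"
      using le h by (intro mult_left_mono) (auto simp: w_def m_def)
    finally have 4: "h * v powr \<alpha> + (1 - h) * u powr \<alpha> \<le> (1 + h) * w powr \<alpha>" by simp
    have "R < v / L" using 3 L2 by (simp add: field_simps)
    also have "v / L \<le> h * v" using mult_right_mono[OF h(3) uv(1)] by simp
    finally have "R < h * v" .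
    moreover have "h * u \<ge> 0" using h uv by simp
    ultimately have "w - u \<le> 2 * h * v" by (simp add: w_def m_def algebra_simps)
    then have "(\<alpha> * w powr (\<alpha> - 1)) * (w - u) \<le> (\<alpha> * w powr (\<alpha> - 1)) * (2 * h * v)"
      using \<alpha> by (intro mult_left_mono) auto
    moreover have "u powr \<alpha> \<ge> w powr \<alpha> + \<alpha> * w powr (\<alpha> - 1) * (u - w)"
      using powr_above_tangent[of \<alpha> w u] \<alpha> w0 uv by simp
    ultimately have "w powr \<alpha> - u powr \<alpha> \<le> h * (2 * \<alpha> * w powr (\<alpha> - 1) * v)"
      by (simp add: algebra_simps)
    with 4 have "h * v powr \<alpha> \<le> h * (w powr \<alpha> + u powr \<alpha> + 2 * \<alpha> * w powr (\<alpha> - 1) * v)"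
      by (simp add: algebra_simps)
    then have 5: "v powr \<alpha> \<le> w powr \<alpha> + u powr \<alpha> + 2 * \<alpha> * w powr (\<alpha> - 1) * v"
      using h by simp
    have "u \<le> 2 * w"
    proof -
      have "(1 / 2) * u \<le> (1 - h) * u" using h uv by (intro mult_right_mono) auto
      moreover have "h * v \<ge> 0" using h uv by simp
      ultimately show ?thesis using R by (simp add: w_def m_def)
    qed
    then have "u powr \<alpha> \<le> (2 * w) powr \<alpha>" using uv \<alpha> by (intro powr_mono2) auto
    also have "\<dots> = 2 powr \<alpha> * w powr \<alpha>" using w0 by (simp add: powr_mult)
    finally have 6: "u powr \<alpha> \<le> 2 powr \<alpha> * w powr \<alpha>" .
    have pw: "x powr \<alpha> = x powr (\<alpha> - 1) * x" if "x > 0" for x :: real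
      using that by (simp add: powr_diff)
    have v0: "v > 0" using 3 w0 by linarith
    have 7: "w powr \<alpha> \<le> w powr (\<alpha> - 1) * v" using 3 w0 by (simp add: pw mult_left_mono)
    have "v powr (\<alpha> - 1) * v \<le> c * w powr (\<alpha> - 1) * v"
    proof -
      have "v powr \<alpha> \<le> w powr (\<alpha> - 1) * v + 2 powr \<alpha> * (w powr (\<alpha> - 1) * v) + 2 * \<alpha> * w powr (\<alpha> - 1) * v"
        using 5 6 7 mult_left_mono[OF 7, of "2 powr \<alpha>"] powr_ge_zero[of 2 \<alpha>] by linarith
      also have "\<dots> = c * w powr (\<alpha> - 1) * v" by (simp add: c_def algebra_simps)
      finally show ?thesis by (simp add: pw[OF v0])
    qed
    then have 8: "v powr (\<alpha> - 1) \<le> c * w powr (\<alpha> - 1)" using v0 by simp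
    have c0: "c > 0" using \<alpha> by (simp add: c_def add_pos_pos)
    have "v = (v powr (\<alpha> - 1)) powr (1 / (\<alpha> - 1))" using \<alpha> v0 by (simp add: powr_powr)
    also have "\<dots> \<le> (c * w powr (\<alpha> - 1)) powr (1 / (\<alpha> - 1))"
      using 8 \<alpha> by (intro powr_mono2) auto
    also have "\<dots> = C * w" using \<alpha> w0 c0 by (simp add: powr_mult powr_powr C_def)
    finally have "v \<le> C * m + C * R" by (simp add: w_def algebra_simps)
    also have "\<dots> \<le> speed_ratio \<alpha> * m + L * R"
      using L C m0 R by (intro add_mono mult_right_mono) auto
    finally show ?thesis .
  qed
  then show ?thesis by (simp add: m_def)
qed

definition mean :: "real list \<Rightarrow> real" where
  "mean js = sum_list js / length js"

text \<open>On a window that is not bad, Jensen's inequality for the jump costs is nearly an equality.\<close>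

definition bad_window :: "real \<Rightarrow> real \<Rightarrow> real \<Rightarrow> real list \<Rightarrow> bool" where
  "bad_window \<alpha> \<kappa> R js \<longleftrightarrow> (1 - \<kappa>) * cost \<alpha> js > length js * (mean js + R) powr \<alpha>"

lemma mean_nonneg: "(\<And>k. k \<in> set js \<Longrightarrow> k \<ge> 0) \<Longrightarrow> mean js \<ge> 0"
  by (simp add: mean_def sum_list_nonneg)

lemma mean_le_enlarged_window:
  fixes \<alpha> L \<kappa> R :: real and js pre post :: "real list"
  assumes \<alpha>: "\<alpha> > 1" and L: "L \<ge> speed_ratio \<alpha>" and \<kappa>: "0 \<le> \<kappa>" "\<kappa> \<le> 1 / (2 * L)" and R: "R > 0"
    and nonneg: "\<And>k. k \<in> set (pre @ js @ post) \<Longrightarrow> k \<ge> 0" and ne: "js \<noteq> []"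
    and len: "length (pre @ js @ post) \<le> L * length js"
    and good: "\<not> bad_window \<alpha> \<kappa> R (pre @ js @ post)"
  shows "mean js \<le> speed_ratio \<alpha> * mean (pre @ js @ post) + L * R"
proof -
  let ?J = "pre @ js @ post"
  define N where "N = real (length ?J)"
  define l where "l = real (length js)"
  define h where "h = l / N"
  have l0: "l > 0" and lN: "l \<le> N" using ne by (auto simp: l_def N_def)
  have N0: "N > 0" using l0 lN by simp
  have s2: "speed_ratio \<alpha> \<ge> 2" by (simp add: speed_ratio_def)
  with L have L2: "L \<ge> 2" by linarith
  have h: "0 < h" "h \<le> 1" using l0 lN N0 by (simp_all add: h_def)
  have hL: "1 / L \<le> h" using len l0 N0 L2 by (simp add: h_def N_def l_def field_simps)
  have sum0: "sum_list js \<ge> 0" "sum_list pre \<ge> 0" "sum_list post \<ge> 0"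
    using nonneg by (auto intro!: sum_list_nonneg)
  have mean0: "mean ?J \<ge> 0" by (intro mean_nonneg nonneg)
  show ?thesis
  proof (cases "h \<le> 1 / 2")
    case False
    have "mean js = sum_list js / l" by (simp add: mean_def l_def)
    also have "\<dots> \<le> sum_list ?J / l" using sum0 l0 by (intro divide_right_mono) auto
    also have "\<dots> = mean ?J * (N / l)" using N0 by (simp add: mean_def N_def)
    also have "\<dots> \<le> mean ?J * 2"
      using mean0 False l0 N0 by (intro mult_left_mono) (auto simp: h_def field_simps)
    also have "\<dots> \<le> speed_ratio \<alpha> * mean ?J" using mean0 s2 by (simp add: mult.commute mult_right_mono)
    also have "\<dots> \<le> speed_ratio \<alpha> * mean ?J + L * R" using L2 R by simp
    finally show ?thesis .
  next
    case True
    define v where "v = mean js"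
    define u where "u = mean (pre @ post)"
    have N_l: "N - l = real (length (pre @ post))" by (simp add: N_def l_def)
    have Nl0: "N - l > 0" using True l0 N0 by (simp add: h_def field_simps)
    have h1: "1 - h = (N - l) / N" using N0 by (simp add: h_def field_simps)
    have m: "h * v + (1 - h) * u = mean ?J"
    proof -
      have "v = sum_list js / l" "u = sum_list (pre @ post) / (N - l)" "mean ?J = sum_list ?J / N"
        unfolding v_def u_def mean_def N_l by (simp_all add: l_def N_def)
      then have "h * v = sum_list js / N" "(1 - h) * u = sum_list (pre @ post) / N"
        unfolding h1 using l0 Nl0 N0 by (simp_all add: h_def)
      then show ?thesis
        using \<open>mean ?J = sum_list ?J / N\<close> by (simp add: add_divide_distrib)
    qed
    have "l * v powr \<alpha> + (N - l) * u powr \<alpha> \<le> cost \<alpha> js + cost \<alpha> (pre @ post)"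
      unfolding v_def u_def N_l mean_def unfolding l_def
      by (intro add_mono cost_ge_mean_powr) (use \<alpha> nonneg in auto)
    also have "\<dots> = cost \<alpha> ?J" by simp
    finally have "(1 - \<kappa>) * (l * v powr \<alpha> + (N - l) * u powr \<alpha>) \<le> (1 - \<kappa>) * cost \<alpha> ?J"
    proof (rule mult_left_mono)
      have "1 / (2 * L) \<le> 1" using L2 by simp
      then show "0 \<le> 1 - \<kappa>" using \<kappa> by linarith
    qed
    also have "\<dots> \<le> N * (mean ?J + R) powr \<alpha>"
      using good by (simp add: bad_window_def N_def del: length_append)
    finally have "(1 - \<kappa>) * (h * v powr \<alpha> + (1 - h) * u powr \<alpha>) \<le> (mean ?J + R) powr \<alpha>"
      unfolding h1 h_def using N0 by (simp add: field_simps)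
    then have "v \<le> speed_ratio \<alpha> * (h * v + (1 - h) * u) + L * R"
      unfolding m[symmetric]
      by (intro mean_le_of_near_convex_equality[where \<kappa> = \<kappa>])
         (use \<alpha> h True hL L \<kappa> R nonneg in \<open>auto simp: v_def u_def intro!: mean_nonneg\<close>)
    then show ?thesis unfolding m by (simp only: v_def)
  qed
qed

lemma take_drop_enlarge:
  assumes "s' \<le> s" "s + l \<le> s' + l'"
  obtains pre post where "take l' (drop s' xs) = pre @ take l (drop s xs) @ post"
proof -
  let ?ys = "take l' (drop s' xs)"
  have "take l (drop s xs) = take l (drop (s - s') ?ys)"
    using assms by (simp add: drop_take min_def add.commute)
  then have "?ys = take (s - s') ?ys @ take l (drop s xs) @ drop l (drop (s - s') ?ys)"
    by (metis append_take_drop_id)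
  then show ?thesis by (rule that)
qed

definition window :: "nat \<Rightarrow> nat \<Rightarrow> 'a list \<Rightarrow> 'a list" where
  "window j l xs = take l (drop (min j (length xs - l)) xs)"

lemma length_window: "l \<le> length xs \<Longrightarrow> length (window j l xs) = l"
  by (simp add: window_def)

lemma speed_bound:
  fixes \<alpha> \<epsilon> :: real
  assumes \<alpha>: "\<alpha> > 1" and \<epsilon>: "\<epsilon> > 0"
  obtains L :: nat and \<kappa> C :: real where "L \<ge> 2" "0 < \<kappa>" "\<kappa> < 1" "C > 0"
    "\<And>R j js. R > 0 \<Longrightarrow> j < length js \<Longrightarrow> (\<And>k. k \<in> set js \<Longrightarrow> k \<ge> 0) \<Longrightarrow>
       js ! j > C * R * length js powr \<epsilon> \<Longrightarrow>
       (1 - \<kappa>) * cost \<alpha> js > length js * R powr \<alpha> \<or>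
       (\<exists>k. L ^ k < length js \<and> bad_window \<alpha> \<kappa> R (window j (L ^ k) js))"
proof -
  define C0 where "C0 = speed_ratio \<alpha>"
  have C0: "C0 \<ge> 2" by (simp add: C0_def speed_ratio_def)
  define L where "L = nat \<lceil>C0\<rceil> + nat \<lceil>C0 powr (1 / \<epsilon>)\<rceil>"
  have "C0 \<le> nat \<lceil>C0\<rceil>" "C0 powr (1 / \<epsilon>) \<le> nat \<lceil>C0 powr (1 / \<epsilon>)\<rceil>"
    by (simp_all add: real_nat_ceiling_ge)
  then have L1: "real L \<ge> C0" and L2: "real L \<ge> C0 powr (1 / \<epsilon>)" unfolding L_def of_nat_add
    by (smt (verit) of_nat_0_le_iff)+
  have L: "L \<ge> 2" using L1 C0 by linarith
  have C0L: "C0 \<le> real L powr \<epsilon>"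
  proof -
    have "C0 = (C0 powr (1 / \<epsilon>)) powr \<epsilon>" using C0 \<epsilon> by (simp add: powr_powr)
    also have "\<dots> \<le> real L powr \<epsilon>" using L2 \<epsilon> by (intro powr_mono2) auto
    finally show ?thesis .
  qed
  define \<kappa> where "\<kappa> = 1 / (2 * real L)"
  have \<kappa>: "0 < \<kappa>" "\<kappa> \<le> 1 / 4" using L by (simp_all add: \<kappa>_def field_simps)
  define C where "C = (2 + real L) * real L powr \<epsilon>"
  have "C > 0" using L by (simp add: C_def)
  have main: "js ! j \<le> C * R * length js powr \<epsilon>"
    if R: "R > 0" and j: "j < length js" and nonneg: "\<And>k. k \<in> set js \<Longrightarrow> k \<ge> 0"
      and top: "(1 - \<kappa>) * cost \<alpha> js \<le> length js * R powr \<alpha>"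
      and win: "\<And>k. L ^ k < length js \<Longrightarrow> \<not> bad_window \<alpha> \<kappa> R (window j (L ^ k) js)" for R j js
  proof -
    define n where "n = length js"
    have n0: "n > 0" using j by (auto simp: n_def)
    define W where "W k = window j (min (L ^ k) n) js" for k
    have good: "\<not> bad_window \<alpha> \<kappa> R (W k)" for k
    proof (cases "L ^ k < n")
      case True then show ?thesis using win[of k] by (simp add: W_def n_def)
    next
      case False
      then have "W k = js" by (simp add: W_def n_def window_def)
      moreover have "R powr \<alpha> \<le> (mean js + R) powr \<alpha>"
        using R \<alpha> mean_nonneg[OF nonneg] by (intro powr_mono2) auto
      then have "length js * R powr \<alpha> \<le> length js * (mean js + R) powr \<alpha>"
        by (intro mult_left_mono) auto
      ultimately show ?thesis using top unfolding bad_window_def by auto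
    qed
    have lenW: "length (W k) = min (L ^ k) n" for k
      by (simp add: W_def length_window n_def)
    have setW: "set (W k) \<subseteq> set js" for k
      by (auto simp: W_def window_def dest: in_set_takeD in_set_dropD)
    have step: "mean (W k) \<le> C0 * mean (W (Suc k)) + real L * R" for k
    proof -
      have le: "min (L ^ k) n \<le> min (L ^ Suc k) n" using L by (auto simp: min_le_iff_disj)
      obtain pre post where eq: "W (Suc k) = pre @ W k @ post"
        using le unfolding W_def window_def n_def
        by (rule_tac take_drop_enlarge[of "min j (length js - min (L ^ Suc k) (length js))"
              "min j (length js - min (L ^ k) (length js))" "min (L ^ k) (length js)" "min (L ^ Suc k) (length js)" js])
           (linarith, linarith, blast)
      have "real (length (W (Suc k))) \<le> real L * real (length (W k))"
      proof -
        have "n \<le> L * n" "L ^ k \<le> L * L ^ k" using L by simp_all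
        then have "min (L ^ Suc k) n \<le> L * min (L ^ k) n" unfolding power_Suc by (cases "L ^ k \<le> n") (simp_all add: min.coboundedI2 min_absorb1 min_absorb2 le_cases)
        then show ?thesis unfolding lenW by (metis of_nat_mono of_nat_mult)
      qed
      moreover have "W k \<noteq> []" using lenW[of k] n0 L by (auto simp: min_def split: if_splits)
      ultimately show ?thesis
        unfolding C0_def eq using \<alpha> L1 \<kappa> R setW[of "Suc k"] nonneg good[of "Suc k"]
        by (intro mean_le_enlarged_window[where \<kappa> = \<kappa>]) (auto simp: eq C0_def \<kappa>_def)
    qed
    define m where "m = (LEAST m. n \<le> L ^ m)"
    have ex: "n \<le> L ^ n" using L by (metis less_exp less_le_not_le nless_le power_mono order_trans zero_le)
    have m: "n \<le> L ^ m" unfolding m_def using ex by (rule LeastI)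
    have top_mean: "mean (W m) \<le> 2 * R"
    proof -
      have Wm: "W m = js" using m by (simp add: W_def n_def window_def)
      have "n * mean js powr \<alpha> \<le> cost \<alpha> js"
        unfolding mean_def n_def by (rule cost_ge_mean_powr) (use \<alpha> nonneg in auto)
      also have "cost \<alpha> js \<le> 2 * ((1 - \<kappa>) * cost \<alpha> js)"
      proof -
        have "1 * cost \<alpha> js \<le> (2 * (1 - \<kappa>)) * cost \<alpha> js"
          using \<kappa> cost_nonneg[of \<alpha> js] by (intro mult_right_mono) auto
        then show ?thesis by (simp only: mult.assoc mult_1)
      qed
      also have "\<dots> \<le> 2 * (n * R powr \<alpha>)" using top by (simp add: n_def)
      finally have "mean js powr \<alpha> \<le> 2 * R powr \<alpha>" using n0 by (simp add: field_simps)
      also have "\<dots> \<le> 2 powr \<alpha> * R powr \<alpha>"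
        using powr_mono[of 1 \<alpha> 2] \<alpha> by (intro mult_right_mono) auto
      also have "\<dots> = (2 * R) powr \<alpha>" using R by (simp add: powr_mult)
      finally have "mean js powr \<alpha> \<le> (2 * R) powr \<alpha>" .
      then show ?thesis unfolding Wm
        using R \<alpha> mean_nonneg[OF nonneg] powr_less_mono2[of \<alpha> "2 * R" "mean js"] by fastforce
    qed
    have "i \<le> m \<Longrightarrow> mean (W (m - i)) \<le> C0 ^ i * ((2 + real L) * R) - real L * R" for i
    proof (induction i)
      case 0 then show ?case using top_mean by (simp add: algebra_simps)
    next
      case (Suc i)
      have "mean (W (m - Suc i)) \<le> C0 * mean (W (m - i)) + real L * R"
        using step[of "m - Suc i"] Suc.prems by (simp add: Suc_diff_Suc)
      also have "\<dots> \<le> C0 * (C0 ^ i * ((2 + real L) * R) - real L * R) + real L * R"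
        using Suc C0 by (intro add_mono mult_left_mono) auto
      also have "\<dots> = C0 ^ Suc i * ((2 + real L) * R) - C0 * (real L * R) + real L * R"
        by (simp add: algebra_simps)
      also have "\<dots> \<le> C0 ^ Suc i * ((2 + real L) * R) - 2 * (real L * R) + real L * R"
        using C0 R by (intro add_mono diff_mono mult_right_mono) auto
      finally show ?case by (simp add: mult.commute)
    qed
    moreover have "real L * R \<ge> 0" using R by simp
    ultimately have "mean (W 0) \<le> C0 ^ m * ((2 + real L) * R)"
      by (smt (verit) diff_self_eq_0 order_refl)
    moreover have "mean (W 0) = js ! j"
    proof -
      have "min (L ^ 0) n = 1" "min j (length js - 1) = j" using j n0 by simp_all
      then have "W 0 = take 1 (drop j js)" by (simp only: W_def window_def)
      also have "drop j js = js ! j # drop (Suc j) js" using j by (rule Cons_nth_drop_Suc[symmetric])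
      finally have "W 0 = [js ! j]" by simp
      then show ?thesis by (simp add: mean_def)
    qed
    moreover have "C0 ^ m \<le> (real L powr \<epsilon>) * n powr \<epsilon>"
    proof -
      have "C0 ^ m \<le> (real L powr \<epsilon>) ^ m" using C0 C0L by (intro power_mono) auto
      also have "\<dots> = (real (L ^ m)) powr \<epsilon>"
        using L by (simp add: powr_realpow[symmetric] powr_powr mult.commute)
      also have "\<dots> \<le> (real (L * n)) powr \<epsilon>"
      proof (intro powr_mono2 of_nat_mono)
        show "L ^ m \<le> L * n"
        proof (cases m)
          case 0 then show ?thesis using n0 L by simp
        next
          case (Suc m')
          have "\<not> n \<le> L ^ m'" using not_less_Least[of m' "\<lambda>m. n \<le> L ^ m"] Suc by (simp add: m_def[symmetric])
          then show ?thesis using Suc by simp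
        qed
      qed (use \<epsilon> in auto)
      finally show ?thesis by (simp add: powr_mult)
    qed
    then have "C0 ^ m * ((2 + real L) * R) \<le> (real L powr \<epsilon>) * n powr \<epsilon> * ((2 + real L) * R)"
      using R by (intro mult_right_mono) auto
    ultimately show ?thesis by (simp add: C_def n_def algebra_simps)
  qed
  show ?thesis
  proof (rule that[of L \<kappa> C])
    fix R :: real and j :: nat and js :: "real list"
    assume *: "R > 0" "j < length js" "\<And>k. k \<in> set js \<Longrightarrow> k \<ge> 0" "js ! j > C * R * length js powr \<epsilon>"
    show "(1 - \<kappa>) * cost \<alpha> js > length js * R powr \<alpha> \<or>
       (\<exists>k. L ^ k < length js \<and> bad_window \<alpha> \<kappa> R (window j (L ^ k) js))"
      using main[OF *(1-3)] *(4) by (meson not_less)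
  qed (use L \<kappa> \<open>C > 0\<close> in auto)
qed

section \<open>Rerouting through open sites\<close>

lemma real_l1norm: "real (l1norm x) = (\<Sum>i\<in>UNIV. \<bar>real_of_int (x $ i)\<bar>)"
  by (simp add: l1norm_def sum_nonneg)

lemma floor_diff_le: "\<bar>real_of_int (\<lfloor>x + t\<rfloor> - \<lfloor>x\<rfloor>)\<bar> \<le> \<bar>t\<bar> + (1::real)"
  by linarith

lemma lattice_segment:
  fixes a b :: "int ^ 'd" and m :: nat
  assumes "m > 0"
  obtains z :: "nat \<Rightarrow> int ^ 'd" where "z 0 = a" "z m = b"
    "\<And>k. real (l1norm (z (Suc k) - z k)) \<le> real (l1norm (b - a)) / m + CARD('d)"
proof -
  define z where "z k = (\<chi> i. a $ i + ((b $ i - a $ i) * int k) div int m)" for k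
  show ?thesis
  proof (rule that[of z])
    show "z 0 = a" "z m = b" using assms by (simp_all add: z_def vec_eq_iff)
    fix k
    have "\<bar>real_of_int ((z (Suc k) - z k) $ i)\<bar> \<le> \<bar>real_of_int ((b - a) $ i)\<bar> / m + 1" for i
    proof -
      define \<delta> where "\<delta> = b $ i - a $ i"
      have "(z (Suc k) - z k) $ i = (\<delta> * int (Suc k)) div int m - (\<delta> * int k) div int m"
        by (simp add: z_def \<delta>_def)
      also have "\<dots> = \<lfloor>real_of_int (\<delta> * int (Suc k)) / real_of_int (int m)\<rfloor>
                     - \<lfloor>real_of_int (\<delta> * int k) / real_of_int (int m)\<rfloor>"
        by (simp only: floor_divide_of_int_eq)
      also have "real_of_int (\<delta> * int (Suc k)) / real_of_int (int m)
          = real_of_int (\<delta> * int k) / real_of_int (int m) + real_of_int \<delta> / m"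
        using assms by (simp add: field_simps)
      finally have "\<bar>real_of_int ((z (Suc k) - z k) $ i)\<bar> \<le> \<bar>real_of_int \<delta> / m\<bar> + 1"
        using floor_diff_le by metis
      then show ?thesis by (simp add: \<delta>_def)
    qed
    then have "real (l1norm (z (Suc k) - z k)) \<le> (\<Sum>i\<in>(UNIV :: 'd set). \<bar>real_of_int ((b - a) $ i)\<bar> / m + 1)"
      unfolding real_l1norm by (intro sum_mono) 
    also have "\<dots> = real (l1norm (b - a)) / m + CARD('d)"
      unfolding real_l1norm by (simp add: sum.distrib sum_divide_distrib)
    finally show "real (l1norm (z (Suc k) - z k)) \<le> real (l1norm (b - a)) / m + CARD('d)" .
  qed
qed

lemma jumps_map_upt:
  "jumps (y s) (map y [Suc s..<Suc (s + l)]) = map (\<lambda>k. real (l1norm (y (Suc k) - y k))) [s..<s + l]"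
proof (induction l arbitrary: s)
  case (Suc l)
  have "[Suc s..<Suc (s + Suc l)] = Suc s # [Suc (Suc s)..<Suc (Suc s + l)]"
    by (simp add: upt_rec)
  moreover have "[s..<s + Suc l] = s # [Suc s..<Suc s + l]"
    by (simp add: upt_rec)
  ultimately show ?case using Suc.IH[of "Suc s"] by simp
qed simp

lemma env_factor_open:
  assumes "\<And>k. k < length xs \<Longrightarrow> \<not> \<eta> (t + Suc k, xs ! k)"
  shows "env_factor \<gamma> \<eta> t xs = 1"
  unfolding env_factor_conv_prod using assms by (intro prod.neutral) auto

definition dense_env :: "nat \<Rightarrow> ('d::finite) env \<Rightarrow> bool" where
  "dense_env r \<eta> \<longleftrightarrow> (\<forall>j y. \<exists>z. l1norm (z - y) \<le> r \<and> \<not> \<eta> (j, z))"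

lemma dense_env_near:
  assumes "dense_env r \<eta>"
  obtains near where "\<And>j y. l1norm (near j y - y) \<le> r" "\<And>j y. \<not> \<eta> (j, near j y)"
  using assms unfolding dense_env_def by metis

lemma open_line:
  fixes a b :: "int ^ 'd"
  assumes "dense_env r \<eta>" "\<alpha> \<ge> 0"
  obtains line where "length line = l" "env_factor \<gamma> \<eta> t line = 1"
    "cost \<alpha> (jumps a (line @ [b]))
       \<le> Suc l * (real (l1norm (b - a)) / Suc l + real (CARD('d) + 2 * r)) powr \<alpha>"
proof -
  obtain near where near: "\<And>j y. l1norm (near j y - y) \<le> r" "\<And>j y. \<not> \<eta> (j, near j y)"
    using dense_env_near[OF assms(1)] by blast
  obtain z where z: "z 0 = a" "z (Suc l) = b"
    "\<And>k. real (l1norm (z (Suc k) - z k)) \<le> real (l1norm (b - a)) / Suc l + CARD('d)"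
    using lattice_segment[of "Suc l" a b] by blast
  define y where "y k = (if k = 0 \<or> k = Suc l then z k else near (t + k) (z k))" for k
  have yz: "l1norm (y k - z k) \<le> r" for k using near by (simp add: y_def)
  have step: "real (l1norm (y (Suc k) - y k)) \<le> real (l1norm (b - a)) / Suc l + real (CARD('d) + 2 * r)" for k
  proof -
    have "l1norm (y (Suc k) - y k) \<le> l1norm (y (Suc k) - z (Suc k)) + l1norm (z (Suc k) - y k)"
      by (rule l1norm_diff_triangle)
    also have "l1norm (z (Suc k) - y k) \<le> l1norm (z (Suc k) - z k) + l1norm (z k - y k)"
      by (rule l1norm_diff_triangle)
    finally have "l1norm (y (Suc k) - y k) \<le> l1norm (z (Suc k) - z k) + 2 * r"
      using yz[of k] yz[of "Suc k"] by (simp add: l1norm_minus_commute[of "z k"])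
    then have "real (l1norm (y (Suc k) - y k)) \<le> real (l1norm (z (Suc k) - z k)) + real (2 * r)"
      using of_nat_mono by fastforce
    then show ?thesis using z(3)[of k] by simp
  qed
  let ?line = "map y [1..<Suc l]"
  show ?thesis
  proof (rule that[of ?line])
    show "length ?line = l" by simp
    show "env_factor \<gamma> \<eta> t ?line = 1"
      by (rule env_factor_open) (auto simp: y_def near simp del: upt_Suc)
    have ab: "y 0 = a" "y (Suc l) = b" using z by (simp_all add: y_def)
    have "jumps a (?line @ [b]) = jumps (y 0) (map y [Suc 0..<Suc (0 + Suc l)])"
      using ab by simp
    also have "\<dots> = map (\<lambda>k. real (l1norm (y (Suc k) - y k))) [0..<0 + Suc l]"
      by (rule jumps_map_upt)
    finally have eq: "jumps a (?line @ [b]) = map (\<lambda>k. real (l1norm (y (Suc k) - y k))) [0..<Suc l]"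
      by simp
    have "cost \<alpha> (jumps a (?line @ [b])) \<le> length (jumps a (?line @ [b])) * (real (l1norm (b - a)) / Suc l + real (CARD('d) + 2 * r)) powr \<alpha>"
      unfolding eq by (rule cost_le_const) (use step assms(2) in auto)
    then show "cost \<alpha> (jumps a (?line @ [b]))
       \<le> Suc l * (real (l1norm (b - a)) / Suc l + real (CARD('d) + 2 * r)) powr \<alpha>"
      unfolding eq by simp
  qed
qed

lemma open_constant_path:
  assumes "dense_env r \<eta>" "\<alpha> \<ge> 0"
  obtains line :: "(int ^ 'd) list" where "length line = n" "env_factor \<gamma> \<eta> 0 line = 1"
    "cost \<alpha> (jumps 0 line) \<le> n * real (2 * r) powr \<alpha>"
proof -
  obtain near where near: "\<And>j y. l1norm (near j y - y) \<le> r" "\<And>j y. \<not> \<eta> (j, near j y)"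
    using dense_env_near[OF assms(1)] by blast
  define y where "y k = (if k = 0 then 0 else near k 0)" for k
  have y: "l1norm (y k) \<le> r" for k using near(1)[of k 0] by (simp add: y_def)
  have step: "real (l1norm (y (Suc k) - y k)) \<le> real (2 * r)" for k
    using l1norm_diff_triangle[of "y (Suc k)" "y k" 0] y[of k] y[of "Suc k"] by simp
  let ?line = "map y [Suc 0..<Suc (0 + n)]"
  have eq: "jumps 0 ?line = map (\<lambda>k. real (l1norm (y (Suc k) - y k))) [0..<0 + n]"
    using jumps_map_upt[of y 0 n] by (simp add: y_def)
  show ?thesis
  proof (rule that[of ?line])
    show "length ?line = n" by simp
    show "env_factor \<gamma> \<eta> 0 ?line = 1"
      by (rule env_factor_open) (auto simp: y_def near simp del: upt_Suc)
    have "cost \<alpha> (jumps 0 ?line) \<le> length (jumps 0 ?line) * real (2 * r) powr \<alpha>"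
      by (rule cost_le_const) (use step assms(2) in \<open>auto simp only: eq set_map of_nat_0_le_iff\<close>)
    then show "cost \<alpha> (jumps 0 ?line) \<le> n * real (2 * r) powr \<alpha>"
      by (simp only: length_jumps length_map length_upt) simp
  qed
qed

lemma powr_superadditive:
  fixes x y \<alpha> :: real
  assumes "\<alpha> \<ge> 1" "x \<ge> 0" "y \<ge> 0"
  shows "x powr \<alpha> + y powr \<alpha> \<le> (x + y) powr \<alpha>"
proof (cases "x + y = 0")
  case False
  then have s: "x + y > 0" using assms by linarith
  have "x powr \<alpha> \<le> x * (x + y) powr (\<alpha> - 1)" "y powr \<alpha> \<le> y * (x + y) powr (\<alpha> - 1)"
  proof -
    have *: "z powr \<alpha> \<le> z * (x + y) powr (\<alpha> - 1)" if "0 \<le> z" "z \<le> x + y" for z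
    proof (cases "z = 0")
      case False
      then have "z powr \<alpha> = z * z powr (\<alpha> - 1)" using that by (simp add: powr_diff)
      also have "\<dots> \<le> z * (x + y) powr (\<alpha> - 1)"
        using that assms by (intro mult_left_mono powr_mono2) auto
      finally show ?thesis .
    qed simp
    show "x powr \<alpha> \<le> x * (x + y) powr (\<alpha> - 1)" "y powr \<alpha> \<le> y * (x + y) powr (\<alpha> - 1)"
      using assms by (auto intro!: *)
  qed
  then have "x powr \<alpha> + y powr \<alpha> \<le> (x + y) * (x + y) powr (\<alpha> - 1)" by (simp add: algebra_simps)
  also have "\<dots> = (x + y) powr \<alpha>" using s by (simp add: powr_diff)
  finally show ?thesis .
next
  case True
  then have "x = 0" "y = 0" using assms by linarith+
  then show ?thesis by simp
qed

lemma powr_subadditive: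
  fixes x y \<alpha> :: real
  assumes "0 < \<alpha>" "\<alpha> \<le> 1" "x \<ge> 0" "y \<ge> 0"
  shows "(x + y) powr \<alpha> \<le> x powr \<alpha> + y powr \<alpha>"
proof (cases "x = 0 \<or> y = 0")
  case False
  then have xy: "x > 0" "y > 0" using assms by auto
  have "z * (x + y) powr (\<alpha> - 1) \<le> z powr \<alpha>" if "0 < z" "z \<le> x + y" for z
  proof -
    have "z * (x + y) powr (\<alpha> - 1) \<le> z * z powr (\<alpha> - 1)"
      using that assms by (intro mult_left_mono powr_mono2') auto
    also have "\<dots> = z powr \<alpha>" using that by (simp add: powr_diff)
    finally show ?thesis .
  qed
  from this[of x] this[of y] have "(x + y) * (x + y) powr (\<alpha> - 1) \<le> x powr \<alpha> + y powr \<alpha>"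
    using xy by (simp add: algebra_simps)
  moreover have "(x + y) powr \<alpha> = (x + y) * (x + y) powr (\<alpha> - 1)" using xy by (simp add: powr_diff)
  ultimately show ?thesis by simp
qed auto

context polymer
begin

text \<open>A path that is expensive on a window is compared with the path in which the window is
  replaced by an open, nearly straight line. The fraction \<open>\<kappa>\<close> of the cost pays for the entropy.\<close>

lemma expensive_path_sum:
  fixes l m :: nat and E w :: real and a :: "int ^ 'd"
  assumes that: "w \<ge> 0" "l \<le> m" and \<gamma>: "0 \<le> \<gamma>" "\<gamma> \<le> \<Gamma>" and \<kappa>: "0 < \<kappa>"
    and gain: "exp (- c2 * g) * \<Gamma> * expsum (c2 * \<kappa>) \<le> 1 / 16"
  shows "path_sum l (\<lambda>xs. if (1 - \<kappa>) * (cost \<alpha> (jumps a xs) + e xs) > m * (E + g) \<and> e xs \<ge> 0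
             then ennreal (c1 ^ m * exp (- c2 * (cost \<alpha> (jumps a xs) + e xs)) * env_factor \<gamma> \<eta> t xs * w) else 0)
    \<le> ennreal ((1 / 16) ^ l * (exp (- c2 * g) ^ (m - l)) * (c1 ^ m * exp (- c2 * (m * E)) * w))"
    (is "path_sum l ?F \<le> _")
proof -
  have \<kappa>c: "c2 * \<kappa> > 0" using \<kappa> c2_pos by simp
  define B where "B = c1 ^ m * exp (- c2 * (m * E)) * w * exp (- c2 * g) ^ m * \<Gamma> ^ l"
  have B0: "B \<ge> 0" using c1_bounds \<Gamma>_ge_1 that by (simp add: B_def)
  have "path_sum l ?F
     \<le> path_sum l (\<lambda>xs. ennreal B * ennreal (exp (- (c2 * \<kappa>) * cost \<alpha> (jumps a xs))))"
  proof (rule path_sum_mono)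
    fix xs :: "(int ^ 'd) list" assume len: "length xs = l"
    show "?F xs
       \<le> ennreal B * ennreal (exp (- (c2 * \<kappa>) * cost \<alpha> (jumps a xs)))"
    proof (cases "(1 - \<kappa>) * (cost \<alpha> (jumps a xs) + e xs) > m * (E + g) \<and> e xs \<ge> 0")
      case True
      define c where "c = cost \<alpha> (jumps a xs)"
      have "c2 * (m * (E + g)) \<le> c2 * ((1 - \<kappa>) * (c + e xs))"
        using True c2_pos by (intro mult_left_mono) (auto simp: c_def)
      moreover have "0 \<le> c2 * (\<kappa> * e xs)" using True c2_pos \<kappa> by simp
      ultimately have le: "- c2 * (c + e xs) \<le> - c2 * (m * E) + m * (- c2 * g) + - (c2 * \<kappa>) * c"
        by (simp add: algebra_simps)
      have "c1 ^ m * exp (- c2 * (c + e xs)) * env_factor \<gamma> \<eta> t xs * w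
          \<le> c1 ^ m * exp (- c2 * (m * E) + m * (- c2 * g) + - (c2 * \<kappa>) * c) * \<Gamma> ^ l * w"
        using le c1_bounds that \<gamma> \<Gamma>_ge_1 env_factor_le[OF \<gamma> \<Gamma>_ge_1, of \<eta> t xs] len
        by (intro mult_right_mono mult_mono mult_left_mono env_factor_nonneg) auto
      also have "\<dots> = B * exp (- (c2 * \<kappa>) * c)"
        unfolding exp_add exp_of_nat_mult B_def by (simp only: mult_ac)
      finally show ?thesis using True B0 by (simp add: c_def ennreal_mult[symmetric] ennreal_leI del: mult_minus_left)
    qed auto
  qed
  also have "\<dots> = ennreal B * ennreal (expsum (c2 * \<kappa>) ^ l)"
    by (simp only: path_sum_cmult path_sum_exp_cost[OF \<kappa>c])
  also have "\<dots> = ennreal (B * expsum (c2 * \<kappa>) ^ l)"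
    using B0 expsum_ge_1[OF \<kappa>c] by (simp add: ennreal_mult)
  also have "B * expsum (c2 * \<kappa>) ^ l = (exp (- c2 * g) * \<Gamma> * expsum (c2 * \<kappa>)) ^ l * (exp (- c2 * g) ^ (m - l)) * (c1 ^ m * exp (- c2 * (m * E)) * w)"
  proof -
    have "exp (- c2 * g) ^ m = exp (- c2 * g) ^ l * exp (- c2 * g) ^ (m - l)"
      using that(2) by (simp add: power_add[symmetric])
    then show ?thesis by (simp add: B_def power_mult_distrib)
  qed
  also have "ennreal \<dots> \<le> ennreal ((1 / 16) ^ l * (exp (- c2 * g) ^ (m - l)) * (c1 ^ m * exp (- c2 * (m * E)) * w))"
    using gain c1_bounds that \<Gamma>_ge_1 expsum_ge_1[OF \<kappa>c]
    by (intro ennreal_leI mult_right_mono power_mono) auto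
  finally show ?thesis .
qed

lemma bad_window_bridge:
  fixes a b :: "int ^ 'd"
  assumes \<alpha>1: "\<alpha> \<ge> 1" and \<gamma>: "0 \<le> \<gamma>" "\<gamma> \<le> \<Gamma>" and \<kappa>: "0 < \<kappa>" and dense: "dense_env r \<eta>" and G: "G \<ge> 0"
    and gain: "exp (- c2 * G powr \<alpha>) * \<Gamma> * expsum (c2 * \<kappa>) \<le> 1 / 16"
    and R: "R = real (CARD('d) + 2 * r) + G"
  shows "path_sum l (\<lambda>xs. if bad_window \<alpha> \<kappa> R (jumps a (xs @ [b])) then ennreal (weight \<gamma> \<eta> t a (xs @ [b])) else 0)
      \<le> ennreal ((1 / 16) ^ Suc l) * path_sum l (\<lambda>xs. ennreal (weight \<gamma> \<eta> t a (xs @ [b])))"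
    (is "path_sum l ?F \<le> _")
proof -
  define m where "m = Suc l"
  define D where "D = real (l1norm (b - a)) / m + real (CARD('d) + 2 * r)"
  have D0: "D \<ge> 0" by (simp add: D_def)
  define w where "w = env_factor \<gamma> \<eta> (t + l) [b]"
  have w0: "w \<ge> 0" using \<gamma> by (simp add: w_def)
  obtain line where line: "length line = l" "env_factor \<gamma> \<eta> t line = 1"
    "cost \<alpha> (jumps a (line @ [b])) \<le> m * D powr \<alpha>"
    using open_line[OF dense, of \<alpha> l \<gamma> t a b] \<alpha>1 unfolding D_def m_def by auto
  have g1: "exp (- c2 * G powr \<alpha>) \<le> 1 / 16"
  proof -
    have "exp (- c2 * G powr \<alpha>) * 1 * 1 \<le> exp (- c2 * G powr \<alpha>) * \<Gamma> * expsum (c2 * \<kappa>)"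
      using \<Gamma>_ge_1 expsum_ge_1[of "c2 * \<kappa>"] \<kappa> c2_pos by (intro mult_mono) auto
    also note gain
    finally show ?thesis by simp
  qed
  let ?e = "\<lambda>xs. real (l1norm (b - last (a # xs))) powr \<alpha>"
  let ?H = "\<lambda>xs. if (1 - \<kappa>) * (cost \<alpha> (jumps a xs) + ?e xs) > m * (D powr \<alpha> + G powr \<alpha>)
              \<and> ?e xs \<ge> 0
             then ennreal (c1 ^ m * exp (- c2 * (cost \<alpha> (jumps a xs) + ?e xs)) * env_factor \<gamma> \<eta> t xs * w) else 0"
  have "path_sum l ?F \<le> path_sum l ?H"
  proof (rule path_sum_mono)
    fix xs :: "(int ^ 'd) list" assume len: "length xs = l"
    have wt: "weight \<gamma> \<eta> t a (xs @ [b]) = c1 ^ m * exp (- c2 * (cost \<alpha> (jumps a xs) + ?e xs)) * env_factor \<gamma> \<eta> t xs * w"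
      using len by (simp add: weight_def w_def m_def)
    have "m * (D powr \<alpha> + G powr \<alpha>) < (1 - \<kappa>) * (cost \<alpha> (jumps a xs) + ?e xs)"
      if bad: "bad_window \<alpha> \<kappa> R (jumps a (xs @ [b]))"
    proof -
      have "real (l1norm (b - a)) / m \<le> mean (jumps a (xs @ [b]))"
        using l1norm_le_sum_jumps[of a "xs @ [b]"] len unfolding mean_def m_def
        by (simp add: divide_right_mono del: jumps_append)
      then have "D + G \<le> mean (jumps a (xs @ [b])) + R" by (simp add: D_def R)
      then have "(D + G) powr \<alpha> \<le> (mean (jumps a (xs @ [b])) + R) powr \<alpha>"
        using D0 G \<alpha>1 by (intro powr_mono2) auto
      moreover have "D powr \<alpha> + G powr \<alpha> \<le> (D + G) powr \<alpha>"
        by (rule powr_superadditive[OF \<alpha>1 D0 G])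
      ultimately have "m * (D powr \<alpha> + G powr \<alpha>) \<le> m * (mean (jumps a (xs @ [b])) + R) powr \<alpha>"
        by (intro mult_left_mono) auto
      also have "\<dots> < (1 - \<kappa>) * cost \<alpha> (jumps a (xs @ [b]))"
        using bad len by (simp add: bad_window_def m_def del: jumps_append)
      finally show ?thesis by simp
    qed
    then show "?F xs
     \<le> ?H xs"
      unfolding wt by auto
  qed
  also have "\<dots> \<le> ennreal ((1 / 16) ^ l * (exp (- c2 * G powr \<alpha>) ^ (m - l)) * (c1 ^ m * exp (- c2 * (m * D powr \<alpha>)) * w))"
    by (rule expensive_path_sum[OF w0 _ \<gamma> \<kappa> gain]) (simp add: m_def)
  also have "\<dots> \<le> ennreal ((1 / 16) ^ l * (1 / 16) * weight \<gamma> \<eta> t a (line @ [b]))"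
  proof (intro ennreal_leI mult_mono mult_left_mono)
    show "exp (- c2 * G powr \<alpha>) ^ (m - l) \<le> 1 / 16" using g1 by (simp add: m_def)
    have "c2 * cost \<alpha> (jumps a (line @ [b])) \<le> c2 * (m * D powr \<alpha>)"
      using line(3) c2_pos by (intro mult_left_mono) auto
    then have "c1 ^ m * exp (- c2 * (m * D powr \<alpha>)) * w \<le> c1 ^ m * exp (- c2 * cost \<alpha> (jumps a (line @ [b]))) * w"
      using w0 c1_bounds by (intro mult_right_mono mult_left_mono) auto
    also have "\<dots> = weight \<gamma> \<eta> t a (line @ [b])"
      using line(1,2) by (simp add: weight_def w_def m_def)
    finally show "c1 ^ m * exp (- c2 * (m * D powr \<alpha>)) * w \<le> weight \<gamma> \<eta> t a (line @ [b])" .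
  qed (use c1_bounds w0 in auto)
  also have "\<dots> = ennreal ((1 / 16) ^ Suc l) * ennreal (weight \<gamma> \<eta> t a (line @ [b]))"
    using weight_nonneg[OF \<gamma>(1)] by (subst ennreal_mult[symmetric]) (auto simp: mult.commute)
  also have "\<dots> \<le> ennreal ((1 / 16) ^ Suc l) * path_sum l (\<lambda>xs. ennreal (weight \<gamma> \<eta> t a (xs @ [b])))"
    by (intro mult_left_mono path_sum_ge_point[where F = "\<lambda>xs. ennreal (weight \<gamma> \<eta> t a (xs @ [b]))"] line(1)) simp
  finally show ?thesis .
qed

lemma bad_window_sum:
  assumes \<alpha>1: "\<alpha> \<ge> 1" and \<gamma>: "0 \<le> \<gamma>" "\<gamma> \<le> \<Gamma>" and \<kappa>: "0 < \<kappa>" and dense: "dense_env r \<eta>" and G: "G \<ge> 0"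
    and gain: "exp (- c2 * G powr \<alpha>) * \<Gamma> * expsum (c2 * \<kappa>) \<le> 1 / 16"
    and R: "R = real (CARD('d) + 2 * r) + G" and l: "0 < l" "s + l \<le> n"
  shows "path_sum n (\<lambda>xs. if bad_window \<alpha> \<kappa> R (take l (drop s (jumps 0 xs))) then ennreal (weight \<gamma> \<eta> 0 0 xs) else 0)
      \<le> ennreal ((1 / 16) ^ l) * Zsum \<gamma> \<eta> n"
proof -
  obtain l' where l': "l = Suc l'" using l by (cases l) auto
  define u where "u = n - (s + l)"
  have n: "n = s + (l' + Suc 0 + u)" using l by (simp add: u_def l')
  define T where "T b = path_sum u (\<lambda>suf. ennreal (weight \<gamma> \<eta> (s + l) b suf))" for b
  have split: "path_sum n F = path_sum s (\<lambda>pre. \<integral>\<^sup>+b. path_sum l' (\<lambda>xs. path_sum u (\<lambda>suf. F (pre @ xs @ [b] @ suf))) \<partial>count_space UNIV)"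
    for F :: "(int ^ 'd) list \<Rightarrow> ennreal"
  proof -
    have "path_sum n F = path_sum s (\<lambda>pre. path_sum l' (\<lambda>xs. \<integral>\<^sup>+b. path_sum u (\<lambda>suf. F (pre @ xs @ [b] @ suf)) \<partial>count_space UNIV))"
      unfolding n path_sum_append by simp
    also have "\<dots> = path_sum s (\<lambda>pre. \<integral>\<^sup>+b. path_sum l' (\<lambda>xs. path_sum u (\<lambda>suf. F (pre @ xs @ [b] @ suf))) \<partial>count_space UNIV)"
      by (intro path_sum_cong path_sum_nn_integral(2)[symmetric]) simp
    finally show ?thesis .
  qed
  have wt: "weight \<gamma> \<eta> 0 0 (pre @ xs @ [b] @ suf)
      = weight \<gamma> \<eta> 0 0 pre * weight \<gamma> \<eta> s (last (0 # pre)) (xs @ [b]) * weight \<gamma> \<eta> (s + l) b suf"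
    if "length pre = s" "length xs = l'" for pre xs suf b
  proof -
    have "pre @ xs @ [b] @ suf = pre @ (xs @ [b]) @ suf" by simp
    then show ?thesis
      using that by (simp only: weight_append) (simp add: l')
  qed
  have inner: "path_sum l' (\<lambda>xs. path_sum u (\<lambda>suf.
       if bad_window \<alpha> \<kappa> R (take l (drop s (jumps 0 (pre @ xs @ [b] @ suf)))) then ennreal (weight \<gamma> \<eta> 0 0 (pre @ xs @ [b] @ suf)) else 0))
     \<le> ennreal ((1 / 16) ^ l) * path_sum l' (\<lambda>xs. path_sum u (\<lambda>suf. ennreal (weight \<gamma> \<eta> 0 0 (pre @ xs @ [b] @ suf))))"
    if pre: "length pre = s" for pre b
  proof -
    let ?a = "last (0 # pre)"
    let ?c = "ennreal (weight \<gamma> \<eta> 0 0 pre) * T b"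
    have win: "take l (drop s (jumps 0 (pre @ xs @ [b] @ suf))) = jumps ?a (xs @ [b])" if "length xs = l'" for xs suf
    proof -
      have "jumps 0 (pre @ (xs @ [b]) @ suf) = jumps 0 pre @ jumps ?a (xs @ [b]) @ jumps (last (?a # xs @ [b])) suf"
        by (simp only: jumps_append)
      moreover have "length (jumps 0 pre) = s" "length (jumps ?a (xs @ [b])) = l" using pre that l' by simp_all
      ultimately show ?thesis by (simp del: jumps_append)
    qed
    let ?I = "\<lambda>xs. path_sum u (\<lambda>suf.
       if bad_window \<alpha> \<kappa> R (take l (drop s (jumps 0 (pre @ xs @ [b] @ suf)))) then ennreal (weight \<gamma> \<eta> 0 0 (pre @ xs @ [b] @ suf)) else 0)"
    have "path_sum l' (\<lambda>xs. ?I xs)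
      = path_sum l' (\<lambda>xs. ?c * (if bad_window \<alpha> \<kappa> R (jumps ?a (xs @ [b])) then ennreal (weight \<gamma> \<eta> s ?a (xs @ [b])) else 0))"
    proof (rule path_sum_cong)
      fix xs :: "(int ^ 'd) list" assume len: "length xs = l'"
      show "?I xs
       = ?c * (if bad_window \<alpha> \<kappa> R (jumps ?a (xs @ [b])) then ennreal (weight \<gamma> \<eta> s ?a (xs @ [b])) else 0)"
        unfolding win[OF len] wt[OF pre len]
        by (simp add: T_def ennreal_mult weight_nonneg \<gamma> path_sum_cmult mult.assoc del: jumps_append)
           (simp add: mult_ac)
    qed
    also have "\<dots> = ?c * path_sum l' (\<lambda>xs. if bad_window \<alpha> \<kappa> R (jumps ?a (xs @ [b])) then ennreal (weight \<gamma> \<eta> s ?a (xs @ [b])) else 0)"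
      by (rule path_sum_cmult)
    also have "\<dots> \<le> ?c * (ennreal ((1 / 16) ^ Suc l') * path_sum l' (\<lambda>xs. ennreal (weight \<gamma> \<eta> s ?a (xs @ [b]))))"
      by (intro mult_left_mono bad_window_bridge[OF \<alpha>1 \<gamma> \<kappa> dense G gain R]) simp
    also have "\<dots> = ennreal ((1 / 16) ^ l) * path_sum l' (\<lambda>xs. ?c * ennreal (weight \<gamma> \<eta> s ?a (xs @ [b])))"
      by (simp add: path_sum_cmult l' mult_ac)
    also have "path_sum l' (\<lambda>xs. ?c * ennreal (weight \<gamma> \<eta> s ?a (xs @ [b])))
        = path_sum l' (\<lambda>xs. path_sum u (\<lambda>suf. ennreal (weight \<gamma> \<eta> 0 0 (pre @ xs @ [b] @ suf))))"
      by (intro path_sum_cong)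
         (simp add: wt[OF pre, simplified] T_def ennreal_mult weight_nonneg \<gamma> path_sum_cmult mult.assoc,
          simp add: mult_ac)
    finally show ?thesis .
  qed
  show ?thesis
    unfolding Zsum_def split path_sum_cmult[symmetric]
    by (intro path_sum_mono order_trans[OF nn_integral_mono[OF inner]]) (simp_all add: nn_integral_cmult)
qed


lemma expensive_total_sum:
  assumes \<alpha>1: "\<alpha> \<ge> 1" and \<gamma>: "0 \<le> \<gamma>" "\<gamma> \<le> \<Gamma>" and \<kappa>: "0 < \<kappa>" "\<kappa> < 1" and dense: "dense_env r \<eta>" and G: "G \<ge> 0"
    and gain: "exp (- c2 * G powr \<alpha>) * \<Gamma> * expsum (c2 * \<kappa>) \<le> 1 / 16"
    and R: "R = real (CARD('d) + 2 * r) + G"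
  shows "path_sum n (\<lambda>xs. if (1 - \<kappa>) * cost \<alpha> (jumps 0 xs) > n * R powr \<alpha> then ennreal (weight \<gamma> \<eta> 0 0 xs) else 0)
      \<le> ennreal ((1 / 16) ^ n) * Zsum \<gamma> \<eta> n"
    (is "path_sum n ?F \<le> _")
proof -
  define D where "D = real (2 * r)"
  obtain line :: "(int ^ 'd) list" where line: "length line = n" "env_factor \<gamma> \<eta> 0 line = 1"
    "cost \<alpha> (jumps 0 line) \<le> n * D powr \<alpha>"
    unfolding D_def using open_constant_path[OF dense, of \<alpha> n \<gamma>] \<alpha>1 by auto
  have RDG: "D powr \<alpha> + G powr \<alpha> \<le> R powr \<alpha>"
  proof -
    have "D powr \<alpha> + G powr \<alpha> \<le> (D + G) powr \<alpha>" using G by (intro powr_superadditive[OF \<alpha>1]) (simp_all add: D_def)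
    also have "\<dots> \<le> R powr \<alpha>" using G \<alpha>1 by (intro powr_mono2) (auto simp: D_def R)
    finally show ?thesis .
  qed
  let ?H = "\<lambda>xs. if (1 - \<kappa>) * (cost \<alpha> (jumps 0 xs) + 0) > n * (D powr \<alpha> + G powr \<alpha>) \<and> (0::real) \<le> 0
             then ennreal (c1 ^ n * exp (- c2 * (cost \<alpha> (jumps 0 xs) + 0)) * env_factor \<gamma> \<eta> 0 xs * 1) else 0"
  have "path_sum n ?F \<le> path_sum n ?H"
  proof (rule path_sum_mono)
    fix xs :: "(int ^ 'd) list" assume len: "length xs = n"
    have "n * (D powr \<alpha> + G powr \<alpha>) \<le> n * R powr \<alpha>" using RDG by (intro mult_left_mono) auto
    then show "?F xs
      \<le> ?H xs"
      using len by (auto simp: weight_def)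
  qed
  also have "\<dots> \<le> ennreal ((1 / 16) ^ n * (exp (- c2 * G powr \<alpha>) ^ (n - n)) * (c1 ^ n * exp (- c2 * (n * D powr \<alpha>)) * 1))"
    by (rule expensive_path_sum[OF _ _ \<gamma> \<kappa>(1) gain]) simp_all
  also have "\<dots> \<le> ennreal ((1 / 16) ^ n * weight \<gamma> \<eta> 0 0 line)"
  proof (intro ennreal_leI)
    have "c2 * cost \<alpha> (jumps 0 line) \<le> c2 * (n * D powr \<alpha>)"
      using line(3) c2_pos by (intro mult_left_mono) auto
    then have "c1 ^ n * exp (- c2 * (n * D powr \<alpha>)) \<le> weight \<gamma> \<eta> 0 0 line"
      using c1_bounds line by (auto simp: weight_def intro!: mult_left_mono)
    then show "(1 / 16) ^ n * (exp (- c2 * G powr \<alpha>) ^ (n - n)) * (c1 ^ n * exp (- c2 * (n * D powr \<alpha>)) * 1)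
       \<le> (1 / 16) ^ n * weight \<gamma> \<eta> 0 0 line"
      by (simp add: mult_left_mono)
  qed
  also have "\<dots> = ennreal ((1 / 16) ^ n) * ennreal (weight \<gamma> \<eta> 0 0 line)"
    using weight_nonneg[OF \<gamma>(1)] by (subst ennreal_mult[symmetric]) auto
  also have "\<dots> \<le> ennreal ((1 / 16) ^ n) * Zsum \<gamma> \<eta> n"
    unfolding Zsum_def
    by (intro mult_left_mono path_sum_ge_point[where F = "\<lambda>xs. ennreal (weight \<gamma> \<eta> 0 0 xs)"] line(1)) simp
  finally show ?thesis .
qed

lemma Zsum_lower_bound:
  assumes \<gamma>: "0 \<le> \<gamma>" and dense: "dense_env r \<eta>"
  shows "ennreal (c1 ^ n * exp (- c2 * (n * real (2 * r) powr \<alpha>))) \<le> Zsum \<gamma> \<eta> n"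
proof -
  obtain line :: "(int ^ 'd) list" where line: "length line = n" "env_factor \<gamma> \<eta> 0 line = 1"
    "cost \<alpha> (jumps 0 line) \<le> n * real (2 * r) powr \<alpha>"
    using open_constant_path[OF dense, of \<alpha> n \<gamma>] \<alpha>_pos by auto
  have "c2 * cost \<alpha> (jumps 0 line) \<le> c2 * (n * real (2 * r) powr \<alpha>)"
    using line(3) c2_pos by (intro mult_left_mono) auto
  then have "c1 ^ n * exp (- c2 * (n * real (2 * r) powr \<alpha>)) \<le> weight \<gamma> \<eta> 0 0 line"
    using c1_bounds line by (auto simp: weight_def intro!: mult_left_mono)
  then have "ennreal (c1 ^ n * exp (- c2 * (n * real (2 * r) powr \<alpha>))) \<le> ennreal (weight \<gamma> \<eta> 0 0 line)"
    by (rule ennreal_leI)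
  also have "\<dots> \<le> Zsum \<gamma> \<eta> n"
    unfolding Zsum_def by (rule path_sum_ge_point[where F = "\<lambda>xs. ennreal (weight \<gamma> \<eta> 0 0 xs)", OF line(1)])
  finally show ?thesis .
qed

lemma large_jump_sum:
  assumes \<alpha>1: "\<alpha> > 1" and \<epsilon>: "\<epsilon> > 0"
  obtains C :: real where "C > 0"
    "\<And>\<gamma> r \<eta> n j. 0 \<le> \<gamma> \<Longrightarrow> \<gamma> \<le> \<Gamma> \<Longrightarrow> 1 \<le> r \<Longrightarrow> dense_env r \<eta> \<Longrightarrow> j < n \<Longrightarrow>
       path_sum n (\<lambda>xs. if jumps 0 xs ! j > C * r * n powr \<epsilon> then ennreal (weight \<gamma> \<eta> 0 0 xs) else 0)
       \<le> ennreal (1 / 4) * Zsum \<gamma> \<eta> n"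
proof -
  obtain L :: nat and \<kappa> C :: real where L: "L \<ge> 2" and \<kappa>: "0 < \<kappa>" "\<kappa> < 1" and C: "C > 0"
    and speed: "\<And>R j js. R > 0 \<Longrightarrow> j < length js \<Longrightarrow> (\<And>k. k \<in> set js \<Longrightarrow> k \<ge> 0) \<Longrightarrow>
       js ! j > C * R * length js powr \<epsilon> \<Longrightarrow>
       (1 - \<kappa>) * cost \<alpha> js > length js * R powr \<alpha> \<or>
       (\<exists>k. L ^ k < length js \<and> bad_window \<alpha> \<kappa> R (window j (L ^ k) js))"
    using speed_bound[OF \<alpha>1 \<epsilon>] by metis
  define A where "A = 16 * \<Gamma> * expsum (c2 * \<kappa>)"
  have A: "A \<ge> 16"
  proof -
    have "16 * 1 * 1 \<le> A" unfolding A_def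
      using \<Gamma>_ge_1 expsum_ge_1[of "c2 * \<kappa>"] \<kappa> c2_pos by (intro mult_mono) auto
    then show ?thesis by simp
  qed
  define G where "G = (ln A / c2) powr (1 / \<alpha>)"
  have G: "G \<ge> 0" by (simp add: G_def)
  have "G powr \<alpha> = ln A / c2"
    using \<alpha>1 A c2_pos by (simp add: G_def powr_powr)
  then have "exp (- c2 * G powr \<alpha>) = 1 / A"
    using c2_pos A by (simp add: exp_minus inverse_eq_divide)
  then have gain: "exp (- c2 * G powr \<alpha>) * \<Gamma> * expsum (c2 * \<kappa>) \<le> 1 / 16"
    using \<Gamma>_ge_1 expsum_ge_1[of "c2 * \<kappa>"] \<kappa> c2_pos A by (simp add: A_def)
  define C' where "C' = C * (CARD('d) + 2 + G)"
  have C': "C' > 0" using C G by (simp add: C'_def)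
  show ?thesis
  proof (rule that[OF C'])
    fix \<gamma> :: real and r :: nat and \<eta> :: "('d::finite) env" and n j :: nat
    assume \<gamma>: "0 \<le> \<gamma>" "\<gamma> \<le> \<Gamma>" and r: "1 \<le> r" and dense: "dense_env r \<eta>" and j: "j < n"
    define R where "R = real (CARD('d) + 2 * r) + G"
    have R0: "R > 0" using G r by (simp add: R_def)
    have "(CARD('d) + G) * 1 \<le> (CARD('d) + G) * real r"
      using r G by (intro mult_left_mono) auto
    then have "R \<le> (CARD('d) + 2 + G) * r"
      by (simp add: R_def algebra_simps)
    then have CR: "C * R * n powr \<epsilon> \<le> C' * r * n powr \<epsilon>"
      using mult_left_mono[of R "(CARD('d) + 2 + G) * r" C] C
      by (intro mult_right_mono) (simp_all add: C'_def mult.assoc)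
    define K where "K = {k. L ^ k < n}"
    have Ksub: "K \<subseteq> {..<n}"
    proof
      fix k assume "k \<in> K"
      moreover have "k < L ^ k" using L by (metis less_exp less_le_trans power_mono zero_le)
      ultimately show "k \<in> {..<n}" by (simp add: K_def)
    qed
    then have finK: "finite K" by (rule finite_subset) simp
    define s where "s k = min j (n - L ^ k)" for k
    let ?w = "\<lambda>xs. ennreal (weight \<gamma> \<eta> 0 0 xs)"
    let ?b = "\<lambda>k xs. if bad_window \<alpha> \<kappa> R (take (L ^ k) (drop (s k) (jumps 0 xs))) then ?w xs else 0"
    let ?c = "\<lambda>xs. if (1 - \<kappa>) * cost \<alpha> (jumps 0 xs) > n * R powr \<alpha> then ?w xs else 0"
    have "path_sum n (\<lambda>xs. if jumps 0 xs ! j > C' * r * n powr \<epsilon> then ?w xs else 0)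
       \<le> path_sum n (\<lambda>xs. ?c xs
            + (\<Sum>k\<in>K. ?b k xs))"
    proof (rule path_sum_mono)
      fix xs :: "(int ^ 'd) list" assume len: "length xs = n"
      let ?S = "\<Sum>k\<in>K. ?b k xs"
      show "(if jumps 0 xs ! j > C' * r * n powr \<epsilon> then ?w xs else 0)
        \<le> ?c xs + ?S"
      proof (cases "jumps 0 xs ! j > C' * r * n powr \<epsilon>")
        case True
        then have "jumps 0 xs ! j > C * R * length (jumps 0 xs) powr \<epsilon>" using CR len by simp
        from speed[OF R0 _ _ this] jumps_nonneg[of _ 0 xs] j len
        consider "(1 - \<kappa>) * cost \<alpha> (jumps 0 xs) > n * R powr \<alpha>"
          | k where "L ^ k < n" "bad_window \<alpha> \<kappa> R (window j (L ^ k) (jumps 0 xs))" by auto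
        then show ?thesis
        proof cases
          case (2 k)
          then have k: "k \<in> K" "bad_window \<alpha> \<kappa> R (take (L ^ k) (drop (s k) (jumps 0 xs)))"
            using len by (simp_all add: K_def window_def s_def)
          have "?w xs \<le> ?S"
            using member_le_sum[of k K "\<lambda>k. ?b k xs"]
              k finK by simp
          then show ?thesis using True by (auto intro: add_increasing)
        qed (use True in auto)
      qed auto
    qed
    also have "\<dots> = path_sum n ?c
            + (\<Sum>k\<in>K. path_sum n (?b k))"
      by (simp add: path_sum_add path_sum_sum[OF finK])
    also have "\<dots> \<le> ennreal ((1 / 16) ^ n) * Zsum \<gamma> \<eta> n + (\<Sum>k\<in>K. ennreal ((1 / 16) ^ (L ^ k)) * Zsum \<gamma> \<eta> n)"
    proof (intro add_mono sum_mono)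
      show "path_sum n ?c
         \<le> ennreal ((1 / 16) ^ n) * Zsum \<gamma> \<eta> n"
        by (rule expensive_total_sum[OF _ \<gamma> \<kappa> dense G gain R_def]) (use \<alpha>1 in simp)
      show "path_sum n (?b k)
         \<le> ennreal ((1 / 16) ^ (L ^ k)) * Zsum \<gamma> \<eta> n" if "k \<in> K" for k
        by (rule bad_window_sum[OF _ \<gamma> \<kappa>(1) dense G gain R_def])
           (use \<alpha>1 L that in \<open>auto simp: s_def K_def\<close>)
    qed
    also have "\<dots> = ennreal ((1 / 16) ^ n + (\<Sum>k\<in>K. (1 / 16) ^ (L ^ k))) * Zsum \<gamma> \<eta> n"
      by (simp add: sum_distrib_right[symmetric] distrib_right[symmetric] ennreal_plus[symmetric] sum_nonneg del: ennreal_plus)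
    also have "\<dots> \<le> ennreal (1 / 4) * Zsum \<gamma> \<eta> n"
    proof (intro mult_right_mono ennreal_leI)
      have "(\<Sum>k\<in>K. (1 / 16 :: real) ^ (L ^ k)) \<le> (\<Sum>k\<in>K. (1 / 16) ^ Suc k)"
      proof (intro sum_mono power_decreasing)
        fix k
        have "k < L ^ k" using L by (metis less_exp less_le_trans power_mono zero_le)
        then show "Suc k \<le> L ^ k" by simp
      qed auto
      also have "\<dots> \<le> (\<Sum>k<n. (1 / 16) ^ Suc k)"
        using Ksub by (intro sum_mono2) auto
      also have "\<dots> = (\<Sum>k<n. (1 / 16) ^ k) / 16" by (simp add: sum_divide_distrib)
      also have "\<dots> \<le> (\<Sum>k. (1 / 16 :: real) ^ k) / 16"
        by (intro divide_right_mono sum_le_suminf summable_geometric) auto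
      also have "\<dots> = 1 / 15" by (simp add: suminf_geometric)
      finally have "(\<Sum>k\<in>K. (1 / 16 :: real) ^ (L ^ k)) \<le> 1 / 15" .
      moreover have "(1 / 16 :: real) ^ n \<le> (1 / 16) ^ 1" using j by (intro power_decreasing) auto
      ultimately show "(1 / 16) ^ n + (\<Sum>k\<in>K. (1 / 16 :: real) ^ (L ^ k)) \<le> 1 / 4" by simp
    qed simp
    finally show "path_sum n (\<lambda>xs. if jumps 0 xs ! j > C' * r * n powr \<epsilon> then ?w xs else 0)
       \<le> ennreal (1 / 4) * Zsum \<gamma> \<eta> n" .
  qed
qed

lemma replace_site_sum:
  fixes pre :: "(int ^ 'd) list"
  assumes \<gamma>: "0 \<le> \<gamma>" "\<gamma> \<le> \<Gamma>" and dense: "dense_env r \<eta>'"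
    and agree: "\<And>i x. i \<noteq> Suc t \<Longrightarrow> \<eta> (i, x) = \<eta>' (i, x)"
    and n: "n = t + Suc u"
    and ok: "\<And>pre x suf y. length pre = t \<Longrightarrow> length suf = u \<Longrightarrow> ok (pre @ x # suf) \<Longrightarrow> l1norm (y - x) \<le> r \<Longrightarrow>
        cost \<alpha> (jumps 0 (pre @ y # suf)) \<le> cost \<alpha> (jumps 0 (pre @ x # suf)) + M"
  shows "path_sum n (\<lambda>xs. if ok xs then ennreal (weight \<gamma> \<eta> 0 0 xs) else 0)
      \<le> ennreal (exp (c2 * M) * \<Gamma> * (2 * real r + 1) ^ CARD('d)) * Zsum \<gamma> \<eta>' n"
proof -
  obtain near where near: "\<And>j y. l1norm (near j y - y) \<le> r" "\<And>j y. \<not> \<eta>' (j, near j y)"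
    using dense_env_near[OF dense] by blast
  let ?w' = "\<lambda>xs. ennreal (weight \<gamma> \<eta>' 0 0 xs)"
  define B where "B = {v :: int ^ 'd. l1norm v \<le> r}"
  have B: "finite B" "card B \<le> (2 * r + 1) ^ CARD('d)" unfolding B_def by (rule l1ball_finite_card)+
  have split: "path_sum n F = path_sum t (\<lambda>pre. \<integral>\<^sup>+x. path_sum u (\<lambda>suf. F (pre @ x # suf)) \<partial>count_space UNIV)"
    for F :: "(int ^ 'd) list \<Rightarrow> ennreal"
    unfolding n path_sum_append by simp
  have pt: "(if ok (pre @ x # suf) then ennreal (weight \<gamma> \<eta> 0 0 (pre @ x # suf)) else 0)
      \<le> ennreal (exp (c2 * M) * \<Gamma>) * ?w' (pre @ near (Suc t) x # suf)"
    if len: "length pre = t" "length suf = u" for pre suf x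
  proof (cases "ok (pre @ x # suf)")
    case True
    let ?y = "near (Suc t) x"
    have "env_factor \<gamma> \<eta> 0 pre = env_factor \<gamma> \<eta>' 0 pre"
      using len agree by (intro env_factor_cong) auto
    moreover have "env_factor \<gamma> \<eta> (Suc t) suf = env_factor \<gamma> \<eta>' (Suc t) suf"
      using len agree by (intro env_factor_cong) auto
    moreover have "(if \<eta> (Suc t, x) then \<gamma> else 1) \<le> \<Gamma>" using \<gamma> \<Gamma>_ge_1 by simp
    moreover have "env_factor \<gamma> \<eta>' 0 pre * env_factor \<gamma> \<eta>' (Suc t) suf \<ge> 0"
      by (intro mult_nonneg_nonneg env_factor_nonneg \<gamma>)
    ultimately have "(if \<eta> (Suc t, x) then \<gamma> else 1) * (env_factor \<gamma> \<eta> 0 pre * env_factor \<gamma> \<eta> (Suc t) suf)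
        \<le> \<Gamma> * (env_factor \<gamma> \<eta>' 0 pre * env_factor \<gamma> \<eta>' (Suc t) suf)"
      by (simp only: mult_right_mono)
    then have env: "env_factor \<gamma> \<eta> 0 (pre @ x # suf) \<le> \<Gamma> * env_factor \<gamma> \<eta>' 0 (pre @ ?y # suf)"
      using len near by (simp add: mult_ac)
    have "c2 * cost \<alpha> (jumps 0 (pre @ ?y # suf)) \<le> c2 * (cost \<alpha> (jumps 0 (pre @ x # suf)) + M)"
      using ok[OF len True near(1)] c2_pos by (intro mult_left_mono) auto
    then have "exp (- c2 * cost \<alpha> (jumps 0 (pre @ x # suf))) \<le> exp (c2 * M) * exp (- c2 * cost \<alpha> (jumps 0 (pre @ ?y # suf)))"
      by (simp add: exp_add[symmetric] algebra_simps)
    then have "weight \<gamma> \<eta> 0 0 (pre @ x # suf)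
        \<le> c1 ^ n * (exp (c2 * M) * exp (- c2 * cost \<alpha> (jumps 0 (pre @ ?y # suf)))) * (\<Gamma> * env_factor \<gamma> \<eta>' 0 (pre @ ?y # suf))"
      unfolding weight_def using env c1_bounds \<gamma> len n
      by (intro mult_mono mult_left_mono env_factor_nonneg) auto
    also have "\<dots> = exp (c2 * M) * \<Gamma> * weight \<gamma> \<eta>' 0 0 (pre @ ?y # suf)"
      unfolding weight_def using len n by simp
    finally show ?thesis using True \<Gamma>_ge_1 weight_nonneg[OF \<gamma>(1)] by (simp add: ennreal_mult[symmetric] ennreal_leI)
  qed simp
  let ?C = "ennreal (exp (c2 * M) * \<Gamma> * (2 * real r + 1) ^ CARD('d))"
  have "path_sum n (\<lambda>xs. if ok xs then ennreal (weight \<gamma> \<eta> 0 0 xs) else 0)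
      \<le> path_sum t (\<lambda>pre. ?C * (\<integral>\<^sup>+x. path_sum u (\<lambda>suf. ?w' (pre @ x # suf)) \<partial>count_space UNIV))"
    unfolding split
  proof (rule path_sum_mono)
    fix pre :: "(int ^ 'd) list" assume pre: "length pre = t"
    define H where "H y = path_sum u (\<lambda>suf. ?w' (pre @ y # suf))" for y
    let ?I = "\<lambda>x. path_sum u (\<lambda>suf. if ok (pre @ x # suf) then ennreal (weight \<gamma> \<eta> 0 0 (pre @ x # suf)) else 0)"
    have "(\<integral>\<^sup>+x. ?I x \<partial>count_space UNIV)
        \<le> (\<integral>\<^sup>+x. ennreal (exp (c2 * M) * \<Gamma>) * H (near (Suc t) x) \<partial>count_space UNIV)"
      unfolding H_def path_sum_cmult[symmetric]
      by (intro nn_integral_mono path_sum_mono pt pre)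
    also have "\<dots> = ennreal (exp (c2 * M) * \<Gamma>) * (\<integral>\<^sup>+x. H (near (Suc t) x) \<partial>count_space UNIV)"
      by (simp add: nn_integral_cmult)
    also have "(\<integral>\<^sup>+x. H (near (Suc t) x) \<partial>count_space UNIV) \<le> (\<integral>\<^sup>+x. (\<Sum>v\<in>B. H (x + v)) \<partial>count_space UNIV)"
    proof (intro nn_integral_mono)
      fix x
      have "near (Suc t) x - x \<in> B" using near by (simp add: B_def)
      then show "H (near (Suc t) x) \<le> (\<Sum>v\<in>B. H (x + v))"
        using member_le_sum[of "near (Suc t) x - x" B "\<lambda>v. H (x + v)"] B by simp
    qed
    also have "\<dots> = (\<Sum>v\<in>B. \<integral>\<^sup>+x. H x \<partial>count_space UNIV)"
      by (subst nn_integral_sum) (auto simp: nn_integral_count_space_translate(2))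
    also have "\<dots> = of_nat (card B) * (\<integral>\<^sup>+x. H x \<partial>count_space UNIV)" by simp
    also have "\<dots> \<le> ennreal ((2 * real r + 1) ^ CARD('d)) * (\<integral>\<^sup>+x. H x \<partial>count_space UNIV)"
    proof (intro mult_right_mono)
      have "real (card B) \<le> real ((2 * r + 1) ^ CARD('d))" using B(2) by (rule of_nat_mono)
      also have "\<dots> = (2 * real r + 1) ^ CARD('d)" by (simp add: add.commute)
      finally show "of_nat (card B) \<le> ennreal ((2 * real r + 1) ^ CARD('d))"
        by (simp add: ennreal_of_nat_eq_real_of_nat ennreal_leI)
    qed simp
    finally show "(\<integral>\<^sup>+x. ?I x \<partial>count_space UNIV)
        \<le> ?C * (\<integral>\<^sup>+x. path_sum u (\<lambda>suf. ?w' (pre @ x # suf)) \<partial>count_space UNIV)"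
      using \<Gamma>_ge_1 by (simp add: H_def ennreal_mult mult.assoc mult_left_mono)
  qed
  also have "\<dots> = ?C * Zsum \<gamma> \<eta>' n"
    unfolding Zsum_def split by (rule path_sum_cmult)
  finally show ?thesis .
qed

end

lemma abs_real_l1norm_diff:
  assumes "l1norm (y - x) \<le> r"
  shows "real (l1norm (y - a)) \<le> real (l1norm (x - a)) + r"
    and "real (l1norm (a - y)) \<le> real (l1norm (a - x)) + r"
  using l1norm_diff_triangle[of y a x] l1norm_diff_triangle[of a y x] assms
  by (simp_all add: l1norm_minus_commute[of x y] of_nat_add[symmetric] del: of_nat_add)

lemma cost_replace_site:
  fixes pre suf :: "(int ^ 'd) list"
  assumes step: "\<And>k k'. k \<in> J \<Longrightarrow> 0 \<le> k \<Longrightarrow> 0 \<le> k' \<Longrightarrow> k' \<le> k + real r \<Longrightarrow> k' powr \<alpha> \<le> k powr \<alpha> + M"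
    and M: "M \<ge> 0" and y: "l1norm (y - x) \<le> r"
    and J: "jumps 0 (pre @ x # suf) ! length pre \<in> J"
      "suf \<noteq> [] \<Longrightarrow> jumps 0 (pre @ x # suf) ! Suc (length pre) \<in> J"
  shows "cost \<alpha> (jumps 0 (pre @ y # suf)) \<le> cost \<alpha> (jumps 0 (pre @ x # suf)) + 2 * M"
proof -
  have l: "length (jumps 0 pre) = length pre" by simp
  let ?a = "last (0 # pre)"
  have 1: "real (l1norm (y - ?a)) powr \<alpha> \<le> real (l1norm (x - ?a)) powr \<alpha> + M"
    using J(1) by (intro step abs_real_l1norm_diff(1)[OF y]) (auto simp: nth_append)
  show ?thesis
  proof (cases suf)
    case Nil
    then show ?thesis using 1 M by simp
  next
    case (Cons b suf')
    have "real (l1norm (b - y)) powr \<alpha> \<le> real (l1norm (b - x)) powr \<alpha> + M"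
      using J(2) Cons by (intro step abs_real_l1norm_diff(2)[OF y]) (auto simp: nth_append)
    then show ?thesis using 1 Cons by simp
  qed
qed

context polymer
begin

definition slice_ratio :: "real \<Rightarrow> real \<Rightarrow> bool" where
  "slice_ratio C \<epsilon> \<longleftrightarrow> (\<forall>\<gamma> r \<eta> \<eta>' n t. 0 \<le> \<gamma> \<longrightarrow> \<gamma> \<le> \<Gamma> \<longrightarrow> 1 \<le> r \<longrightarrow> dense_env r \<eta> \<longrightarrow> dense_env r \<eta>' \<longrightarrow> t < n \<longrightarrow>
     (\<forall>i x. i \<noteq> Suc t \<longrightarrow> \<eta> (i, x) = \<eta>' (i, x)) \<longrightarrow>
     Zsum \<gamma> \<eta> n \<le> ennreal (exp (C * (real r * n powr \<epsilon>) powr (\<alpha> + 1))) * Zsum \<gamma> \<eta>' n)"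

lemma slice_ratioD:
  assumes "slice_ratio C \<epsilon>" "0 \<le> \<gamma>" "\<gamma> \<le> \<Gamma>" "1 \<le> r" "dense_env r \<eta>" "dense_env r \<eta>'" "t < n"
    "\<And>i x. i \<noteq> Suc t \<Longrightarrow> \<eta> (i, x) = \<eta>' (i, x)"
  shows "Zsum \<gamma> \<eta> n \<le> ennreal (exp (C * (real r * n powr \<epsilon>) powr (\<alpha> + 1))) * Zsum \<gamma> \<eta>' n"
  using assms unfolding slice_ratio_def by blast

lemma slice_ratio_exists:
  assumes \<epsilon>: "\<epsilon> > 0"
  shows "\<exists>C>0. slice_ratio C \<epsilon>"
proof -
  let ?D = "CARD('d)"
  have bound: "exp (c2 * (2 * (c * X powr \<alpha>))) * \<Gamma> * (2 * real r + 1) ^ ?D * 2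
      \<le> exp ((2 * c2 * c + ln \<Gamma> + 2 * ?D + 1) * X powr (\<alpha> + 1))"
    if "c \<ge> 0" "X \<ge> 1" "real r \<le> X" for c X :: real and r :: nat
  proof -
    define Y where "Y = X powr (\<alpha> + 1)"
    have XY: "X powr \<alpha> \<le> Y" "X \<le> Y" "1 \<le> Y"
      using that \<alpha>_pos powr_mono[of 1 "\<alpha> + 1" X] by (auto simp: Y_def intro!: powr_mono ge_one_powr_ge_zero)
    have "(2 * real r + 1) \<le> exp (2 * real r)" using exp_ge_add_one_self[of "2 * real r"] by linarith
    then have "(2 * real r + 1) ^ ?D \<le> exp (2 * real r) ^ ?D" by (intro power_mono) auto
    also have "\<dots> = exp (2 * ?D * real r)" by (simp add: exp_of_nat_mult[symmetric] mult_ac)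
    finally have 1: "(2 * real r + 1) ^ ?D \<le> exp (2 * ?D * real r)" .
    have "(2::real) \<le> exp 1" using exp_ge_add_one_self[of 1] by simp
    then have "exp (c2 * (2 * (c * X powr \<alpha>))) * \<Gamma> * (2 * real r + 1) ^ ?D * 2
      \<le> exp (c2 * (2 * (c * X powr \<alpha>))) * exp (ln \<Gamma>) * exp (2 * ?D * real r) * exp 1"
      using 1 \<Gamma>_ge_1 by (intro mult_mono) auto
    also have "\<dots> = exp (2 * c2 * c * X powr \<alpha> + ln \<Gamma> * 1 + 2 * ?D * real r + 1)"
      by (simp add: exp_add[symmetric] algebra_simps)
    also have "\<dots> \<le> exp (2 * c2 * c * Y + ln \<Gamma> * Y + 2 * ?D * Y + 1 * Y)"
      using XY that c2_pos \<Gamma>_ge_1 by (subst exp_le_cancel_iff) (intro add_mono mult_left_mono, auto)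
    also have "\<dots> = exp ((2 * c2 * c + ln \<Gamma> + 2 * ?D + 1) * Y)" by (simp add: algebra_simps)
    finally show ?thesis by (simp add: Y_def)
  qed
  have Xge: "1 \<le> real r * n powr \<epsilon>" "real r \<le> real r * n powr \<epsilon>" if "1 \<le> r" "t < n" for r n t :: nat
  proof -
    have n1: "1 \<le> real n powr \<epsilon>" using that \<epsilon> by (intro ge_one_powr_ge_zero) auto
    then show "real r \<le> real r * n powr \<epsilon>" by (simp add: mult_le_cancel_left1)
    then show "1 \<le> real r * n powr \<epsilon>" using that by linarith
  qed
  consider "\<alpha> \<le> 1" | "\<alpha> > 1" by linarith
  then show ?thesis
  proof cases
    case 1
    define C where "C = 2 * c2 * 1 + ln \<Gamma> + 2 * ?D + 1"
    have "C > 0" using c2_pos \<Gamma>_ge_1 by (simp add: C_def add_pos_nonneg)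
    moreover have "slice_ratio C \<epsilon>"
      unfolding slice_ratio_def
    proof (intro allI impI)
      fix \<gamma> :: real and r n t :: nat and \<eta> \<eta>' :: "('d::finite) env"
      assume \<gamma>: "0 \<le> \<gamma>" "\<gamma> \<le> \<Gamma>" and r: "1 \<le> r" and dense: "dense_env r \<eta>" "dense_env r \<eta>'" and t: "t < n"
        and "\<forall>i x. i \<noteq> Suc t \<longrightarrow> \<eta> (i, x) = \<eta>' (i, x)"
      then have agree: "\<And>i x. i \<noteq> Suc t \<Longrightarrow> \<eta> (i, x) = \<eta>' (i, x)" by blast
      define X where "X = real r * n powr \<epsilon>"
      have X: "1 \<le> X" "real r \<le> X" unfolding X_def using Xge[OF r t] by auto
      let ?q = "exp (c2 * (2 * (1 * X powr \<alpha>))) * \<Gamma> * (2 * real r + 1) ^ ?D"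
      have "Zsum \<gamma> \<eta> n = path_sum n (\<lambda>xs. if True then ennreal (weight \<gamma> \<eta> 0 0 xs) else 0)"
        by (simp add: Zsum_def)
      also have "\<dots> \<le> ennreal (?q) * Zsum \<gamma> \<eta>' n"
      proof (rule replace_site_sum[OF \<gamma> dense(2) agree, where u = "n - Suc t"])
        fix pre suf :: "(int ^ 'd) list" and x y :: "int ^ 'd"
        assume y: "l1norm (y - x) \<le> r"
        show "cost \<alpha> (jumps 0 (pre @ y # suf)) \<le> cost \<alpha> (jumps 0 (pre @ x # suf)) + 2 * (1 * X powr \<alpha>)"
        proof (rule cost_replace_site[where J = UNIV, OF _ _ y])
          fix k k' :: real assume k: "0 \<le> k" "0 \<le> k'" "k' \<le> k + real r"
          have "k' powr \<alpha> \<le> (k + real r) powr \<alpha>" using k \<alpha>_pos by (intro powr_mono2) auto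
          also have "\<dots> \<le> k powr \<alpha> + real r powr \<alpha>" using k 1 \<alpha>_pos by (intro powr_subadditive) auto
          also have "real r powr \<alpha> \<le> 1 * X powr \<alpha>" using X \<alpha>_pos by (simp add: powr_mono2)
          finally show "k' powr \<alpha> \<le> k powr \<alpha> + 1 * X powr \<alpha>" by simp
        qed auto
      qed (use t in auto)
      also have "\<dots> \<le> ennreal (exp (C * X powr (\<alpha> + 1))) * Zsum \<gamma> \<eta>' n"
      proof (intro mult_right_mono ennreal_leI)
        have "?q
           \<le> ?q * 2"
          using \<Gamma>_ge_1 by simp
        also have "\<dots> \<le> exp (C * X powr (\<alpha> + 1))"
          unfolding C_def using X by (intro bound) auto
        finally show "?q \<le> exp (C * X powr (\<alpha> + 1))" .
      qed simp
      finally show "Zsum \<gamma> \<eta> n \<le> ennreal (exp (C * (real r * n powr \<epsilon>) powr (\<alpha> + 1))) * Zsum \<gamma> \<eta>' n"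
        by (simp add: X_def)
    qed
    ultimately show ?thesis by blast
  next
    case 2
    obtain C0 :: real where C0: "C0 > 0" and large: "\<And>\<gamma> r \<eta> n j. 0 \<le> \<gamma> \<Longrightarrow> \<gamma> \<le> \<Gamma> \<Longrightarrow> 1 \<le> r \<Longrightarrow> dense_env r \<eta> \<Longrightarrow> j < n \<Longrightarrow>
       path_sum n (\<lambda>xs. if jumps 0 xs ! j > C0 * r * n powr \<epsilon> then ennreal (weight \<gamma> \<eta> 0 0 xs) else 0)
       \<le> ennreal (1 / 4) * Zsum \<gamma> \<eta> n"
      using large_jump_sum[OF 2 \<epsilon>] by blast
    define c where "c = (C0 + 1) powr \<alpha>"
    define C where "C = 2 * c2 * c + ln \<Gamma> + 2 * ?D + 1"
    have "C > 0" using c2_pos \<Gamma>_ge_1 by (simp add: C_def c_def add_nonneg_pos)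
    moreover have "slice_ratio C \<epsilon>"
      unfolding slice_ratio_def
    proof (intro allI impI)
      fix \<gamma> :: real and r n t :: nat and \<eta> \<eta>' :: "('d::finite) env"
      assume \<gamma>: "0 \<le> \<gamma>" "\<gamma> \<le> \<Gamma>" and r: "1 \<le> r" and dense: "dense_env r \<eta>" "dense_env r \<eta>'" and t: "t < n"
        and "\<forall>i x. i \<noteq> Suc t \<longrightarrow> \<eta> (i, x) = \<eta>' (i, x)"
      then have agree: "\<And>i x. i \<noteq> Suc t \<Longrightarrow> \<eta> (i, x) = \<eta>' (i, x)" by blast
      define X where "X = real r * n powr \<epsilon>"
      have X: "1 \<le> X" "real r \<le> X" unfolding X_def using Xge[OF r t] by auto
      define K where "K = C0 * X"
      let ?w = "\<lambda>xs. ennreal (weight \<gamma> \<eta> 0 0 xs)"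
      define ok where "ok xs \<longleftrightarrow> jumps 0 xs ! t \<le> K \<and> (Suc t < n \<longrightarrow> jumps 0 xs ! Suc t \<le> K)" for xs :: "(int ^ 'd) list"
      define Z where "Z = Zsum \<gamma> \<eta> n"
      have Zfin: "Z < top" using Zsum_le[OF \<gamma>, of \<eta> n] by (auto simp: Z_def less_top[symmetric] top_unique)
      let ?f1 = "\<lambda>xs. if jumps 0 xs ! t > K then ?w xs else 0"
      let ?f2 = "\<lambda>xs. if Suc t < n \<and> jumps 0 xs ! Suc t > K then ?w xs else 0"
      define q where "q = exp (c2 * (2 * (c * X powr \<alpha>))) * \<Gamma> * (2 * real r + 1) ^ ?D"
      have q0: "q \<ge> 0" using \<Gamma>_ge_1 by (simp add: q_def)
      have l1: "path_sum n ?f1 \<le> ennreal (1 / 4) * Z"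
        using large[OF \<gamma> r dense(1) t] by (simp add: K_def X_def Z_def mult.assoc)
      have l2: "path_sum n ?f2 \<le> ennreal (1 / 4) * Z"
      proof (cases "Suc t < n")
        case True
        then show ?thesis using large[OF \<gamma> r dense(1) True] by (simp add: K_def X_def Z_def mult.assoc)
      qed simp
      let ?O = "path_sum n (\<lambda>xs. if ok xs then ?w xs else 0)"
      have "Z \<le> path_sum n (\<lambda>xs. ?f1 xs
           + ?f2 xs + (if ok xs then ?w xs else 0))"
        unfolding Z_def Zsum_def by (intro path_sum_mono) (auto simp: ok_def not_le)
      also have "\<dots> = path_sum n ?f1
           + path_sum n ?f2 + ?O"
        by (simp add: path_sum_add)
      also have "\<dots> \<le> ennreal (1 / 4) * Z + ennreal (1 / 4) * Z + ?O"
        by (intro add_mono l1 l2 order_refl)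
      also have "?O
         \<le> ennreal q * Zsum \<gamma> \<eta>' n"
      proof (unfold q_def, rule replace_site_sum[OF \<gamma> dense(2) agree, where u = "n - Suc t"])
        fix pre suf :: "(int ^ 'd) list" and x y :: "int ^ 'd"
        assume len: "length pre = t" "length suf = n - Suc t" and ok: "ok (pre @ x # suf)" and y: "l1norm (y - x) \<le> r"
        show "cost \<alpha> (jumps 0 (pre @ y # suf)) \<le> cost \<alpha> (jumps 0 (pre @ x # suf)) + 2 * (c * X powr \<alpha>)"
        proof (rule cost_replace_site[where J = "{..K}", OF _ _ y])
          fix k k' :: real assume k: "k \<in> {..K}" "0 \<le> k" "0 \<le> k'" "k' \<le> k + real r"
          have "k' powr \<alpha> \<le> ((C0 + 1) * X) powr \<alpha>"
            using k \<alpha>_pos X by (intro powr_mono2) (auto simp: K_def algebra_simps)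
          also have "\<dots> = c * X powr \<alpha>" using C0 X by (simp add: powr_mult c_def)
          finally show "k' powr \<alpha> \<le> k powr \<alpha> + c * X powr \<alpha>" using powr_ge_zero[of k \<alpha>] by linarith
        next
          show "jumps 0 (pre @ x # suf) ! length pre \<in> {..K}" using ok len by (simp add: ok_def del: jumps_append)
        next
          assume "suf \<noteq> []"
          then have "Suc t < n" using len by (cases suf) auto
          then show "jumps 0 (pre @ x # suf) ! Suc (length pre) \<in> {..K}" using ok len by (simp add: ok_def del: jumps_append)
        qed (simp add: c_def)
      qed (use t in auto)
      finally have le: "Z \<le> ennreal (1 / 4) * Z + ennreal (1 / 4) * Z
          + ennreal q * Zsum \<gamma> \<eta>' n" by simp
      define Z' where "Z' = Zsum \<gamma> \<eta>' n"
      have Z'fin: "Z' < top" using Zsum_le[OF \<gamma>, of \<eta>' n] by (auto simp: Z'_def less_top[symmetric] top_unique)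
      define z z' where "z = enn2real Z" and "z' = enn2real Z'"
      have zz: "Z = ennreal z" "Z' = ennreal z'" "z \<ge> 0" "z' \<ge> 0"
        using Zfin Z'fin by (simp_all add: z_def z'_def)
      have "ennreal z \<le> ennreal (1 / 4) * ennreal z + ennreal (1 / 4) * ennreal z + ennreal q * ennreal z'"
        using le unfolding Z'_def[symmetric] zz(1,2) .
      also have "\<dots> = ennreal (1 / 4 * z + 1 / 4 * z + q * z')"
        using zz(3,4) q0 by (simp only: ennreal_mult[symmetric] ennreal_plus[symmetric] mult_nonneg_nonneg
            add_nonneg_nonneg divide_nonneg_nonneg zero_le_one zero_le_numeral)
      finally have "ennreal z \<le> ennreal (1 / 4 * z + 1 / 4 * z + q * z')" .
      then have "z \<le> 1 / 4 * z + 1 / 4 * z + q * z'" using zz q0 by (subst (asm) ennreal_le_iff) auto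
      then have "z \<le> q * 2 * z'" by simp
      also have "\<dots> \<le> exp (C * X powr (\<alpha> + 1)) * z'"
        unfolding q_def C_def using X zz by (intro mult_right_mono bound) (auto simp: c_def)
      finally have "ennreal z \<le> ennreal (exp (C * X powr (\<alpha> + 1)) * z')" by (rule ennreal_leI)
      then show "Zsum \<gamma> \<eta> n \<le> ennreal (exp (C * (real r * n powr \<epsilon>) powr (\<alpha> + 1))) * Zsum \<gamma> \<eta>' n"
        using zz by (simp add: X_def[symmetric] Z_def[symmetric] Z'_def[symmetric] ennreal_mult)
    qed
    ultimately show ?thesis by blast
  qed
qed

end

section \<open>Truncation of the environment\<close>

lemma space_envQ [simp]: "space (envQ p) = UNIV"
  by (simp add: envQ_def space_PiM)

lemma prob_space_envQ: "prob_space (envQ p)"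
  unfolding envQ_def by (intro prob_space_PiM measure_pmf.prob_space_axioms)

lemma env_component_measurable [measurable]: "(\<lambda>\<eta>. \<eta> i) \<in> envQ p \<rightarrow>\<^sub>M count_space UNIV"
  unfolding envQ_def
  by (rule measurable_component_singleton[where M = "\<lambda>_. measure_pmf (bernoulli_pmf p)", simplified]) simp

lemma sets_envQ_Collect [intro]: "Measurable.pred (envQ p) P \<Longrightarrow> {\<eta>. P \<eta>} \<in> sets (envQ p)"
  by (drule predE) simp

lemma measure_all_closed:
  assumes p: "0 \<le> p" "p \<le> 1" and J: "finite J"
  shows "measure (envQ p) {\<eta>. \<forall>i\<in>J. \<eta> i} = p ^ card J"
proof -
  interpret product_prob_space "\<lambda>_. measure_pmf (bernoulli_pmf p)" "UNIV :: (nat \<times> (int ^ 'd)) set"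
    by unfold_locales
  have "emeasure (envQ p) {\<eta>. \<forall>i\<in>J. \<eta> i} = (\<Prod>i\<in>J. emeasure (measure_pmf (bernoulli_pmf p)) {True})"
    using emeasure_PiM_Collect[of J "\<lambda>_. {True}"] J
    by (simp add: envQ_def[symmetric])
  also have "\<dots> = ennreal (p ^ card J)"
    using p by (simp add: emeasure_pmf_single ennreal_power)
  finally show ?thesis using p by (simp add: measure_def)
qed

definition slice_good :: "nat \<Rightarrow> nat \<Rightarrow> nat \<Rightarrow> ('d::finite) env \<Rightarrow> bool" where
  "slice_good B r j \<eta> \<longleftrightarrow> (\<forall>y. l1norm y \<le> B \<longrightarrow> (\<exists>z. l1norm (z - y) \<le> r \<and> \<not> \<eta> (j, z)))"

lemma slice_good_measurable [measurable]: "Measurable.pred (envQ p) (slice_good B r j)"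
  unfolding slice_good_def by measurable

lemma measure_slice_not_good:
  assumes p: "0 \<le> p" "p \<le> 1"
  shows "measure (envQ p) {\<eta> :: ('d::finite) env. \<not> slice_good B r j \<eta>} \<le> (2 * real B + 1) ^ CARD('d) * p ^ Suc r"
proof -
  interpret prob_space "envQ p :: ('d::finite) env measure" by (rule prob_space_envQ)
  define J where "J y = (\<lambda>k. (j, y + axis_site k)) ` {..r}" for y :: "int ^ 'd"
  have J: "finite (J y)" "card (J y) = Suc r" for y
  proof -
    show "finite (J y)" by (simp add: J_def)
    have "inj_on (\<lambda>k. (j, y + axis_site k)) {..r}"
      using inj_axis_site by (auto simp: inj_on_def)
    then show "card (J y) = Suc r" by (simp add: J_def card_image)
  qed
  let ?ball = "{y :: int ^ 'd. l1norm y \<le> B}"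
  have "{\<eta>. \<not> slice_good B r j \<eta>} \<subseteq> (\<Union>y\<in>?ball. {\<eta>. \<forall>i\<in>J y. \<eta> i})"
    by (auto simp: slice_good_def J_def)
  then have "prob {\<eta>. \<not> slice_good B r j \<eta>} \<le> prob (\<Union>y\<in>?ball. {\<eta>. \<forall>i\<in>J y. \<eta> i})"
  proof (rule finite_measure_mono)
    have "{\<eta>. \<forall>i\<in>J y. \<eta> i} \<in> sets (envQ p)" for y
      using J(1)[of y] by (intro sets_envQ_Collect) measurable
    then show "(\<Union>y\<in>?ball. {\<eta>. \<forall>i\<in>J y. \<eta> i}) \<in> sets (envQ p)"
      using l1ball_finite_card(1)[of B] by blast
  qed
  also have "\<dots> \<le> (\<Sum>y\<in>?ball. prob {\<eta>. \<forall>i\<in>J y. \<eta> i})"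
  proof (rule measure_UNION_le[OF l1ball_finite_card(1)])
    show "{\<eta>. \<forall>i\<in>J y. \<eta> i} \<in> sets (envQ p)" for y
      using J(1)[of y] by (intro sets_envQ_Collect) measurable
  qed
  also have "\<dots> = card ?ball * p ^ Suc r"
    by (simp add: measure_all_closed[OF p J(1)] J(2))
  also have "\<dots> \<le> (2 * real B + 1) ^ CARD('d) * p ^ Suc r"
  proof (intro mult_right_mono)
    have "real (card ?ball) \<le> real ((2 * B + 1) ^ CARD('d))" using l1ball_finite_card(2)[of B] by (rule of_nat_mono)
    then show "real (card ?ball) \<le> (2 * real B + 1) ^ CARD('d)" by (simp add: add.commute)
  qed (use p in simp)
  finally show ?thesis .
qed

text \<open>Unspecified if no site of the axis is open in slice \<open>j\<close>, which is a null event.\<close>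

definition first_open :: "nat \<Rightarrow> ('d::finite) env \<Rightarrow> nat" where
  "first_open j \<eta> = (LEAST k. \<not> \<eta> (j, axis_site k))"

lemma first_open_measurable [measurable]: "first_open j \<in> envQ p \<rightarrow>\<^sub>M count_space UNIV"
  unfolding first_open_def by measurable

lemma AE_first_open:
  assumes p: "0 \<le> p" "p < 1"
  shows "AE \<eta> in envQ p. \<not> \<eta> (j, axis_site (first_open j \<eta>) :: int ^ 'd)"
proof -
  interpret prob_space "envQ p :: ('d::finite) env measure" by (rule prob_space_envQ)
  let ?N = "{\<eta> :: ('d::finite) env. \<forall>k. \<eta> (j, axis_site k)}"
  have N: "?N \<in> sets (envQ p)" by (intro sets_envQ_Collect) measurable
  have "prob ?N \<le> p ^ k" for k
  proof -
    have inj: "inj_on (\<lambda>i. (j, axis_site i :: int ^ 'd)) {..<k}"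
      using inj_axis_site[where 'a = 'd] by (auto simp: inj_on_def)
    have "prob ?N \<le> prob {\<eta>. \<forall>i\<in>(\<lambda>i. (j, axis_site i)) ` {..<k}. \<eta> i}"
      by (intro finite_measure_mono sets_envQ_Collect) (auto, measurable)
    also have "\<dots> = p ^ k" using p inj by (subst measure_all_closed) (auto simp: card_image)
    finally show ?thesis .
  qed
  moreover have "(\<lambda>k. p ^ k) \<longlonglongrightarrow> 0" using p by (intro LIMSEQ_realpow_zero) auto
  ultimately have "prob ?N \<le> 0" by (intro LIMSEQ_le_const) auto
  then have "prob ?N = 0" by (simp add: measure_le_0_iff)
  then have "AE \<eta> in envQ p. \<eta> \<notin> ?N"
    using N by (intro AE_not_in) (auto simp: null_sets_def emeasure_eq_measure)
  then show ?thesis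
  proof eventually_elim
    case (elim \<eta>)
    then obtain k where "\<not> \<eta> (j, axis_site k)" by auto
    then show ?case unfolding first_open_def by (rule LeastI)
  qed
qed

lemma summable_powr_geometric:
  fixes s q :: real
  assumes "0 \<le> q" "q < 1"
  shows "summable (\<lambda>k. real k powr s * q ^ k)"
proof (cases "q = 0")
  case True
  then have "(\<lambda>k. real k powr s * q ^ k) = (\<lambda>k. 0)" by (auto simp: fun_eq_iff power_0_left)
  then show ?thesis by simp
next
  case False
  then have q: "0 < q" "q < 1" using assms by auto
  have "((\<lambda>k. real k powr s * q powr real k * real k ^ 2) \<longlongrightarrow> 0) sequentially"
    using q by real_asymp
  then have "((\<lambda>k. real k powr s * q ^ k * real k ^ 2) \<longlongrightarrow> 0) sequentially"
    using q by (simp add: powr_realpow)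
  then have "eventually (\<lambda>k. real k powr s * q ^ k * real k ^ 2 < 1) sequentially"
    by (rule order_tendstoD) simp
  then have "eventually (\<lambda>k. norm (real k powr s * q ^ k) \<le> 1 / real k ^ 2) sequentially"
    using eventually_gt_at_top[of 0]
    by eventually_elim (use q in \<open>simp add: field_simps\<close>)
  then show ?thesis
    by (rule summable_comparison_test_ev) (use inverse_power_summable[of 2] in \<open>simp add: inverse_eq_divide\<close>)
qed

lemma first_open_moment:
  assumes p: "0 \<le> p" "p \<le> q" "q < 1"
  shows "(\<integral>\<^sup>+\<eta>. ennreal (real (first_open j (\<eta> :: ('d::finite) env)) powr s) \<partial>envQ p)
      \<le> ennreal (\<Sum>k. real k powr s * q ^ k)"
proof -
  interpret prob_space "envQ p :: ('d::finite) env measure" by (rule prob_space_envQ)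
  define A where "A k = {\<eta> :: ('d::finite) env. \<forall>i\<in>(\<lambda>i. (j, axis_site i)) ` {..<k}. \<eta> i}" for k
  have A: "A k \<in> sets (envQ p)" for k unfolding A_def by (intro sets_envQ_Collect) measurable
  have PA: "emeasure (envQ p) (A k) \<le> ennreal (q ^ k)" for k
  proof -
    have inj: "inj_on (\<lambda>i. (j, axis_site i :: int ^ 'd)) {..<k}"
      using inj_axis_site[where 'a = 'd] by (auto simp: inj_on_def)
    have "prob (A k) = p ^ k" unfolding A_def using p inj by (subst measure_all_closed) (auto simp: card_image)
    also have "\<dots> \<le> q ^ k" using p by (intro power_mono) auto
    finally show ?thesis by (simp add: emeasure_eq_measure ennreal_leI)
  qed
  have mem: "\<eta> \<in> A (first_open j \<eta>)" for \<eta>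
    by (auto simp: A_def first_open_def dest: not_less_Least)
  have "(\<integral>\<^sup>+\<eta>. ennreal (real (first_open j (\<eta> :: ('d::finite) env)) powr s) \<partial>envQ p)
     \<le> (\<integral>\<^sup>+\<eta>. (\<integral>\<^sup>+k. ennreal (real k powr s) * indicator (A k) \<eta> \<partial>count_space UNIV) \<partial>envQ p)"
  proof (rule nn_integral_mono)
    fix \<eta> :: "('d::finite) env"
    show "ennreal (real (first_open j \<eta>) powr s) \<le> (\<integral>\<^sup>+k. ennreal (real k powr s) * indicator (A k) \<eta> \<partial>count_space UNIV)"
      using nn_integral_ge_point[of "first_open j \<eta>" UNIV "\<lambda>k. ennreal (real k powr s) * indicator (A k) \<eta>"] mem[of \<eta>]
      by simp
  qed
  also have "\<dots> = (\<integral>\<^sup>+k. (\<integral>\<^sup>+\<eta>. ennreal (real k powr s) * indicator (A k) \<eta> \<partial>envQ p) \<partial>count_space UNIV)"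
    using A by (intro nn_integral_count_space_nn_integral) auto
  also have "\<dots> \<le> (\<integral>\<^sup>+k. ennreal (real k powr s * q ^ k) \<partial>count_space UNIV)"
    using A PA by (intro nn_integral_mono) (use p in \<open>simp add: nn_integral_cmult_indicator ennreal_mult mult_left_mono\<close>)
  also have "\<dots> = ennreal (\<Sum>k. real k powr s * q ^ k)"
    unfolding nn_integral_count_space_nat
    using p by (intro suminf_ennreal2 summable_powr_geometric) auto
  finally show ?thesis .
qed

text \<open>Opening all sites outside a box and all sites of bad slices makes every environment dense,
  while different slices of the result remain independent.\<close>

definition trunc_env :: "nat \<Rightarrow> nat \<Rightarrow> ('d::finite) env \<Rightarrow> ('d::finite) env" where
  "trunc_env B r \<eta> = (\<lambda>(j, x). \<eta> (j, x) \<and> l1norm x \<le> B \<and> slice_good B r j \<eta>)"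

lemma trunc_env_measurable [measurable]: "trunc_env B r \<in> envQ p \<rightarrow>\<^sub>M envQ p"
proof -
  have "(\<lambda>\<eta>. trunc_env B r \<eta> i) \<in> envQ p \<rightarrow>\<^sub>M measure_pmf (bernoulli_pmf p)" for i
  proof -
    have "Measurable.pred (envQ p) (\<lambda>\<eta>. trunc_env B r \<eta> i)"
      unfolding trunc_env_def case_prod_beta by measurable
    then show ?thesis by simp
  qed
  then have "trunc_env B r \<in> envQ p \<rightarrow>\<^sub>M PiM UNIV (\<lambda>_. measure_pmf (bernoulli_pmf p))"
    by (intro measurable_PiM_single') auto
  then show ?thesis by (simp only: envQ_def)
qed

lemma dense_trunc_env: "dense_env r (trunc_env B r \<eta>)"
  unfolding dense_env_def
proof (intro allI)
  fix j and y :: "int ^ 'a"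
  show "\<exists>z. l1norm (z - y) \<le> r \<and> \<not> trunc_env B r \<eta> (j, z)"
  proof (cases "l1norm y \<le> B \<and> slice_good B r j \<eta>")
    case True
    then show ?thesis unfolding slice_good_def trunc_env_def by auto
  next
    case False
    then show ?thesis by (intro exI[of _ y]) (auto simp: trunc_env_def)
  qed
qed

lemma trunc_env_local:
  assumes "\<And>x. \<eta> (j, x) = \<eta>' (j, x)"
  shows "trunc_env B r \<eta> (j, x) = trunc_env B r \<eta>' (j, x)"
  using assms by (simp add: trunc_env_def slice_good_def)

lemma l1norm_le_sum_jumps_set: "x \<in> set xs \<Longrightarrow> real (l1norm (x - a)) \<le> sum_list (jumps a xs)"
proof -
  assume "x \<in> set xs"
  then obtain ys zs where xs: "xs = (ys @ [x]) @ zs" by (metis append.assoc append_Cons append_Nil split_list)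
  have "real (l1norm (last (a # ys @ [x]) - a)) \<le> sum_list (jumps a (ys @ [x]))"
    by (rule l1norm_le_sum_jumps)
  also have "\<dots> \<le> sum_list (jumps a (ys @ [x])) + sum_list (jumps x zs)"
    using jumps_nonneg[of _ x zs] by (simp add: sum_list_nonneg del: jumps_append)
  also have "\<dots> = sum_list (jumps a xs)" unfolding xs by simp
  finally show ?thesis by simp
qed

lemma cost_ge_of_sum_ge:
  fixes b \<alpha> :: real
  assumes \<alpha>: "\<alpha> > 0" and b: "b \<ge> 0" and js: "js \<noteq> []" and sum: "sum_list js \<ge> b"
  shows "cost \<alpha> js \<ge> (b / length js) powr \<alpha>"
proof -
  have "\<exists>k\<in>set js. k \<ge> b / length js"
  proof (rule ccontr)
    assume "\<not> ?thesis"
    then have "\<And>k. k \<in> set js \<Longrightarrow> k < b / length js" by auto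
    then have "sum_list (map (\<lambda>k. k) js) < sum_list (map (\<lambda>_. b / length js) js)"
      using js by (intro sum_list_strict_mono) auto
    also have "\<dots> = b" using js by (simp add: sum_list_triv)
    finally show False using sum by simp
  qed
  then obtain k where k: "k \<in> set js" "k \<ge> b / length js" by blast
  have "(b / length js) powr \<alpha> \<le> k powr \<alpha>" using k b \<alpha> by (intro powr_mono2) auto
  also have "\<dots> \<le> cost \<alpha> js" unfolding cost_def using k
    by (intro member_le_sum_list) auto
  finally show ?thesis .
qed

context polymer
begin

lemma Zsum_cong:
  assumes "\<And>j x. 1 \<le> j \<Longrightarrow> j \<le> n \<Longrightarrow> \<eta> (j, x) = \<eta>' (j, x)"
  shows "Zsum \<gamma> \<eta> n = Zsum \<gamma> \<eta>' n"
  unfolding Zsum_def weight_def using assms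
  by (intro path_sum_cong arg_cong[where f = ennreal] arg_cong2[where f = "(*)"] refl env_factor_cong) auto

lemma Zsum_trunc:
  assumes \<gamma>: "0 \<le> \<gamma>" "\<gamma> \<le> \<Gamma>" and n: "n > 0"
    and agree: "\<And>j x. 1 \<le> j \<Longrightarrow> j \<le> n \<Longrightarrow> l1norm x \<le> B \<Longrightarrow> \<eta> (j, x) = \<eta>' (j, x)"
  shows "Zsum \<gamma> \<eta> n \<le> Zsum \<gamma> \<eta>' n + ennreal ((c1 * \<Gamma> * expsum (c2 / 2)) ^ n * exp (- (c2 / 2) * (real B / n) powr \<alpha>))"
proof -
  define q where "q = c1 ^ n * \<Gamma> ^ n * exp (- (c2 / 2) * (real B / n) powr \<alpha>)"
  have q0: "q \<ge> 0" using c1_bounds \<Gamma>_ge_1 by (simp add: q_def)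
  have "Zsum \<gamma> \<eta> n \<le> path_sum n (\<lambda>xs. ennreal (weight \<gamma> \<eta>' 0 0 xs) + ennreal q * ennreal (exp (- (c2 / 2) * cost \<alpha> (jumps (0 :: int ^ 'd) xs))))"
    unfolding Zsum_def
  proof (rule path_sum_mono)
    fix xs :: "(int ^ 'd) list" assume len: "length xs = n"
    show "ennreal (weight \<gamma> \<eta> 0 0 xs) \<le> ennreal (weight \<gamma> \<eta>' 0 0 xs) + ennreal q * ennreal (exp (- (c2 / 2) * cost \<alpha> (jumps 0 xs)))"
    proof (cases "\<forall>x\<in>set xs. l1norm x \<le> B")
      case True
      then have "env_factor \<gamma> \<eta> 0 xs = env_factor \<gamma> \<eta>' 0 xs"
        using agree len by (intro env_factor_cong) auto
      then show ?thesis by (simp add: weight_def)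
    next
      case False
      then obtain x where x: "x \<in> set xs" "l1norm x > B" by (auto simp: not_le)
      then have "real B \<le> sum_list (jumps 0 xs)" using l1norm_le_sum_jumps_set[OF x(1), of 0] by simp
      then have "(real B / length (jumps 0 xs)) powr \<alpha> \<le> cost \<alpha> (jumps 0 xs)"
        using n len by (intro cost_ge_of_sum_ge \<alpha>_pos) (auto simp flip: length_0_conv)
      then have "(c2 / 2) * (real B / n) powr \<alpha> \<le> (c2 / 2) * cost \<alpha> (jumps 0 xs)"
        using c2_pos len by (intro mult_left_mono) auto
      then have "exp (- c2 * cost \<alpha> (jumps 0 xs)) \<le> exp (- (c2 / 2) * (real B / n) powr \<alpha>) * exp (- (c2 / 2) * cost \<alpha> (jumps 0 xs))"
        by (simp add: exp_add[symmetric] algebra_simps)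
      then have "weight \<gamma> \<eta> 0 0 xs \<le> c1 ^ n * (exp (- (c2 / 2) * (real B / n) powr \<alpha>) * exp (- (c2 / 2) * cost \<alpha> (jumps 0 xs))) * \<Gamma> ^ n"
        unfolding weight_def using env_factor_le[OF \<gamma> \<Gamma>_ge_1, of \<eta> 0 xs] len c1_bounds \<gamma>
        by (intro mult_mono mult_left_mono env_factor_nonneg) auto
      also have "\<dots> = q * exp (- (c2 / 2) * cost \<alpha> (jumps 0 xs))" by (simp add: q_def mult_ac)
      finally have "ennreal (weight \<gamma> \<eta> 0 0 xs) \<le> ennreal (q * exp (- (c2 / 2) * cost \<alpha> (jumps 0 xs)))"
        by (rule ennreal_leI)
      also have "\<dots> = ennreal q * ennreal (exp (- (c2 / 2) * cost \<alpha> (jumps 0 xs)))"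
        using q0 by (rule ennreal_mult) simp
      finally show ?thesis by (rule add_increasing[rotated]) simp
    qed
  qed
  also have "\<dots> = Zsum \<gamma> \<eta>' n + ennreal q * ennreal (expsum (c2 / 2) ^ n)"
    using c2_pos path_sum_exp_cost[of "c2 / 2" n 0] by (simp only: path_sum_add path_sum_cmult Zsum_def half_gt_zero)
  also have "ennreal q * ennreal (expsum (c2 / 2) ^ n) = ennreal (q * expsum (c2 / 2) ^ n)"
    using q0 expsum_ge_1[of "c2 / 2"] c2_pos by (simp add: ennreal_mult)
  also have "q * expsum (c2 / 2) ^ n = (c1 * \<Gamma> * expsum (c2 / 2)) ^ n * exp (- (c2 / 2) * (real B / n) powr \<alpha>)"
    by (simp add: q_def power_mult_distrib)
  finally show ?thesis .
qed

lemma Zsum_ge_first_open: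
  fixes \<eta> :: "('d::finite) env"
  assumes \<gamma>: "0 \<le> \<gamma>"
    and open_site: "\<And>j. 1 \<le> j \<Longrightarrow> j \<le> n \<Longrightarrow> \<not> \<eta> (j, axis_site (first_open j \<eta>))"
  shows "ennreal (c1 ^ n * exp (- c2 * (2 * (\<Sum>j=1..n. real (first_open j \<eta>) powr \<alpha>)))) \<le> Zsum \<gamma> \<eta> n"
proof -
  let ?S = "(\<Sum>j=1..n. real (first_open j \<eta>) powr \<alpha>)"
  define \<rho> where "\<rho> k = (if k = 0 then 0 else first_open k \<eta>)" for k
  define y where "y k = (axis_site (\<rho> k) :: int ^ 'd)" for k
  let ?line = "map y [Suc 0..<Suc (0 + n)]"
  have y0: "y 0 = 0" by (simp add: y_def \<rho>_def)
  have "jumps (y 0) ?line = map (\<lambda>k. real (l1norm (y (Suc k) - y k))) [0..<0 + n]"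
    by (rule jumps_map_upt)
  then have "cost \<alpha> (jumps 0 ?line) = (\<Sum>k<n. real (l1norm (y (Suc k) - y k)) powr \<alpha>)"
    unfolding y0 cost_def by (simp add: interv_sum_list_conv_sum_set_nat atLeast0LessThan o_def del: upt_Suc)
  also have "\<dots> \<le> (\<Sum>k<n. real (\<rho> (Suc k)) powr \<alpha> + real (\<rho> k) powr \<alpha>)"
  proof (rule sum_mono)
    fix k
    have "l1norm (y (Suc k) - y k) \<le> max (\<rho> (Suc k)) (\<rho> k)"
      by (simp add: y_def l1norm_axis_site_diff)
    then have "real (l1norm (y (Suc k) - y k)) powr \<alpha> \<le> real (max (\<rho> (Suc k)) (\<rho> k)) powr \<alpha>"
      using \<alpha>_pos by (intro powr_mono2) auto
    also have "\<dots> \<le> real (\<rho> (Suc k)) powr \<alpha> + real (\<rho> k) powr \<alpha>" by (simp add: max_def)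
    finally show "real (l1norm (y (Suc k) - y k)) powr \<alpha> \<le> real (\<rho> (Suc k)) powr \<alpha> + real (\<rho> k) powr \<alpha>" .
  qed
  also have "\<dots> = (\<Sum>k<n. real (\<rho> (Suc k)) powr \<alpha>) + (\<Sum>k<n. real (\<rho> k) powr \<alpha>)"
    by (simp add: sum.distrib)
  also have "(\<Sum>k<n. real (\<rho> k) powr \<alpha>) \<le> (\<Sum>k<Suc n. real (\<rho> k) powr \<alpha>)" by simp
  also have "(\<Sum>k<Suc n. real (\<rho> k) powr \<alpha>) = (\<Sum>k<n. real (\<rho> (Suc k)) powr \<alpha>)"
    by (subst sum.lessThan_Suc_shift) (simp add: \<rho>_def)
  also have "(\<Sum>k<n. real (\<rho> (Suc k)) powr \<alpha>) = ?S"
    by (rule sum.reindex_bij_witness[of _ "\<lambda>j. j - 1" Suc]) (auto simp: \<rho>_def)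
  finally have "c2 * cost \<alpha> (jumps 0 ?line) \<le> c2 * (2 * ?S)"
    using c2_pos by (intro mult_left_mono) auto
  moreover have "env_factor \<gamma> \<eta> 0 ?line = 1"
    by (rule env_factor_open) (use open_site in \<open>auto simp: y_def \<rho>_def simp del: upt_Suc\<close>)
  moreover have len: "length ?line = n" by simp
  ultimately have "c1 ^ n * exp (- c2 * (2 * ?S)) \<le> weight \<gamma> \<eta> 0 0 ?line"
    unfolding weight_def using c1_bounds by (auto intro!: mult_left_mono simp del: upt_Suc)
  then have "ennreal (c1 ^ n * exp (- c2 * (2 * ?S))) \<le> ennreal (weight \<gamma> \<eta> 0 0 ?line)"
    by (rule ennreal_leI)
  also have "\<dots> \<le> Zsum \<gamma> \<eta> n"
    unfolding Zsum_def by (rule path_sum_ge_point[where F = "\<lambda>xs. ennreal (weight \<gamma> \<eta> 0 0 xs)", OF len])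
  finally show ?thesis .
qed

end

section \<open>Concentration\<close>

lemma enn2real_bounds:
  assumes "ennreal a \<le> z" "z \<le> ennreal b" "b \<ge> 0"
  shows "a \<le> enn2real z" "enn2real z \<le> b"
proof -
  have "z < top" using assms(2) by (rule le_less_trans) simp
  then have "z = ennreal (enn2real z)" by simp
  then show "a \<le> enn2real z" using assms(1) by (metis enn2real_nonneg ennreal_le_iff)
  show "enn2real z \<le> b" using assms(2,3) by (metis enn2real_leI)
qed

lemma abs_ln_diff_le:
  fixes x y m :: real
  assumes "x > 0" "y > 0" "x \<le> exp m * y" "y \<le> exp m * x"
  shows "\<bar>ln x - ln y\<bar> \<le> m"
proof -
  have "ln x \<le> ln (exp m * y)" "ln y \<le> ln (exp m * x)" using assms by (simp_all add: ln_le_cancel_iff)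
  then show ?thesis using assms by (simp add: ln_mult abs_le_iff)
qed

context polymer
begin

definition logZ :: "real \<Rightarrow> nat \<Rightarrow> ('d::finite) env \<Rightarrow> real" where
  "logZ \<gamma> n \<eta> = ln (enn2real (Zsum \<gamma> \<eta> n))"

lemma logZ_measurable [measurable]: "logZ \<gamma> n \<in> borel_measurable (envQ p)"
  unfolding logZ_def by measurable

definition log_const :: real where "log_const = \<bar>ln c1\<bar> + ln \<Gamma>"

lemma abs_logZ_le:
  assumes \<gamma>: "0 \<le> \<gamma>" "\<gamma> \<le> \<Gamma>" and K: "K \<ge> 0" and le: "ennreal (c1 ^ n * exp (- K)) \<le> Zsum \<gamma> \<eta> n"
  shows "enn2real (Zsum \<gamma> \<eta> n) > 0" "\<bar>logZ \<gamma> n \<eta>\<bar> \<le> n * log_const + K"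
proof -
  define z where "z = enn2real (Zsum \<gamma> \<eta> n)"
  have z: "c1 ^ n * exp (- K) \<le> z" "z \<le> \<Gamma> ^ n"
    unfolding z_def using enn2real_bounds[OF le Zsum_le[OF \<gamma>]] \<Gamma>_ge_1 by auto
  have pos: "c1 ^ n * exp (- K) > 0" using c1_bounds by simp
  then show z0: "enn2real (Zsum \<gamma> \<eta> n) > 0" using z by (simp add: z_def)
  have "ln (c1 ^ n * exp (- K)) \<le> ln z" using z pos by (simp add: ln_le_cancel_iff)
  then have lo: "n * ln c1 - K \<le> ln z" using c1_bounds by (simp add: ln_mult ln_realpow)
  have "ln z \<le> ln (\<Gamma> ^ n)" using z pos \<Gamma>_ge_1 by (simp add: ln_le_cancel_iff)
  then have hi: "ln z \<le> n * ln \<Gamma>" using \<Gamma>_ge_1 by (simp add: ln_realpow)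
  have "n * ln \<Gamma> \<ge> 0" using \<Gamma>_ge_1 by simp
  moreover have "real n * (- \<bar>ln c1\<bar>) \<le> n * ln c1" by (intro mult_left_mono) auto
  moreover have "0 \<le> n * \<bar>ln c1\<bar>" by simp
  ultimately show "\<bar>logZ \<gamma> n \<eta>\<bar> \<le> n * log_const + K"
    using lo hi K unfolding logZ_def z_def[symmetric] log_const_def distrib_left mult_minus_right abs_le_iff by linarith
qed

lemma trunc_logZ_concentration:
  assumes ratio: "slice_ratio C \<epsilon>"
    and C: "C > 0" and \<gamma>: "0 \<le> \<gamma>" "\<gamma> \<le> \<Gamma>" and r: "1 \<le> r" and n: "n > 0" and t: "t > 0"
    and M: "M = C * (real r * n powr \<epsilon>) powr (\<alpha> + 1)"
  shows "measure (envQ p) {\<eta> \<in> space (envQ p). \<bar>logZ \<gamma> n (trunc_env B r \<eta>) - (\<integral>\<zeta>. logZ \<gamma> n (trunc_env B r \<zeta>) \<partial>envQ p)\<bar> \<ge> t}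
      \<le> 2 * exp (- 2 * t\<^sup>2 / (n * M\<^sup>2))"
proof -
  let ?F = "\<lambda>\<eta>. logZ \<gamma> n (trunc_env B r \<eta>)"
  let ?J = "\<lambda>k. {Suc k} \<times> (UNIV :: (int ^ 'd) set)"
  have M0: "M > 0" using C r n by (simp add: M)
  have pos: "enn2real (Zsum \<gamma> (trunc_env B r \<eta>) n) > 0" for \<eta>
    by (rule abs_logZ_le(1)[OF \<gamma>, where K = "c2 * (n * real (2 * r) powr \<alpha>)"])
       (use Zsum_lower_bound[OF \<gamma>(1) dense_trunc_env] c2_pos in auto)
  have le: "enn2real (Zsum \<gamma> \<eta> n) \<le> exp M * enn2real (Zsum \<gamma> \<eta>' n)"
    if "dense_env r \<eta>" "dense_env r \<eta>'" "k < n" "\<And>i x. i \<noteq> Suc k \<Longrightarrow> \<eta> (i, x) = \<eta>' (i, x)" for \<eta> \<eta>' k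
  proof -
    have fin: "Zsum \<gamma> \<eta>' n < top" using Zsum_le[OF \<gamma>, of \<eta>' n] by (rule le_less_trans) simp
    have "Zsum \<gamma> \<eta> n \<le> ennreal (exp M) * Zsum \<gamma> \<eta>' n" unfolding M by (rule slice_ratioD[OF ratio \<gamma> r that])
    then have "enn2real (Zsum \<gamma> \<eta> n) \<le> enn2real (ennreal (exp M) * Zsum \<gamma> \<eta>' n)"
      using fin by (intro enn2real_mono) (auto simp: ennreal_mult_less_top)
    then show ?thesis by (simp add: enn2real_mult)
  qed
  interpret prob_family "\<lambda>_ :: nat \<times> (int ^ 'd). measure_pmf (bernoulli_pmf p)"
    by unfold_locales
  show ?thesis
  proof (rule bounded_differences_inequality[where J = ?J and F = ?F, folded envQ_def])
    show "?F \<in> borel_measurable (envQ p)" by measurable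
    show "\<bar>?F \<eta>\<bar> \<le> n * log_const + c2 * (n * real (2 * r) powr \<alpha>)" for \<eta>
      by (rule abs_logZ_le(2)[OF \<gamma>]) (use Zsum_lower_bound[OF \<gamma>(1) dense_trunc_env] c2_pos in auto)
    show "\<bar>?F (resample (?J k) \<eta> \<zeta>) - ?F \<eta>\<bar> \<le> M" if "k < n" for k \<eta> \<zeta>
    proof -
      have "trunc_env B r (resample (?J k) \<eta> \<zeta>) (i, x) = trunc_env B r \<eta> (i, x)" if "i \<noteq> Suc k" for i x
        by (rule trunc_env_local) (use that in \<open>simp add: resample_def\<close>)
      then show ?thesis
        unfolding logZ_def using that by (intro abs_ln_diff_le pos le dense_trunc_env) auto
    qed
    show "?F \<eta> = ?F \<eta>'" if eq: "\<And>i k. k < n \<Longrightarrow> i \<in> ?J k \<Longrightarrow> \<eta> i = \<eta>' i" for \<eta> \<eta>'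
    proof -
      have "Zsum \<gamma> (trunc_env B r \<eta>) n = Zsum \<gamma> (trunc_env B r \<eta>') n"
      proof (rule Zsum_cong, rule trunc_env_local)
        fix j x assume "1 \<le> j" "j \<le> n"
        then show "\<eta> (j, x) = \<eta>' (j, x)" for x by (intro eq[of "j - 1"]) auto
      qed
      then show ?thesis by (simp add: logZ_def)
    qed
    show "disjoint_family ?J" by (auto simp: disjoint_family_on_def)
  qed (use n t M0 in auto)
qed

lemma logZ_trunc_close:
  assumes \<gamma>: "0 \<le> \<gamma>" "\<gamma> \<le> \<Gamma>" and n: "n > 0"
    and good: "\<And>j. 1 \<le> j \<Longrightarrow> j \<le> n \<Longrightarrow> slice_good B r j \<eta>"
    and small: "(c1 * \<Gamma> * expsum (c2 / 2)) ^ n * exp (- (c2 / 2) * (real B / n) powr \<alpha>)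
       \<le> 1 / 2 * (c1 ^ n * exp (- c2 * (n * real (2 * r) powr \<alpha>)))"
  shows "\<bar>logZ \<gamma> n \<eta> - logZ \<gamma> n (trunc_env B r \<eta>)\<bar> \<le> ln 2"
proof -
  define e where "e = (c1 * \<Gamma> * expsum (c2 / 2)) ^ n * exp (- (c2 / 2) * (real B / n) powr \<alpha>)"
  define b where "b = c1 ^ n * exp (- c2 * (n * real (2 * r) powr \<alpha>))"
  define z z' where "z = enn2real (Zsum \<gamma> \<eta> n)" and "z' = enn2real (Zsum \<gamma> (trunc_env B r \<eta>) n)"
  have e0: "e \<ge> 0" using c1_bounds \<Gamma>_ge_1 expsum_ge_1[of "c2 / 2"] c2_pos by (simp add: e_def)
  have fin: "Zsum \<gamma> \<zeta> n < top" for \<zeta> using Zsum_le[OF \<gamma>, of \<zeta> n] by (rule le_less_trans) simp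
  have Z: "Zsum \<gamma> \<eta> n = ennreal z" "Zsum \<gamma> (trunc_env B r \<eta>) n = ennreal z'" "z \<ge> 0" "z' \<ge> 0"
    using fin by (simp_all add: z_def z'_def)
  have agree: "trunc_env B r \<eta> (j, x) = \<eta> (j, x)" if "1 \<le> j" "j \<le> n" "l1norm x \<le> B" for j x
    using good that by (simp add: trunc_env_def)
  have 1: "z \<le> z' + e"
  proof -
    have "ennreal z \<le> ennreal z' + ennreal e"
      using Zsum_trunc[OF \<gamma> n, of B \<eta> "trunc_env B r \<eta>"] agree unfolding Z e_def by auto
    then show ?thesis using Z e0 by (simp flip: ennreal_plus)
  qed
  have 2: "z' \<le> z + e"
  proof -
    have "ennreal z' \<le> ennreal z + ennreal e"
      using Zsum_trunc[OF \<gamma> n, of B "trunc_env B r \<eta>" \<eta>] agree unfolding Z e_def by auto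
    then show ?thesis using Z e0 by (simp flip: ennreal_plus)
  qed
  have b0: "b > 0" using c1_bounds by (simp add: b_def)
  have 3: "b \<le> z'"
    using Zsum_lower_bound[OF \<gamma>(1) dense_trunc_env, of n r B \<eta>] Z unfolding b_def by simp
  have 4: "e \<le> b / 2" using small unfolding e_def b_def by simp
  have z0: "z > 0" "z' > 0" using 1 2 3 4 b0 by linarith+
  have "\<bar>ln z - ln z'\<bar> \<le> ln 2"
    by (rule abs_ln_diff_le) (use z0 1 2 3 4 in auto)
  then show ?thesis by (simp add: logZ_def z_def z'_def)
qed

lemma logZ_concentration_aux:
  assumes ratio: "slice_ratio C \<epsilon>"
    and C: "C > 0" and \<gamma>: "0 \<le> \<gamma>" "\<gamma> \<le> \<Gamma>" and r: "1 \<le> r" and n: "n > 0"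
    and M: "M = C * (real r * n powr \<epsilon>) powr (\<alpha> + 1)"
    and p: "0 \<le> p" "p \<le> q" "q < 1"
    and small: "(c1 * \<Gamma> * expsum (c2 / 2)) ^ n * exp (- (c2 / 2) * (real B / n) powr \<alpha>)
       \<le> 1 / 2 * (c1 ^ n * exp (- c2 * (n * real (2 * r) powr \<alpha>)))"
    and g: "g = n * ((2 * real B + 1) ^ CARD('d) * q ^ r)"
    and D: "D = ln 2 + 2 * c2 * (\<Sum>k. real k powr (2 * \<alpha>) * q ^ k)
        + (2 * n * log_const + c2 * (n * real (2 * r) powr \<alpha>) + 2 * c2 * n\<^sup>2) * g"
    and T: "T > D + ln 2"
  shows "measure (envQ p) {\<eta> \<in> space (envQ p). \<bar>logZ \<gamma> n \<eta> - (\<integral>\<zeta>. logZ \<gamma> n \<zeta> \<partial>envQ p)\<bar> > T}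
      \<le> g + 2 * exp (- 2 * (T - D - ln 2)\<^sup>2 / (n * M\<^sup>2))"
proof -
  interpret prob_space "envQ p :: ('d::finite) env measure" by (rule prob_space_envQ)
  let ?f = "logZ \<gamma> n" and ?f' = "\<lambda>\<eta>. logZ \<gamma> n (trunc_env B r \<eta>)"
  define N where "N = {\<eta> :: ('d::finite) env. \<exists>j\<in>{1..n}. \<not> slice_good B r j \<eta>}"
  have N: "N \<in> sets (envQ p)" unfolding N_def by (intro sets_envQ_Collect) measurable
  have PN: "prob N \<le> g"
  proof -
    have s: "{\<eta> :: ('d::finite) env. \<not> slice_good B r j \<eta>} \<in> sets (envQ p)" for j
      by (intro sets_envQ_Collect) measurable
    have "N = (\<Union>j\<in>{1..n}. {\<eta>. \<not> slice_good B r j \<eta>})" by (auto simp: N_def)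
    then have "prob N = prob (\<Union>j\<in>{1..n}. {\<eta>. \<not> slice_good B r j \<eta>})" by simp
    also have "\<dots> \<le> (\<Sum>j\<in>{1..n}. prob {\<eta>. \<not> slice_good B r j \<eta>})"
      by (intro measure_UNION_le s) simp
    also have "\<dots> \<le> (\<Sum>j\<in>{1..n}. (2 * real B + 1) ^ CARD('d) * q ^ r)"
    proof (rule sum_mono)
      fix j
      have "prob {\<eta>. \<not> slice_good B r j \<eta>} \<le> (2 * real B + 1) ^ CARD('d) * p ^ Suc r"
        using p by (intro measure_slice_not_good) auto
      also have "p ^ Suc r \<le> q ^ r"
      proof -
        have "p * p ^ r \<le> 1 * q ^ r" using p by (intro mult_mono power_mono) auto
        then show ?thesis by simp
      qed
      finally show "prob {\<eta>. \<not> slice_good B r j \<eta>} \<le> (2 * real B + 1) ^ CARD('d) * q ^ r"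
        by (simp add: mult_left_mono)
    qed
    finally show ?thesis by (simp add: g)
  qed
  have close: "\<bar>?f \<eta> - ?f' \<eta>\<bar> \<le> ln 2" if "\<eta> \<notin> N" for \<eta>
    using that by (intro logZ_trunc_close[OF \<gamma> n _ small]) (auto simp: N_def)
  define b where "b = n * log_const + c2 * (n * real (2 * r) powr \<alpha>)"
  have f'b: "\<bar>?f' \<eta>\<bar> \<le> b" for \<eta>
    unfolding b_def by (rule abs_logZ_le(2)[OF \<gamma>]) (use Zsum_lower_bound[OF \<gamma>(1) dense_trunc_env] c2_pos in auto)
  have lc: "log_const \<ge> 0" using \<Gamma>_ge_1 by (simp add: log_const_def)
  define \<rho> where "\<rho> j \<eta> = real (first_open j (\<eta> :: ('d::finite) env))" for j \<eta>
  have [measurable]: "\<rho> j \<in> borel_measurable (envQ p)" for j unfolding \<rho>_def by measurable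
  define S where "S = (\<Sum>k. real k powr (2 * \<alpha>) * q ^ k)"
  have S0: "S \<ge> 0" unfolding S_def using p by (intro suminf_nonneg summable_powr_geometric) auto
  let ?S = "\<lambda>\<eta>. \<Sum>j=1..n. \<rho> j \<eta> powr (2 * \<alpha>)"
  define h where "h \<eta> = ln 2 + (b + n * log_const + 2 * c2 * n\<^sup>2) * indicator N \<eta>
      + (2 * c2 / n) * ?S \<eta>" for \<eta>
  have \<rho>int: "integrable (envQ p) (\<lambda>\<eta>. \<rho> j \<eta> powr (2 * \<alpha>))" "(\<integral>\<eta>. \<rho> j \<eta> powr (2 * \<alpha>) \<partial>envQ p) \<le> S" for j
  proof -
    have le: "(\<integral>\<^sup>+\<eta>. ennreal (\<rho> j \<eta> powr (2 * \<alpha>)) \<partial>envQ p) \<le> ennreal S"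
      unfolding S_def \<rho>_def by (rule first_open_moment[OF p])
    show int: "integrable (envQ p) (\<lambda>\<eta>. \<rho> j \<eta> powr (2 * \<alpha>))"
      by (rule integrableI_bounded) (use le in \<open>auto intro: le_less_trans\<close>)
    have "ennreal (\<integral>\<eta>. \<rho> j \<eta> powr (2 * \<alpha>) \<partial>envQ p) \<le> ennreal S"
      using le nn_integral_eq_integral[OF int] by simp
    then show "(\<integral>\<eta>. \<rho> j \<eta> powr (2 * \<alpha>) \<partial>envQ p) \<le> S" using S0 by (simp add: ennreal_le_iff)
  qed
  have intN: "integrable (envQ p) (indicator N :: _ \<Rightarrow> real)" using N by (simp add: integrable_real_indicator emeasure_eq_measure)
  have hint: "integrable (envQ p) h"
    unfolding h_def using \<rho>int intN by (intro Bochner_Integration.integrable_add integrable_mult_right Bochner_Integration.integrable_sum) auto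
  have Eh: "(\<integral>\<eta>. h \<eta> \<partial>envQ p) \<le> D"
  proof -
    have "(\<integral>\<eta>. h \<eta> \<partial>envQ p) = ln 2 + (b + n * log_const + 2 * c2 * n\<^sup>2) * prob N
        + (2 * c2 / n) * (\<Sum>j=1..n. \<integral>\<eta>. \<rho> j \<eta> powr (2 * \<alpha>) \<partial>envQ p)"
      unfolding h_def using \<rho>int intN N
      by (simp add: Bochner_Integration.integral_add Bochner_Integration.integral_sum prob_space[simplified])
    also have "\<dots> \<le> ln 2 + (b + n * log_const + 2 * c2 * n\<^sup>2) * g + (2 * c2 / n) * (\<Sum>j=1..n. S)"
      using PN lc c2_pos \<rho>int(2) by (intro add_mono mult_left_mono sum_mono order_refl) (auto simp: b_def)
    also have "\<dots> = D" using n unfolding D b_def S_def by (simp add: algebra_simps)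
    finally show ?thesis .
  qed
  have "AE \<eta> in envQ p. \<forall>j\<in>{1..n}. \<not> \<eta> (j, axis_site (first_open j \<eta>) :: int ^ 'd)"
    using p by (intro AE_finite_allI AE_first_open) auto
  then have diff: "AE \<eta> in envQ p. \<bar>?f \<eta> - ?f' \<eta>\<bar> \<le> h \<eta>"
  proof eventually_elim
    case (elim \<eta>)
    have sum0: "0 \<le> (2 * c2 / n) * ?S \<eta>"
      using c2_pos by (intro mult_nonneg_nonneg sum_nonneg) auto
    show ?case
    proof (cases "\<eta> \<in> N")
      case False
      then show ?thesis using close[OF False] sum0 by (simp add: h_def)
    next
      case True
      have "ennreal (c1 ^ n * exp (- (c2 * (2 * (\<Sum>j=1..n. \<rho> j \<eta> powr \<alpha>))))) \<le> Zsum \<gamma> \<eta> n"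
        unfolding \<rho>_def using Zsum_ge_first_open[OF \<gamma>(1), of n \<eta>] elim by auto
      then have "\<bar>?f \<eta>\<bar> \<le> n * log_const + c2 * (2 * (\<Sum>j=1..n. \<rho> j \<eta> powr \<alpha>))"
        using c2_pos by (intro abs_logZ_le(2)[OF \<gamma>]) (auto intro!: mult_nonneg_nonneg sum_nonneg)
      also have "\<dots> \<le> n * log_const + c2 * (2 * (\<Sum>j=1..n. n + \<rho> j \<eta> powr (2 * \<alpha>) / n))"
      proof (intro add_mono mult_left_mono sum_mono order_refl)
        fix j
        define x where "x = \<rho> j \<eta> powr \<alpha>"
        have x0: "x \<ge> 0" by (simp add: x_def)
        have xx: "\<rho> j \<eta> powr (2 * \<alpha>) = x * x" by (simp add: x_def powr_add[symmetric])
        have "x \<le> n + x * x / n"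
        proof (cases "x \<le> n")
          case True
          moreover have "x * x / n \<ge> 0" by simp
          ultimately show ?thesis by linarith
        next
          case False
          then have "x * n \<le> x * x" using x0 by (intro mult_left_mono) auto
          then have "x \<le> x * x / n" using n by (simp add: field_simps)
          then show ?thesis by simp
        qed
        then show "\<rho> j \<eta> powr \<alpha> \<le> n + \<rho> j \<eta> powr (2 * \<alpha>) / n" by (simp add: x_def xx)
      qed (use c2_pos in auto)
      also have "\<dots> = n * log_const + 2 * c2 * n\<^sup>2 + (2 * c2 / n) * ?S \<eta>"
        by (simp add: sum.distrib sum_divide_distrib[symmetric] algebra_simps power2_eq_square)
      finally have "\<bar>?f \<eta>\<bar> \<le> n * log_const + 2 * c2 * n\<^sup>2 + (2 * c2 / n) * ?S \<eta>" .
      moreover have "\<bar>?f \<eta> - ?f' \<eta>\<bar> \<le> \<bar>?f \<eta>\<bar> + b" using f'b[of \<eta>] by linarith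
      moreover have "ln 2 \<ge> (0::real)" by simp
      moreover have "h \<eta> = ln 2 + (b + n * log_const + 2 * c2 * n\<^sup>2) + (2 * c2 / n) * ?S \<eta>"
        using True by (simp add: h_def)
      ultimately show ?thesis by linarith
    qed
  qed
  have f'int: "integrable (envQ p) ?f'"
    by (rule integrable_const_bound[where B = b]) (auto intro!: AE_I2 f'b)
  have dint: "integrable (envQ p) (\<lambda>\<eta>. ?f \<eta> - ?f' \<eta>)"
    by (rule Bochner_Integration.integrable_bound[OF hint]) (use diff in \<open>auto elim: eventually_mono\<close>)
  have fint: "integrable (envQ p) ?f"
    using Bochner_Integration.integrable_add[OF dint f'int] by simp
  have mean: "\<bar>(\<integral>\<eta>. ?f \<eta> \<partial>envQ p) - (\<integral>\<eta>. ?f' \<eta> \<partial>envQ p)\<bar> \<le> D"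
  proof -
    have "\<bar>(\<integral>\<eta>. ?f \<eta> \<partial>envQ p) - (\<integral>\<eta>. ?f' \<eta> \<partial>envQ p)\<bar> = \<bar>\<integral>\<eta>. ?f \<eta> - ?f' \<eta> \<partial>envQ p\<bar>"
      using fint f'int by simp
    also have "\<dots> \<le> (\<integral>\<eta>. \<bar>?f \<eta> - ?f' \<eta>\<bar> \<partial>envQ p)" by (rule integral_abs_bound)
    also have "\<dots> \<le> (\<integral>\<eta>. h \<eta> \<partial>envQ p)" using dint hint diff by (intro integral_mono_AE) auto
    finally show ?thesis using Eh by simp
  qed
  let ?A = "{\<eta> \<in> space (envQ p). \<bar>?f' \<eta> - (\<integral>\<zeta>. ?f' \<zeta> \<partial>envQ p)\<bar> \<ge> T - D - ln 2}"
  have A: "?A \<in> sets (envQ p)" by measurable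
  have "{\<eta> \<in> space (envQ p). \<bar>?f \<eta> - (\<integral>\<zeta>. ?f \<zeta> \<partial>envQ p)\<bar> > T} \<subseteq> N \<union> ?A"
  proof
    fix \<eta> assume \<eta>: "\<eta> \<in> {\<eta> \<in> space (envQ p). \<bar>?f \<eta> - (\<integral>\<zeta>. ?f \<zeta> \<partial>envQ p)\<bar> > T}"
    show "\<eta> \<in> N \<union> ?A"
    proof (cases "\<eta> \<in> N")
      case False
      then show ?thesis using close[OF False] mean \<eta> by (simp add: abs_if split: if_splits)
    qed simp
  qed
  then have "prob {\<eta> \<in> space (envQ p). \<bar>?f \<eta> - (\<integral>\<zeta>. ?f \<zeta> \<partial>envQ p)\<bar> > T} \<le> prob (N \<union> ?A)"
    by (rule finite_measure_mono) (rule sets.Un[OF N A])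
  also have "\<dots> \<le> prob N + prob ?A" by (rule measure_Un_le[OF N A])
  also have "prob ?A \<le> 2 * exp (- 2 * (T - D - ln 2)\<^sup>2 / (n * M\<^sup>2))"
    by (rule trunc_logZ_concentration[OF ratio C \<gamma> r n _ M]) (use T in auto)
  finally show ?thesis using PN by linarith
qed

end

lemma eventually_error_bounds:
  fixes c2 \<epsilon> e s \<kappa> c A L c4 D K \<tau> :: real
  assumes pos: "c2 > 0" "\<epsilon> > 0" "e > 0" "s > 0" "\<kappa> > 0" "c > 0" "A > 0" "L > 0" "c4 > 0" "D > 0" "K > 0" "\<tau> > 0"
  defines "g \<equiv> \<lambda>x::real. x * ((2 * (x * (x powr s + 1)) + 1) powr D * exp (- \<kappa> * x powr \<epsilon>))"
  shows "eventually (\<lambda>x. x * A + ln 2 + c2 * (x * (c4 * x powr e)) \<le> c2 / 2 * x powr (2 + e)) at_top"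
    and "eventually (\<lambda>x. K + (2 * x * L + c2 * (x * (c4 * x powr e)) + 2 * c2 * x\<^sup>2) * g x \<le> x powr \<tau> / 2) at_top"
    and "eventually (\<lambda>x. g x + 2 * exp (- (c * x powr \<epsilon>)) < exp (- (x powr (\<epsilon> / 2)))) at_top"
proof -
  show "eventually (\<lambda>x. x * A + ln 2 + c2 * (x * (c4 * x powr e)) \<le> c2 / 2 * x powr (2 + e)) at_top"
    using pos by real_asymp
  have "((\<lambda>x. (2 * x * L + c2 * (x * (c4 * x powr e)) + 2 * c2 * x\<^sup>2) * g x) \<longlongrightarrow> 0) at_top"
    unfolding g_def using pos by real_asymp
  then have "eventually (\<lambda>x. (2 * x * L + c2 * (x * (c4 * x powr e)) + 2 * c2 * x\<^sup>2) * g x < 1) at_top"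
    by (rule order_tendstoD) simp
  moreover have "eventually (\<lambda>x. K + 1 \<le> x powr \<tau> / 2) at_top" using pos by real_asymp
  ultimately show "eventually (\<lambda>x. K + (2 * x * L + c2 * (x * (c4 * x powr e)) + 2 * c2 * x\<^sup>2) * g x \<le> x powr \<tau> / 2) at_top"
    by eventually_elim linarith
  have "((\<lambda>x. g x * exp (x powr (\<epsilon> / 2))) \<longlongrightarrow> 0) at_top"
    unfolding g_def using pos by real_asymp
  then have "eventually (\<lambda>x. g x * exp (x powr (\<epsilon> / 2)) < 1 / 2) at_top"
    by (rule order_tendstoD) simp
  moreover have "((\<lambda>x. 2 * exp (- (c * x powr \<epsilon>)) * exp (x powr (\<epsilon> / 2))) \<longlongrightarrow> 0) at_top"
    using pos by real_asymp
  then have "eventually (\<lambda>x. 2 * exp (- (c * x powr \<epsilon>)) * exp (x powr (\<epsilon> / 2)) < 1 / 2) at_top"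
    by (rule order_tendstoD) simp
  ultimately show "eventually (\<lambda>x. g x + 2 * exp (- (c * x powr \<epsilon>)) < exp (- (x powr (\<epsilon> / 2)))) at_top"
  proof eventually_elim
    case (elim x)
    then have "(g x + 2 * exp (- (c * x powr \<epsilon>))) * exp (x powr (\<epsilon> / 2)) < 1"
      by (simp add: algebra_simps)
    then show ?case by (simp add: exp_minus field_simps)
  qed
qed

context polymer
begin

lemma logZ_concentration:
  assumes q: "0 < q" "q < 1" and \<delta>: "\<delta> > 0"
  obtains lam :: real and n0 :: nat where "0 < lam" "lam < 1"
    "\<And>n p \<gamma>. n \<ge> n0 \<Longrightarrow> 0 \<le> p \<Longrightarrow> p \<le> q \<Longrightarrow> 0 \<le> \<gamma> \<Longrightarrow> \<gamma> \<le> \<Gamma> \<Longrightarrow>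
       measure (envQ p) {\<eta> \<in> space (envQ p). \<bar>logZ \<gamma> n \<eta> - (\<integral>\<zeta>. logZ \<gamma> n \<zeta> \<partial>envQ p)\<bar> > real n powr (1 / 2 + \<delta>)}
       < exp (- (real n powr lam))"
proof -
  define \<epsilon> where "\<epsilon> = min 1 (\<delta> / (4 * (\<alpha> + 1)))"
  have \<epsilon>: "\<epsilon> > 0" "\<epsilon> \<le> 1" using \<delta> \<alpha>_pos by (simp_all add: \<epsilon>_def)
  have \<epsilon>\<delta>: "2 * \<epsilon> * (\<alpha> + 1) \<le> \<delta> / 2"
  proof -
    have "\<epsilon> \<le> \<delta> / (4 * (\<alpha> + 1))" by (simp add: \<epsilon>_def)
    then show ?thesis using \<alpha>_pos by (simp add: field_simps)
  qed
  have \<epsilon>\<delta>': "\<epsilon> \<le> \<delta>"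
  proof -
    have "0 \<le> \<epsilon> * \<alpha>" using \<epsilon> \<alpha>_pos by simp
    then show ?thesis using \<epsilon>\<delta> \<delta> \<epsilon> by (simp add: algebra_simps)
  qed
  obtain C :: real where C: "C > 0" and ratio: "slice_ratio C \<epsilon>"
    using slice_ratio_exists[OF \<epsilon>(1)] by blast
  define Cm where "Cm = C * 2 powr (\<alpha> + 1)"
  have Cm: "Cm > 0" using C by (simp add: Cm_def)
  define c where "c = 1 / (2 * Cm\<^sup>2)"
  have c: "c > 0" using Cm by (simp add: c_def)
  define \<kappa> where "\<kappa> = - ln q"
  have \<kappa>: "\<kappa> > 0" using q by (simp add: \<kappa>_def)
  define e where "e = \<epsilon> * \<alpha>"
  define s where "s = \<epsilon> + 2 / \<alpha>"
  have es: "e > 0" "s > 0" using \<epsilon> \<alpha>_pos by (simp_all add: e_def s_def add_pos_pos)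
  have s\<alpha>: "s * \<alpha> = 2 + e" using \<alpha>_pos by (simp add: s_def e_def field_simps)
  define c4 where "c4 = (4::real) powr \<alpha>"
  define A where "A = ln (\<Gamma> * expsum (c2 / 2)) + 1"
  have \<Gamma>E: "\<Gamma> * expsum (c2 / 2) \<ge> 1"
    using mult_mono[of 1 \<Gamma> 1 "expsum (c2 / 2)"] \<Gamma>_ge_1 expsum_ge_1[of "c2 / 2"] c2_pos by simp
  then have A: "A > 0" by (simp add: A_def add_nonneg_pos)
  define L where "L = log_const + 1"
  have lc: "log_const \<ge> 0" using \<Gamma>_ge_1 by (simp add: log_const_def)
  then have L: "L > 0" by (simp add: L_def)
  define S where "S = (\<Sum>k. real k powr (2 * \<alpha>) * q ^ k)"
  have S: "S \<ge> 0" unfolding S_def using q by (intro suminf_nonneg summable_powr_geometric) auto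
  define K where "K = ln 2 + ln 2 + 2 * c2 * S"
  have K: "K > 0" using S c2_pos by (simp add: K_def add_pos_nonneg)
  define \<tau> where "\<tau> = 1 / 2 + \<delta>"
  have \<tau>: "\<tau> > 0" using \<delta> by (simp add: \<tau>_def)
  define D0 where "D0 = real CARD('d)"
  have D0: "D0 > 0" by (simp add: D0_def)
  define g where "g x = x * ((2 * (x * (x powr s + 1)) + 1) powr D0 * exp (- \<kappa> * x powr \<epsilon>))" for x :: real
  have c4: "c4 > 0" by (simp add: c4_def)
  note ev = eventually_error_bounds[OF c2_pos \<epsilon>(1) es \<kappa> c A L c4 D0 K \<tau>, folded g_def]
  define E where "E x \<longleftrightarrow> x * A + ln 2 + c2 * (x * (c4 * x powr e)) \<le> c2 / 2 * x powr (2 + e) \<and>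
     K + (2 * x * L + c2 * (x * (c4 * x powr e)) + 2 * c2 * x\<^sup>2) * g x \<le> x powr \<tau> / 2 \<and>
     g x + 2 * exp (- (c * x powr \<epsilon>)) < exp (- (x powr (\<epsilon> / 2)))" for x
  have "eventually E at_top" unfolding E_def by (intro eventually_conj ev)
  then have "eventually (\<lambda>n. E (real n) \<and> n > 0) sequentially"
    by (intro eventually_conj eventually_gt_at_top eventually_compose_filterlim[OF _ filterlim_real_sequentially])
  then obtain n0 where n0: "\<And>n. n \<ge> n0 \<Longrightarrow> E (real n) \<and> n > 0"
    unfolding eventually_sequentially by blast
  show ?thesis
  proof (rule that[of "\<epsilon> / 2" n0])
    show "0 < \<epsilon> / 2" "\<epsilon> / 2 < 1" using \<epsilon> by auto
    fix n :: nat and p \<gamma> :: real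
    assume n: "n \<ge> n0" and p: "0 \<le> p" "p \<le> q" and \<gamma>: "0 \<le> \<gamma>" "\<gamma> \<le> \<Gamma>"
    have n1: "n > 0" and ev1: "real n * A + ln 2 + c2 * (real n * (c4 * real n powr e)) \<le> c2 / 2 * real n powr (2 + e)"
      and ev2: "K + (2 * real n * L + c2 * (real n * (c4 * real n powr e)) + 2 * c2 * (real n)\<^sup>2) * g (real n) \<le> real n powr \<tau> / 2"
      and ev3: "g (real n) + 2 * exp (- (c * real n powr \<epsilon>)) < exp (- (real n powr (\<epsilon> / 2)))"
      using n0[OF n] unfolding E_def by auto
    define x where "x = real n"
    have x1: "x \<ge> 1" using n1 by (simp add: x_def)
    define r where "r = nat \<lceil>x powr \<epsilon>\<rceil>"
    define b where "b = nat \<lceil>x powr s\<rceil>"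
    define B where "B = n * b"
    have x\<epsilon>: "x powr \<epsilon> \<ge> 1" using x1 \<epsilon> by (intro ge_one_powr_ge_zero) auto
    have r: "x powr \<epsilon> \<le> r" "real r \<le> 2 * x powr \<epsilon>"
      using x\<epsilon> unfolding r_def by linarith+
    have r1: "1 \<le> r" using r(1) x\<epsilon> by linarith
    have b: "x powr s \<le> b" "real b \<le> x powr s + 1"
      using powr_ge_zero[of x s] unfolding b_def by linarith+
    have Bn: "real B / n = b" using n1 by (simp add: B_def)
    have r2: "real (2 * r) powr \<alpha> \<le> c4 * x powr e"
    proof -
      have "real (2 * r) powr \<alpha> \<le> (4 * x powr \<epsilon>) powr \<alpha>" using r \<alpha>_pos by (intro powr_mono2) auto
      also have "\<dots> = c4 * x powr e" using x1 by (simp add: powr_mult powr_powr c4_def e_def)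
      finally show ?thesis .
    qed
    have r3: "c2 * (n * real (2 * r) powr \<alpha>) \<le> c2 * (real n * (c4 * real n powr e))"
      using r2 c2_pos unfolding x_def by (intro mult_left_mono) auto
    have small: "(c1 * \<Gamma> * expsum (c2 / 2)) ^ n * exp (- (c2 / 2) * (real B / n) powr \<alpha>)
       \<le> 1 / 2 * (c1 ^ n * exp (- c2 * (n * real (2 * r) powr \<alpha>)))"
    proof -
      have "x powr (2 + e) = (x powr s) powr \<alpha>" by (simp add: powr_powr s\<alpha>)
      also have "\<dots> \<le> real b powr \<alpha>" using b \<alpha>_pos by (intro powr_mono2) auto
      finally have "c2 / 2 * x powr (2 + e) \<le> c2 / 2 * real b powr \<alpha>" using c2_pos by (intro mult_left_mono) auto
      moreover have "real n * ln (\<Gamma> * expsum (c2 / 2)) \<le> real n * A" by (intro mult_left_mono) (simp_all add: A_def)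
      ultimately have le: "real n * ln (\<Gamma> * expsum (c2 / 2)) + - (c2 / 2) * real b powr \<alpha> \<le> - ln 2 + - c2 * (n * real (2 * r) powr \<alpha>)"
        using ev1 r3 by (simp add: x_def)
      have "(\<Gamma> * expsum (c2 / 2)) ^ n * exp (- (c2 / 2) * (real B / n) powr \<alpha>)
          = exp (real n * ln (\<Gamma> * expsum (c2 / 2)) + - (c2 / 2) * real b powr \<alpha>)"
        using \<Gamma>E unfolding Bn exp_add exp_of_nat_mult by simp
      also have "\<dots> \<le> exp (- ln 2 + - c2 * (n * real (2 * r) powr \<alpha>))" using le by simp
      also have "\<dots> = 1 / 2 * exp (- c2 * (n * real (2 * r) powr \<alpha>))" unfolding exp_add by (simp add: exp_minus inverse_eq_divide)
      finally have "c1 ^ n * ((\<Gamma> * expsum (c2 / 2)) ^ n * exp (- (c2 / 2) * (real B / n) powr \<alpha>))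
         \<le> c1 ^ n * (1 / 2 * exp (- c2 * (n * real (2 * r) powr \<alpha>)))"
        using c1_bounds by (intro mult_left_mono) auto
      then show ?thesis by (simp add: power_mult_distrib mult_ac)
    qed
    define G where "G = real n * ((2 * real B + 1) ^ CARD('d) * q ^ r)"
    have G0: "G \<ge> 0" using q by (simp add: G_def)
    have Gg: "G \<le> g (real n)"
    proof -
      have "real B \<le> x * (x powr s + 1)" unfolding B_def x_def[symmetric] of_nat_mult using b x1 by (intro mult_left_mono) (auto simp: x_def)
      then have "(2 * real B + 1) ^ CARD('d) \<le> (2 * (x * (x powr s + 1)) + 1) ^ CARD('d)"
        by (intro power_mono) auto
      also have "\<dots> = (2 * (x * (x powr s + 1)) + 1) powr D0"
        unfolding D0_def using x1 by (subst powr_realpow) (auto intro!: add_nonneg_pos mult_nonneg_nonneg)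
      finally have 1: "(2 * real B + 1) ^ CARD('d) \<le> (2 * (x * (x powr s + 1)) + 1) powr D0" .
      have "q ^ r = exp (- \<kappa> * r)" using q exp_of_nat2_mult[of "ln q" r] by (simp add: \<kappa>_def)
      also have "\<dots> \<le> exp (- \<kappa> * x powr \<epsilon>)" using \<kappa> r by simp
      finally have 2: "q ^ r \<le> exp (- \<kappa> * x powr \<epsilon>)" .
      show ?thesis unfolding G_def g_def x_def[symmetric]
        using 1 2 x1 q by (intro mult_left_mono mult_mono) auto
    qed
    define D where "D = ln 2 + 2 * c2 * (\<Sum>k. real k powr (2 * \<alpha>) * q ^ k)
        + (2 * real n * log_const + c2 * (n * real (2 * r) powr \<alpha>) + 2 * c2 * (real n)\<^sup>2) * G"
    define T where "T = real n powr \<tau>"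
    have DT: "D + ln 2 \<le> T / 2"
    proof -
      have "(2 * real n * log_const + c2 * (n * real (2 * r) powr \<alpha>) + 2 * c2 * (real n)\<^sup>2) * G
         \<le> (2 * real n * L + c2 * (real n * (c4 * real n powr e)) + 2 * c2 * (real n)\<^sup>2) * g (real n)"
        using r3 Gg G0 c2_pos L lc c4 by (intro mult_mono[OF add_mono[OF add_mono]]) (simp_all add: L_def mult_left_mono)
      then show ?thesis using ev2 unfolding D_def K_def S_def[symmetric] T_def by linarith
    qed
    have T0: "T > 0" using n1 by (simp add: T_def)
    define M where "M = C * (real r * n powr \<epsilon>) powr (\<alpha> + 1)"
    have M0: "M > 0" using C r1 n1 by (simp add: M_def)
    have M: "M \<le> Cm * x powr (\<delta> / 2)"
    proof -
      have "(real r * x powr \<epsilon>) powr (\<alpha> + 1) \<le> (2 * x powr (2 * \<epsilon>)) powr (\<alpha> + 1)"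
      proof (rule powr_mono2)
        have "real r * x powr \<epsilon> \<le> (2 * x powr \<epsilon>) * x powr \<epsilon>" using r by (intro mult_right_mono) auto
        then show "real r * x powr \<epsilon> \<le> 2 * x powr (2 * \<epsilon>)"
          by (simp only: mult.assoc powr_add[symmetric] mult_2[of \<epsilon>])
      qed (use \<alpha>_pos in auto)
      also have "\<dots> = 2 powr (\<alpha> + 1) * x powr (2 * \<epsilon> * (\<alpha> + 1))" using x1 by (simp add: powr_mult powr_powr)
      also have "\<dots> \<le> 2 powr (\<alpha> + 1) * x powr (\<delta> / 2)"
        using x1 \<epsilon>\<delta> by (intro mult_left_mono powr_mono) auto
      finally show ?thesis using C by (simp add: M_def Cm_def x_def mult.assoc)
    qed
    have expo: "c * x powr \<epsilon> \<le> 2 * (T - D - ln 2)\<^sup>2 / (n * M\<^sup>2)"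
    proof -
      have "M\<^sup>2 \<le> (Cm * x powr (\<delta> / 2))\<^sup>2" using M M0 by (intro power_mono) auto
      also have "\<dots> = Cm\<^sup>2 * x powr \<delta>" by (simp add: power_mult_distrib power2_eq_square powr_add[symmetric])
      finally have M2: "n * M\<^sup>2 \<le> x * (Cm\<^sup>2 * x powr \<delta>)" unfolding x_def by (intro mult_left_mono) auto
      have "(T / 2)\<^sup>2 \<le> (T - D - ln 2)\<^sup>2" using DT T0 by (intro power_mono) auto
      moreover have "(T / 2)\<^sup>2 = x powr (1 + 2 * \<delta>) / 4"
        by (simp add: T_def x_def power2_eq_square \<tau>_def powr_add[symmetric])
      ultimately have T2: "x powr (1 + 2 * \<delta>) / 2 \<le> 2 * (T - D - ln 2)\<^sup>2" by simp
      have "c * x powr \<epsilon> \<le> c * x powr \<delta>" using c x1 \<epsilon>\<delta>' by (intro mult_left_mono powr_mono) auto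
      also have "\<dots> = (x powr (1 + 2 * \<delta>) / 2) / (x * (Cm\<^sup>2 * x powr \<delta>))"
      proof -
        have "x powr (1 + 2 * \<delta>) = x * x powr \<delta> * x powr \<delta>"
          using x1 by (simp add: powr_add[symmetric] powr_mult_base add.commute)
        then show ?thesis using x1 Cm by (simp add: c_def field_simps)
      qed
      also have "\<dots> \<le> 2 * (T - D - ln 2)\<^sup>2 / (n * M\<^sup>2)"
        using T2 M2 M0 n1 by (intro frac_le) auto
      finally show ?thesis .
    qed
    have "measure (envQ p) {\<eta> \<in> space (envQ p). \<bar>logZ \<gamma> n \<eta> - (\<integral>\<zeta>. logZ \<gamma> n \<zeta> \<partial>envQ p)\<bar> > T}
        \<le> G + 2 * exp (- 2 * (T - D - ln 2)\<^sup>2 / (n * M\<^sup>2))"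
      by (rule logZ_concentration_aux[OF ratio C \<gamma> r1 n1 M_def p q(2) small G_def D_def]) (use DT T0 in auto)
    also have "\<dots> \<le> g (real n) + 2 * exp (- (c * real n powr \<epsilon>))"
      using Gg expo by (intro add_mono mult_left_mono) (auto simp: x_def)
    also note ev3
    finally show "measure (envQ p) {\<eta> \<in> space (envQ p). \<bar>logZ \<gamma> n \<eta> - (\<integral>\<zeta>. logZ \<gamma> n \<zeta> \<partial>envQ p)\<bar> > real n powr (1 / 2 + \<delta>)}
       < exp (- (real n powr (\<epsilon> / 2)))"
      by (simp add: T_def \<tau>_def)
  qed
qed

end

theorem theorem3:
  fixes \<alpha> c2 q \<delta> \<beta>0 :: real
  assumes "\<alpha> > 0" and "c2 > 0"
    and "0 \<le> q" and "q < 1" and "\<delta> > 0"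
  shows "\<exists>C1 C2 lam. C1 > 0 \<and> C2 > 0 \<and> 0 < lam \<and> lam < 1 \<and>
    (\<forall>p \<beta> n. 0 \<le> p \<longrightarrow> p < q \<longrightarrow> \<beta> \<le> ereal \<beta>0 \<longrightarrow>
       measure (envQ p :: (nat \<times> (int ^ 'd) \<Rightarrow> bool) measure)
         {\<eta> \<in> space (envQ p :: (nat \<times> (int ^ 'd) \<Rightarrow> bool) measure).
            \<bar>ln (partition_fn \<alpha> c2 \<beta> n \<eta>)
              - (\<integral>\<zeta>. ln (partition_fn \<alpha> c2 \<beta> n \<zeta>) \<partial>(envQ p :: (nat \<times> (int ^ 'd) \<Rightarrow> bool) measure))\<bar>
            > real n powr (1/2 + \<delta>)}
       < C1 * exp (- C2 * real n powr lam))"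
proof (cases "q = 0")
  case True
  then show ?thesis by (intro exI[of _ "1 / 2"]) auto
next
  case False
  then have q: "0 < q" "q < 1" using assms by auto
  define \<Gamma> where "\<Gamma> = max 1 (exp \<beta>0)"
  interpret polymer \<alpha> c2 \<Gamma> "TYPE('d)"
    using assms by unfold_locales (auto simp: \<Gamma>_def)
  obtain lam :: real and n0 :: nat where lam: "0 < lam" "lam < 1" and main:
    "\<And>n p \<gamma>. n \<ge> n0 \<Longrightarrow> 0 \<le> p \<Longrightarrow> p \<le> q \<Longrightarrow> 0 \<le> \<gamma> \<Longrightarrow> \<gamma> \<le> \<Gamma> \<Longrightarrow>
       measure (envQ p) {\<eta> \<in> space (envQ p :: ('d::finite) env measure). \<bar>logZ \<gamma> n \<eta> - (\<integral>\<zeta>. logZ \<gamma> n \<zeta> \<partial>(envQ p :: ('d::finite) env measure))\<bar> > real n powr (1 / 2 + \<delta>)}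
       < exp (- (real n powr lam))"
    using logZ_concentration[OF q assms(5)] by blast
  define C1 where "C1 = exp (real n0 powr lam) + 1"
  show ?thesis
  proof (rule exI[of _ C1], rule exI[of _ 1], rule exI[of _ lam], intro conjI allI impI, goal_cases)
    case (5 p \<beta> n)
    note p = 5(1,2) and \<beta> = 5(3)
    have \<gamma>: "0 \<le> gamma_of \<beta>" "gamma_of \<beta> \<le> \<Gamma>"
      using \<beta> by (cases \<beta>; auto simp: gamma_of_def \<Gamma>_def le_max_iff_disj)+
    have Z: "ln (partition_fn \<alpha> c2 \<beta> n \<eta>) = logZ (gamma_of \<beta>) n \<eta>" for \<eta> :: "('d::finite) env"
      by (simp add: partition_fn_eq[OF \<gamma>] logZ_def)
    show ?case (is "?P < _")
    proof (cases "n \<ge> n0")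
      case True
      have "?P < exp (- (real n powr lam))"
        unfolding Z using p by (intro main[OF True _ _ \<gamma>]) auto
      also have "\<dots> \<le> C1 * exp (- 1 * real n powr lam)" by (simp add: C1_def)
      finally show ?thesis .
    next
      case False
      interpret prob_space "envQ p :: ('d::finite) env measure" by (rule prob_space_envQ)
      have "?P \<le> 1" by (rule prob_le_1)
      also have "1 \<le> exp (real n0 powr lam) * exp (- 1 * real n powr lam)"
        using False lam powr_mono2[of lam n n0] by (simp flip: exp_add)
      also have "\<dots> < C1 * exp (- 1 * real n powr lam)" by (simp add: C1_def)
      finally show ?thesis .
    qed
  qed (use lam in \<open>auto simp: C1_def add_pos_pos\<close>)
qed

end
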